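(* Let $(u_1, u_2, \ldots, u_k)$ be a $k$-tuple of positive integers such that $\ell c(u_1)-\ell c(u_1-1)\ge \ell c(u_i)-\ell c(u_i-1)$ for all $2\le i\le k$, and let $u_1+\cdots+u_k=u$. Then there is a full circulant quasisymmetric $SOD(4u;\, 4u_1, 4u_2, \ldots, 4u_k)$ over some signed group $S$ that admits a remrep of degree $2^{n}$, where $$n\le \tfrac{3}{13}\log (u_1-1)+\tfrac{3}{13}\sum_{i=2}^k \log (u_i)+8k+2 .$$
   Context: Here $\log$ is to base $2$, with the convention $\log(0)=0$. A signed group $S$ is a group with a distinguished central element of order two, denoted $-1$ (the unit is denoted $1$). The signed group ring $\mathbb{R}[S]$ consists of the finite sums $\sum r_i s_i$ with $r_i\in\mathbb{R}$, $s_i\in P$, where $P$ is a set of coset representatives of $S$ modulo $\langle -1\rangle$, with the identification $-rs=r(-s)$; addition is termwise and multiplication is by linear extension. Conjugation on $\mathbb{R}[S]$ is $\overline{\sum r_i s_i}=\sum r_i s_i^{-1}$. Variables are commuting real indeterminates that commute with elements of $S$ and are fixed by conjugation; for a matrix $A=[a_{ij}]$, $A^*=[\overline{a}_{ji}]$. A signed group orthogonal design $SOD(n;\,u_1,\ldots,u_k)$ over $S$ ($u_i$ positive integers) is a square matrix $X$ of order $n$, each entry of which is $0$ or of the form $\epsilon x_j$ with $\epsilon\in S$, $1\le j\le k$, where $x_1,\ldots,x_k$ are distinct variables, such that $XX^*=\big(\sum_{i=1}^k u_i x_i^2\big)I_n$. It is full if it has no zero entries. For a matrix $A=[a_{ij}]$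 with entries $0$ or $\epsilon x_\ell$ ($\epsilon\in S$), put $|\epsilon x_\ell|=x_\ell$, $|0|=0$ and $\mathrm{abs}(A)=[|a_{ij}|]$; $A$ is quasisymmetric if $\mathrm{abs}(A)=\mathrm{abs}(A^* )$. A matrix is circulant if it has the form $\mathrm{circ}(a_1,\ldots,a_n)=a_1I_n+\sum_{k=1}^{n-1}a_{k+1}U^k$ with $U=\mathrm{circ}(0,1,0,\ldots,0)$ the cyclic shift. $SP_m$ is the signed group of all monomial $\{0,\pm1\}$-matrices of order $m$ (exactly one nonzero entry in each row and column), with distinguished element $-I_m$. A remrep of degree $m$ of $S$ is a group homomorphism $\pi:S\to SP_m$ with $\pi(-1)=-I_m$. A complex Golay number is a positive integer $m$ for which there is a pair of sequences $A=(a_1,\ldots,a_m)$, $B=(b_1,\ldots,b_m)$ with entries in $\{\pm1,\pm i\}\subset\mathbb{C}$ such that $\sum_{r=1}^{m-j}(a_{r+j}\overline{a_r}+b_{r+j}\overline{b_r})=0$ for all $1\le j\le m-1$. For a positive integer $u$, $\ell c(u)$ is the least number of complex Golay numbers (repetitions allowed) that add up to $u$, and $\ell c(0)=0$. *)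

theory Defs
  imports
    Complex_Main
    "HOL-Library.Multiset"
    "HOL-Library.Poly_Mapping"
    "HOL-Algebra.Coset"
    "HOL-Algebra.Ring"
    "Jordan_Normal_Form.Matrix"
begin

section \<open>Signed groups\<close>

record 'g signed_monoid = "'g monoid" +
  neg_one :: 'g  (\<open>\<epsilon>\<index>\<close>)

text \<open>The distinguished element \<open>\<epsilon>\<close> is the element written $-1$ in the literature.\<close>

locale signed_group = group S for S (structure) +
  assumes neg_one_closed: "\<epsilon> \<in> carrier S"
    and neg_one_neq_one: "\<epsilon> \<noteq> \<one>"
    and neg_one_square: "\<epsilon> \<otimes> \<epsilon> = \<one>"
    and neg_one_central: "s \<in> carrier S \<Longrightarrow> \<epsilon> \<otimes> s = s \<otimes> \<epsilon>"

definition signed_perm_group :: "nat \<Rightarrow> int mat signed_monoid" where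
  "signed_perm_group m =
     \<lparr>carrier = {A \<in> carrier_mat m m.
        (\<forall>i<m. \<forall>j<m. A $$ (i, j) \<in> {-1, 0, 1}) \<and>
        (\<forall>i<m. \<exists>!j. j < m \<and> A $$ (i, j) \<noteq> 0) \<and>
        (\<forall>j<m. \<exists>!i. i < m \<and> A $$ (i, j) \<noteq> 0)},
      monoid.mult = (*), one = 1\<^sub>m m, neg_one = - 1\<^sub>m m\<rparr>"

definition remrep :: "('g, 'm) signed_monoid_scheme \<Rightarrow> nat \<Rightarrow> ('g \<Rightarrow> int mat) \<Rightarrow> bool" where
  "remrep S m \<pi> \<longleftrightarrow> \<pi> \<in> hom S (signed_perm_group m) \<and> \<pi> \<epsilon>\<^bsub>S\<^esub> = \<epsilon>\<^bsub>signed_perm_group m\<^esub>"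


section \<open>Signed group rings\<close>

definition coset_reps :: "('g, 'm) signed_monoid_scheme \<Rightarrow> 'g set \<Rightarrow> bool" where
  "coset_reps S P \<longleftrightarrow>
     P \<subseteq> carrier S \<and> (\<forall>C \<in> rcosets\<^bsub>S\<^esub> {\<one>\<^bsub>S\<^esub>, \<epsilon>\<^bsub>S\<^esub>}. \<exists>!p. p \<in> P \<inter> C)"

definition reps :: "('g, 'm) signed_monoid_scheme \<Rightarrow> 'g set" where
  "reps S = (SOME P. coset_reps S P)"

text \<open>
  A formal sum $\sum_{s \in P} r_s s$ over coset representatives is stored as its coefficient
  function, extended to all of \<open>S\<close> by the identification $-rs = r(-s)$: the coefficient at
  \<open>\<epsilon> \<otimes> s\<close> is the negative of the coefficient at \<open>s\<close>. Such a function is determined by its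
  values on \<open>P\<close>, and conversely these values are arbitrary. In this way equality of formal sums
  is equality of functions, and carrier and addition do not mention \<open>P\<close>; the products and
  conjugates below do not depend on \<open>P\<close> either, because \<open>sg_term\<close> respects the identification.

  The coefficients are taken from an arbitrary commutative ring, so that coefficients in
  $\mathbb{R}[x_1,x_2,\ldots]$ give $\mathbb{R}[S]$ with commuting indeterminates adjoined.
\<close>

definition sg_term :: "('g, 'm) signed_monoid_scheme \<Rightarrow> 'r::comm_ring_1 \<Rightarrow> 'g \<Rightarrow> 'g \<Rightarrow> 'r" where
  "sg_term S r s = (\<lambda>t. if t = s then r else if t = \<epsilon>\<^bsub>S\<^esub> \<otimes>\<^bsub>S\<^esub> s then - r else 0)"

definition sg_supp :: "('g, 'm) signed_monoid_scheme \<Rightarrow> ('g \<Rightarrow> 'r::comm_ring_1) \<Rightarrow> 'g set" where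
  "sg_supp S f = {s \<in> reps S. f s \<noteq> 0}"

definition sg_ring :: "('g, 'm) signed_monoid_scheme \<Rightarrow> ('g \<Rightarrow> 'r::comm_ring_1) ring" where
  "sg_ring S =
     \<lparr>carrier = {f. {s. f s \<noteq> 0} \<subseteq> carrier S \<and> finite {s. f s \<noteq> 0} \<and>
                   (\<forall>s \<in> carrier S. f (\<epsilon>\<^bsub>S\<^esub> \<otimes>\<^bsub>S\<^esub> s) = - f s)},
      monoid.mult = (\<lambda>f g t. \<Sum>a \<in> sg_supp S f. \<Sum>b \<in> sg_supp S g.
                       sg_term S (f a * g b) (a \<otimes>\<^bsub>S\<^esub> b) t),
      one = sg_term S 1 \<one>\<^bsub>S\<^esub>,
      zero = (\<lambda>_. 0),
      add = (\<lambda>f g t. f t + g t)\<rparr>"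

definition sg_conj :: "('g, 'm) signed_monoid_scheme \<Rightarrow> ('g \<Rightarrow> 'r::comm_ring_1) \<Rightarrow> 'g \<Rightarrow> 'r" where
  "sg_conj S f = (\<lambda>t. \<Sum>a \<in> sg_supp S f. sg_term S (f a) (inv\<^bsub>S\<^esub> a) t)"

text \<open>Real polynomials in the indeterminates \<open>var 0, var 1, \<dots>\<close>; the exponent vectors
  have type \<open>nat \<Rightarrow>\<^sub>0 nat\<close>.\<close>

type_synonym rpoly = "(nat \<Rightarrow>\<^sub>0 nat) \<Rightarrow>\<^sub>0 real"

definition var :: "nat \<Rightarrow> rpoly" where
  "var i = Poly_Mapping.single (Poly_Mapping.single i 1) 1"


section \<open>Matrices over a ring\<close>

definition ring_mat_one :: "('a, 'b) ring_scheme \<Rightarrow> nat \<Rightarrow> 'a mat" where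
  "ring_mat_one R n = mat n n (\<lambda>(i, j). if i = j then \<one>\<^bsub>R\<^esub> else \<zero>\<^bsub>R\<^esub>)"

definition ring_mat_mult :: "('a, 'b) ring_scheme \<Rightarrow> 'a mat \<Rightarrow> 'a mat \<Rightarrow> 'a mat" where
  "ring_mat_mult R A B = mat (dim_row A) (dim_col B)
     (\<lambda>(i, j). \<Oplus>\<^bsub>R\<^esub>l \<in> {..<dim_col A}. A $$ (i, l) \<otimes>\<^bsub>R\<^esub> B $$ (l, j))"

primrec ring_mat_pow :: "('a, 'b) ring_scheme \<Rightarrow> nat \<Rightarrow> 'a mat \<Rightarrow> nat \<Rightarrow> 'a mat" where
  "ring_mat_pow R n A 0 = ring_mat_one R n"
| "ring_mat_pow R n A (Suc e) = ring_mat_mult R (ring_mat_pow R n A e) A"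

definition ring_mat_smult :: "('a, 'b) ring_scheme \<Rightarrow> 'a \<Rightarrow> 'a mat \<Rightarrow> 'a mat" where
  "ring_mat_smult R c A = map_mat (\<lambda>a. c \<otimes>\<^bsub>R\<^esub> a) A"

definition cyclic_shift :: "('a, 'b) ring_scheme \<Rightarrow> nat \<Rightarrow> 'a mat" where
  "cyclic_shift R n = mat n n (\<lambda>(i, j). if j = (i + 1) mod n then \<one>\<^bsub>R\<^esub> else \<zero>\<^bsub>R\<^esub>)"

text \<open>The matrix $a_1 I + a_2 U + \cdots + a_n U^{n-1}$, with \<open>U\<close> the cyclic shift.\<close>

definition circ :: "('a, 'b) ring_scheme \<Rightarrow> nat \<Rightarrow> (nat \<Rightarrow> 'a) \<Rightarrow> 'a mat" where
  "circ R n a = mat n n (\<lambda>(i, j). \<Oplus>\<^bsub>R\<^esub>l \<in> {..<n}.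
     ring_mat_smult R (a (l + 1)) (ring_mat_pow R n (cyclic_shift R n) l) $$ (i, j))"

definition circulant :: "('a, 'b) ring_scheme \<Rightarrow> nat \<Rightarrow> 'a mat \<Rightarrow> bool" where
  "circulant R n A \<longleftrightarrow> (\<exists>a. (\<forall>l \<in> {1..n}. a l \<in> carrier R) \<and> A = circ R n a)"


section \<open>Signed group orthogonal designs\<close>

definition sg_adjoint :: "('g, 'm) signed_monoid_scheme \<Rightarrow> ('g \<Rightarrow> 'r::comm_ring_1) mat \<Rightarrow> ('g \<Rightarrow> 'r) mat" where
  "sg_adjoint S A = map_mat (sg_conj S) (transpose_mat A)"

text \<open>\<open>sod S n k u X\<close>: the matrix \<open>X\<close> is an $SOD(n; u_1, \ldots, u_k)$ over \<open>S\<close>.\<close>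

definition sod ::
  "('g, 'm) signed_monoid_scheme \<Rightarrow> nat \<Rightarrow> nat \<Rightarrow> (nat \<Rightarrow> nat) \<Rightarrow> ('g \<Rightarrow> rpoly) mat \<Rightarrow> bool" where
  "sod S n k u X \<longleftrightarrow>
     X \<in> carrier_mat n n \<and>
     (\<forall>i \<in> {1..k}. u i > 0) \<and>
     (\<forall>i<n. \<forall>j<n. X $$ (i, j) = \<zero>\<^bsub>sg_ring S\<^esub> \<or>
        (\<exists>s \<in> carrier S. \<exists>l \<in> {1..k}. X $$ (i, j) = sg_term S (var l) s)) \<and>
     ring_mat_mult (sg_ring S) X (sg_adjoint S X) =
       ring_mat_smult (sg_ring S)
         (sg_term S (\<Sum>i=1..k. of_nat (u i) * (var i)\<^sup>2) \<one>\<^bsub>S\<^esub>) (ring_mat_one (sg_ring S) n)"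

definition full :: "('g, 'm) signed_monoid_scheme \<Rightarrow> ('g \<Rightarrow> rpoly) mat \<Rightarrow> bool" where
  "full S X \<longleftrightarrow> (\<forall>i < dim_row X. \<forall>j < dim_col X. X $$ (i, j) \<noteq> \<zero>\<^bsub>sg_ring S\<^esub>)"

text \<open>$|\epsilon x_l| = x_l$ and $|0| = 0$; meaningful only for elements of these two forms.\<close>

definition sg_abs :: "('g, 'm) signed_monoid_scheme \<Rightarrow> ('g \<Rightarrow> rpoly) \<Rightarrow> rpoly" where
  "sg_abs S f = (if f = \<zero>\<^bsub>sg_ring S\<^esub> then 0
     else (THE x. \<exists>l. \<exists>s \<in> carrier S. f = sg_term S (var l) s \<and> x = var l))"

definition quasisymmetric :: "('g, 'm) signed_monoid_scheme \<Rightarrow> ('g \<Rightarrow> rpoly) mat \<Rightarrow> bool" where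
  "quasisymmetric S A \<longleftrightarrow> map_mat (sg_abs S) A = map_mat (sg_abs S) (sg_adjoint S A)"


section \<open>Complex Golay numbers\<close>

definition complex_golay_pair :: "nat \<Rightarrow> (nat \<Rightarrow> complex) \<Rightarrow> (nat \<Rightarrow> complex) \<Rightarrow> bool" where
  "complex_golay_pair m a b \<longleftrightarrow>
     (\<forall>r \<in> {1..m}. a r \<in> {1, -1, \<i>, -\<i>} \<and> b r \<in> {1, -1, \<i>, -\<i>}) \<and>
     (\<forall>j \<in> {1..m-1}. (\<Sum>r = 1..m-j. a (r + j) * cnj (a r) + b (r + j) * cnj (b r)) = 0)"

definition complex_golay_number :: "nat \<Rightarrow> bool" where
  "complex_golay_number m \<longleftrightarrow> m > 0 \<and> (\<exists>a b. complex_golay_pair m a b)"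

text \<open>The least number of complex Golay numbers that add up to \<open>u\<close>; every \<open>u\<close> is such a sum
  because 1 is a complex Golay number, and the empty sum gives \<open>lc 0 = 0\<close>.\<close>

definition lc :: "nat \<Rightarrow> nat" where
  "lc u = (LEAST c. \<exists>M. size M = c \<and> (\<forall>m \<in># M. complex_golay_number m) \<and> sum_mset M = u)"

definition lg :: "nat \<Rightarrow> real" where
  "lg x = (if x = 0 then 0 else log 2 (real x))"

end

theory Submission
  imports Defs
begin

text \<open>
  Work in the group ring of the cyclic group of order N = 4u over R[S], with t the generator,
  h = t^(N/2), and * the involution that inverts t and conjugates coefficients.  Let S contain a
  central square root I of -1 and anticommuting involutions E_v.  If the self-adjoint elements W_v
  have coefficients in {0, 1, -1, i, -i} and pairwise disjoint supports covering the cyclic group,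
  then X = sum_v x_(c(v)) E_v W_v satisfies X X* = sum_v x_(c(v))^2 W_v^2, because the mixed terms
  cancel by anticommutation.  Moreover X is quasisymmetric since the support of each W_v is symmetric.

  A sequence C placed on 1, ..., u - 1 gives two such elements, C + C* and i h (C - C*), whose squares
  add up to 4 C C*; the remaining positions 0, N/4, N/2, 3N/4 carry 1 + h and i (t^(N/4) - t^(-N/4)),
  whose squares add up to 4.  So it suffices to split u - 1 positions, u_1 - 1 of the first colour
  and u_i of the i-th one, into few complementary sequences: Q of them need 2Q + 2 involutions, which
  exist in dimension 2^(Q + 2).  A complex Golay pair of length g gives two sequences on 2g positions.
  Golay pairs of lengths 1, 3, 5, 11, 13 and the product g, h |-> 2gh give all lengths
  2^a 3^b 5^c 11^d 13^e with b + c + d + e <= a + 1.  These are dense enough that taking away a suitable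
  one leaves at most the 407th part of the remaining number, and 407^3 > 2^26 gives the factor 3/13.
\<close>


section \<open>Complex Golay pairs\<close>

text \<open>With D = C*, the elements C + D and C - D have the same support. Multiplying the second
  by h moves it onto the arcs that are still free, and i makes it self-adjoint; as h^2 = 1, the
  squares give (C + D)^2 - (C - D)^2 = 4 C D. The left-over positions form one more quadruple, and
  giving it the first colour is what turns u_1 into u_1 - 1 in the bound.

  The constants are balanced against each other. Golay pairs fill an even number of positions, so
  with v the integral part of u_i/2, a sum of c Golay numbers for v costs 2c sequences, and one more
  if u_i is odd. From c <= 47/13 + (3/26) log v and log v <= log u_i - 1 the total is at most 94/13
  + 1 - 3/13 + (3/13) log u_i = 8 + (3/13) log u_i. Hence 47/13 is the largest constant that the 8
  for each colour permits. Taking away one Golay number has to lower (3/26) log v by 1, that is, to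
  divide v by 2^(26/3), and 407 is the least integer above this number. The argument by division
  starts at 2^40; smaller numbers are settled by explicit coverings.\<close>

definition quaternary :: "complex set" where
  "quaternary = {1, -1, \<i>, -\<i>}"

abbreviation list_eval :: "complex \<Rightarrow> complex list \<Rightarrow> complex" where
  "list_eval z xs \<equiv> horner_sum (\<lambda>a. a) z xs"

text \<open>Phrased through power spectra instead of vanishing autocorrelations, so that multiplying
  pairs reduces to an identity between complex numbers at each point of the unit circle.\<close>

definition golay :: "nat \<Rightarrow> bool" where
  "golay g \<longleftrightarrow> (\<exists>A B. length A = g \<and> length B = g \<and> set A \<subseteq> quaternary \<and> set B \<subseteq> quaternary \<and>
     (\<forall>z. cmod z = 1 \<longrightarrow> (cmod (list_eval z A))\<^sup>2 + (cmod (list_eval z B))\<^sup>2 = 2 * real g))"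

lemma quaternary_closed:
  assumes "x \<in> quaternary"
  shows "cnj x \<in> quaternary" "- x \<in> quaternary" "\<i> * x \<in> quaternary"
    "y \<in> quaternary \<Longrightarrow> x * y \<in> quaternary"
  using assms by (auto simp: quaternary_def)

lemma quaternary_norm: "x \<in> quaternary \<Longrightarrow> cmod x = 1"
  by (auto simp: quaternary_def)

fun list_add :: "'a::plus list \<Rightarrow> 'a list \<Rightarrow> 'a list" where
  "list_add [] ys = ys"
| "list_add xs [] = xs"
| "list_add (x # xs) (y # ys) = (x + y) # list_add xs ys"

text \<open>The entry with index j is the aperiodic autocorrelation at shift j + 1. The zero shift
  is left out, hence the extra factor z in \<open>norm_list_eval_square\<close>.\<close>

fun autocorr :: "complex list \<Rightarrow> complex list" where
  "autocorr [] = []"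
| "autocorr (a # A) = list_add (map ((*) (cnj a)) A) (autocorr A)"

lemma list_eval_add: "list_eval z (list_add xs ys) = list_eval z xs + list_eval z ys"
  by (induction xs ys rule: list_add.induct) (auto simp: algebra_simps)

lemma list_eval_smult: "list_eval z (map ((*) c) xs) = c * list_eval z xs"
  by (induction xs) (auto simp: algebra_simps)

lemma norm_list_eval_square:
  assumes "cmod z = 1" "set A \<subseteq> quaternary"
  shows "(cmod (list_eval z A))\<^sup>2 = real (length A) + 2 * Re (z * list_eval z (autocorr A))"
  using assms(2)
proof (induction A)
  case (Cons a A)
  have a: "a * cnj a = 1" using Cons.prems quaternary_norm[of a] by (simp add: complex_norm_square[symmetric])
  have z: "z * cnj z = 1" using assms(1) by (simp add: complex_norm_square[symmetric])
  have "(cmod (a + z * list_eval z A))\<^sup>2 = (cmod a)\<^sup>2 + (cmod z)\<^sup>2 * (cmod (list_eval z A))\<^sup>2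
     + 2 * Re (z * (cnj a * list_eval z A))"
    unfolding cmod_power2 by (simp add: power2_eq_square algebra_simps)
  then show ?case using Cons assms(1) quaternary_norm[of a]
    by (simp add: list_eval_add list_eval_smult algebra_simps)
qed simp

lemma list_eval_replicate_zero: "list_eval z (replicate n 0) = 0"
  by (induction n) auto

text \<open>Turns the condition on the whole circle into a finite computation: off the zero shift
  the two spectra cancel, and each zero shift contributes the length.\<close>

lemma golayI:
  assumes "length A = g" "length B = g" "set A \<subseteq> quaternary" "set B \<subseteq> quaternary"
    "set (list_add (autocorr A) (autocorr B)) \<subseteq> {0}"
  shows "golay g"
proof -
  have "list_eval z (list_add (autocorr A) (autocorr B)) = 0" for z
    using assms(5) by (metis list_eval_replicate_zero replicate_length_same singletonD subsetD)
  then have "Re (z * (list_eval z (autocorr A) + list_eval z (autocorr B))) = 0" for z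
    unfolding list_eval_add by simp
  then have sum: "Re (z * list_eval z (autocorr A)) + Re (z * list_eval z (autocorr B)) = 0" for z
    unfolding distrib_left plus_complex.sel .
  have "(cmod (list_eval z A))\<^sup>2 + (cmod (list_eval z B))\<^sup>2 = 2 * real g" if "cmod z = 1" for z
    using sum[of z] norm_list_eval_square[OF that assms(3)] norm_list_eval_square[OF that assms(4)]
      assms(1,2) by linarith
  then show ?thesis unfolding golay_def using assms(1-4) by blast
qed

lemma golay_1: "golay 1"
  by (rule golayI[of "[1]" _ "[1]"]) (auto simp: quaternary_def)

lemma golay_3: "golay 3"
  by (rule golayI[of "[1, 1, -1]" _ "[1, \<i>, 1]"]) (auto simp: quaternary_def)

lemma golay_5: "golay 5"
  by (rule golayI[of "[1, \<i>, \<i>, 1, -\<i>]" _ "[1, 1, \<i>, -\<i>, \<i>]"]) (auto simp: quaternary_def)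

lemma golay_11: "golay 11"
  by (rule golayI[of "[1, \<i>, -1, 1, -1, \<i>, -\<i>, -1, \<i>, \<i>, 1]" _
        "[1, 1, -\<i>, -\<i>, -\<i>, 1, 1, \<i>, -1, 1, -1]"]) (auto simp: quaternary_def)

lemma golay_13: "golay 13"
  by (rule golayI[of "[1, 1, 1, \<i>, -1, 1, 1, -\<i>, 1, -1, 1, -\<i>, \<i>]" _
        "[1, \<i>, -1, -1, -1, \<i>, -1, 1, 1, -\<i>, -1, 1, -\<i>]"]) (auto simp: quaternary_def)

section \<open>Products of Golay pairs\<close>

definition list_kron :: "complex list \<Rightarrow> complex list \<Rightarrow> complex list" where
  "list_kron A C = concat (map (\<lambda>a. map ((*) a) C) A)"

lemma length_list_kron: "length (list_kron A C) = length A * length C"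
  by (induction A) (auto simp: list_kron_def)

lemma set_list_kron: "set A \<subseteq> quaternary \<Longrightarrow> set C \<subseteq> quaternary \<Longrightarrow> set (list_kron A C) \<subseteq> quaternary"
  by (auto simp: list_kron_def intro: quaternary_closed)

lemma list_eval_kron: "list_eval z (list_kron A C) = list_eval (z ^ length C) A * list_eval z C"
  by (induction A) (auto simp: list_kron_def horner_sum_append list_eval_smult algebra_simps)

text \<open>On the unit circle the conjugate of z is its inverse, so reversal and conjugation
  conjugate the value up to a power of z. The factor z on the left spares the truncated exponent
  \<open>length D - 1\<close>.\<close>

lemma list_eval_rev_cnj:
  assumes "cmod z = 1"
  shows "list_eval z (map cnj (rev D)) * z = z ^ length D * cnj (list_eval z D)"
proof (induction D)
  case (Cons d D)
  have z: "z * cnj z = 1" using assms by (simp add: complex_norm_square[symmetric])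
  have "list_eval z (map cnj (rev (d # D))) * z
      = list_eval z (map cnj (rev D)) * z + z * z ^ length D * cnj d"
    by (simp add: horner_sum_append algebra_simps)
  also have "\<dots> = z ^ length D * (z * cnj z) * cnj (list_eval z D) + z * z ^ length D * cnj d"
    by (simp add: Cons z)
  finally show ?case by (simp add: algebra_simps)
qed simp

text \<open>The multiplicativity of the quaternion norm, with quaternions written as pairs of
  complex numbers.\<close>

lemma four_square_complex:
  "(cmod (a * c + b * d))\<^sup>2 + (cmod (a * cnj d - b * cnj c))\<^sup>2
     = ((cmod a)\<^sup>2 + (cmod b)\<^sup>2) * ((cmod c)\<^sup>2 + (cmod d)\<^sup>2)"
  unfolding cmod_power2 by (simp add: power2_eq_square algebra_simps)

text \<open>Concatenating Kronecker products, instead of adding them, keeps all entries quaternary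
  and costs the factor 2 in the length. The second sequence takes reversed conjugates, so that the
  two values have the shape required by \<open>four_square_complex\<close>.\<close>

lemma golay_double_mult:
  assumes "golay g" "golay h"
  shows "golay (2 * g * h)"
proof -
  obtain A B where AB: "length A = g" "length B = g" "set A \<subseteq> quaternary" "set B \<subseteq> quaternary"
     "\<And>z. cmod z = 1 \<Longrightarrow> (cmod (list_eval z A))\<^sup>2 + (cmod (list_eval z B))\<^sup>2 = 2 * real g"
    using assms(1) unfolding golay_def by blast
  obtain C D where CD: "length C = h" "length D = h" "set C \<subseteq> quaternary" "set D \<subseteq> quaternary"
     "\<And>z. cmod z = 1 \<Longrightarrow> (cmod (list_eval z C))\<^sup>2 + (cmod (list_eval z D))\<^sup>2 = 2 * real h"
    using assms(2) unfolding golay_def by blast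
  define C' where "C' = map (\<lambda>x. - cnj x) (rev C)"
  define D' where "D' = map cnj (rev D)"
  define E where "E = list_kron A C @ list_kron B D"
  define F where "F = list_kron A D' @ list_kron B C'"
  have q: "set C' \<subseteq> quaternary" "set D' \<subseteq> quaternary"
    using CD(3,4) by (auto simp: C'_def D'_def intro: quaternary_closed)
  have len: "length E = 2 * g * h" "length F = 2 * g * h"
    using AB CD by (auto simp: E_def F_def length_list_kron C'_def D'_def)
  have set: "set E \<subseteq> quaternary" "set F \<subseteq> quaternary"
    using set_list_kron AB CD q by (auto simp: E_def F_def)
  have "(cmod (list_eval z E))\<^sup>2 + (cmod (list_eval z F))\<^sup>2 = 2 * real (2 * g * h)"
    if z: "cmod z = 1" for z
  proof -
    define a where "a = list_eval (z ^ h) A"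
    \<comment> \<open>The shift of the second block is absorbed into b; it has modulus one.\<close>
    define b where "b = z ^ (g * h) * list_eval (z ^ h) B"
    define c where "c = list_eval z C"
    define d where "d = list_eval z D"
    have zh: "cmod (z ^ h) = 1" using z by (simp add: norm_power)
    have nb: "cmod b = cmod (list_eval (z ^ h) B)"
      using z by (simp add: b_def norm_mult norm_power)
    have C': "list_eval z C' * z = - (z ^ h * cnj c)"
    proof -
      have "C' = map ((*) (-1)) (map cnj (rev C))" by (simp add: C'_def)
      then have "list_eval z C' = - list_eval z (map cnj (rev C))" by (simp only: list_eval_smult) simp
      then show ?thesis using list_eval_rev_cnj[OF z, of C] CD(1) by (simp add: c_def)
    qed
    have D': "list_eval z D' * z = z ^ h * cnj d"
      using list_eval_rev_cnj[OF z, of D] CD(2) by (simp add: d_def D'_def)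
    have E: "list_eval z E = a * c + b * d"
      using AB(1) CD(1,2) by (simp add: E_def horner_sum_append list_eval_kron length_list_kron a_def b_def c_def d_def)
    \<comment> \<open>The additional factor z has modulus one and completes both reversals to the
      common factor \<open>z ^ h\<close>.\<close>
    have "list_eval z F * z = a * (list_eval z D' * z) + b * (list_eval z C' * z)"
      using AB(1) CD(1,2) by (simp add: F_def horner_sum_append list_eval_kron length_list_kron a_def b_def
          C'_def D'_def algebra_simps)
    also have "\<dots> = z ^ h * (a * cnj d - b * cnj c)"
      unfolding C' D' by (simp add: algebra_simps)
    finally have "cmod (list_eval z F * z) = cmod (z ^ h * (a * cnj d - b * cnj c))" by simp
    then have F: "cmod (list_eval z F) = cmod (a * cnj d - b * cnj c)"
      using z zh by (simp add: norm_mult)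
    have "(cmod (list_eval z E))\<^sup>2 + (cmod (list_eval z F))\<^sup>2
        = ((cmod a)\<^sup>2 + (cmod b)\<^sup>2) * ((cmod c)\<^sup>2 + (cmod d)\<^sup>2)"
      unfolding E F by (rule four_square_complex)
    also have "\<dots> = (2 * real g) * (2 * real h)"
      using AB(5)[OF zh] CD(5)[OF z] by (simp add: nb a_def c_def d_def)
    finally show ?thesis by simp
  qed
  then show ?thesis unfolding golay_def using len set by blast
qed

text \<open>Joining a + 1 pairs of lengths 1, 3, 5, 11 or 13 takes a products, and each product
  contributes one factor 2.\<close>

lemma golay_smooth:
  assumes "b + c + d + e \<le> a + 1"
  shows "golay (2 ^ a * 3 ^ b * 5 ^ c * 11 ^ d * 13 ^ e)"
  using assms
proof (induction a arbitrary: b c d e)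
  case 0
  then consider "b = 0" "c = 0" "d = 0" "e = 0" | "b = 1" "c = 0" "d = 0" "e = 0"
    | "b = 0" "c = 1" "d = 0" "e = 0" | "b = 0" "c = 0" "d = 1" "e = 0" | "b = 0" "c = 0" "d = 0" "e = 1"
    by linarith
  then show ?case by cases (use golay_1 golay_3 golay_5 golay_11 golay_13 in auto)
next
  case (Suc a)
  consider "b + c + d + e = 0" | b' where "b = Suc b'" | c' where "c = Suc c'"
    | d' where "d = Suc d'" | e' where "e = Suc e'"
    by (metis add_is_0 not0_implies_Suc)
  then show ?case
  proof cases
    case 1
    then show ?thesis using golay_double_mult[OF golay_1 Suc.IH[of 0 0 0 0]] by simp
  next
    case 2
    then show ?thesis using golay_double_mult[OF golay_3 Suc.IH[of b' c d e]] Suc.prems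
      by (simp add: algebra_simps)
  next
    case 3
    then show ?thesis using golay_double_mult[OF golay_5 Suc.IH[of b c' d e]] Suc.prems
      by (simp add: algebra_simps)
  next
    case 4
    then show ?thesis using golay_double_mult[OF golay_11 Suc.IH[of b c d' e]] Suc.prems
      by (simp add: algebra_simps)
  next
    case 5
    then show ?thesis using golay_double_mult[OF golay_13 Suc.IH[of b c d e']] Suc.prems
      by (simp add: algebra_simps)
  qed
qed

section \<open>Sums of few Golay numbers\<close>

definition golay_sum :: "nat \<Rightarrow> nat \<Rightarrow> bool" where
  "golay_sum c v \<longleftrightarrow> (\<exists>gs. length gs \<le> c \<and> (\<forall>g \<in> set gs. golay g) \<and> sum_list gs = v)"

lemma golay_sum_0: "golay_sum 0 0"
  by (simp add: golay_sum_def)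

lemma golay_sum_add: "golay g \<Longrightarrow> golay_sum c v \<Longrightarrow> golay_sum (Suc c) (g + v)"
  unfolding golay_sum_def by (metis (no_types, lifting) Suc_le_mono length_Cons set_ConsD sum_list.Cons)

lemma golay_sum_mono: "golay_sum c v \<Longrightarrow> c \<le> c' \<Longrightarrow> golay_sum c' v"
  unfolding golay_sum_def by (blast intro: order_trans)

section \<open>Admissible lengths and certificates for their density\<close>

type_synonym exponents = "nat \<times> nat \<times> nat \<times> nat \<times> nat"

fun smooth_value :: "exponents \<Rightarrow> nat" where
  "smooth_value (a, b, c, d, e) = 2 ^ a * 3 ^ b * 5 ^ c * 11 ^ d * 13 ^ e"

fun admissible :: "exponents \<Rightarrow> bool" where
  "admissible (a, b, c, d, e) \<longleftrightarrow> b + c + d + e \<le> a + 1"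

lemma golay_scaled_smooth_value:
  assumes "admissible t"
  shows "golay (2 ^ k * smooth_value t)"
proof -
  obtain a b c d e where t: "t = (a, b, c, d, e)" by (metis prod.collapse)
  have "golay (2 ^ (k + a) * 3 ^ b * 5 ^ c * 11 ^ d * 13 ^ e)"
    by (rule golay_smooth) (use assms t in simp)
  then show ?thesis by (simp add: t power_add algebra_simps)
qed

text \<open>
  A certificate that intervals of length \<open>M\<close> starting at admissible values cover \<open>{r..N}\<close>.
\<close>

fun chain :: "nat \<Rightarrow> nat \<Rightarrow> exponents list \<Rightarrow> nat \<Rightarrow> bool" where
  "chain M r [] N \<longleftrightarrow> N \<le> r"
| "chain M r (t # ts) N \<longleftrightarrow>
     admissible t \<and> smooth_value t \<le> r + 1 \<and> chain M (smooth_value t + M) ts N"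

text \<open>A number beyond r leaves a remainder of at most M once the value of t is removed. The
  bound r + 1 on that value ensures that nothing between two intervals is missed.\<close>

lemma golay_sum_chain_step:
  assumes "\<And>v. v \<le> M \<Longrightarrow> golay_sum c v" "chain M r ts N"
    "\<And>v. v \<le> r \<Longrightarrow> golay_sum (Suc c) v" "v \<le> N"
  shows "golay_sum (Suc c) v"
  using assms(2-)
proof (induction ts arbitrary: r)
  case (Cons t ts)
  have "golay_sum (Suc c) w" if "w \<le> smooth_value t + M" for w
  proof (cases "w \<le> r")
    case False
    then have "w = smooth_value t + (w - smooth_value t)" "w - smooth_value t \<le> M"
      using that Cons.prems(1) by auto
    then show ?thesis
      using golay_sum_add assms(1) golay_scaled_smooth_value[of t 0] Cons.prems(1) by fastforce
  qed (use Cons.prems in simp)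
  then show ?case using Cons by auto
qed (simp add: order_trans)

text \<open>The covering may start at M, because up to there c summands already suffice.\<close>

lemma golay_sum_chain:
  assumes "chain M M ts N" "\<And>v. v \<le> M \<Longrightarrow> golay_sum c v" "v \<le> N"
  shows "golay_sum (c + 1) v"
proof -
  have "golay_sum (Suc c) w" if "w \<le> M" for w
    using assms(2)[OF that] by (rule golay_sum_mono) simp
  then show ?thesis using golay_sum_chain_step[OF assms(2) assms(1) _ assms(3)] by simp
qed

text \<open>
  The subtraction is truncated, so the values need not increase.  One octave of such values suffices,
  since it can be multiplied by powers of two.
\<close>

fun fine_chain :: "nat \<Rightarrow> exponents list \<Rightarrow> nat \<Rightarrow> bool" where
  "fine_chain g [] N \<longleftrightarrow> N \<le> g"
| "fine_chain g (t # ts) N \<longleftrightarrow>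
     admissible t \<and> 407 * (smooth_value t - g) \<le> g \<and> fine_chain (smooth_value t) ts N"

text \<open>If v lies between two neighbouring values g and t, then v - g < t - g, which is at most
  g / 407 and so at most v / 407. All values are scaled by the same power of two.\<close>

lemma fine_chain_approx:
  assumes "fine_chain g ts N" "golay (2 ^ k * g)" "2 ^ k * g \<le> v" "v < 2 ^ k * N"
  shows "\<exists>g'. golay g' \<and> g' \<le> v \<and> 407 * (v - g') \<le> v"
  using assms
proof (induction ts arbitrary: g)
  case Nil
  then have "2 ^ k * N \<le> 2 ^ k * g" by simp
  with Nil show ?case by linarith
next
  case (Cons t ts)
  show ?case
  proof (cases "2 ^ k * smooth_value t \<le> v")
    case True
    then show ?thesis
      using Cons.IH[of "smooth_value t"] Cons.prems golay_scaled_smooth_value[of t k] by simp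
  next
    case False
    have "407 * (2 ^ k * smooth_value t - 2 ^ k * g) = 2 ^ k * (407 * (smooth_value t - g))"
      by (simp add: diff_mult_distrib2)
    also have "\<dots> \<le> 2 ^ k * g" using Cons.prems by simp
    finally have "407 * (v - 2 ^ k * g) \<le> v" using False Cons.prems by linarith
    then show ?thesis using Cons.prems by blast
  qed
qed

text \<open>The exponents in the following lists were found by a greedy computer search.\<close>

lemma smooth_chain_1: "chain 0 0 [(0,0,0,0,0), (1,0,0,0,0), (0,1,0,0,0), (2,0,0,0,0), (0,0,1,0,0), (1,1,0,0,0)] 6"
  by simp

lemma smooth_chain_2: "chain 6 6 [
    (1,1,0,0,0),(0,0,0,0,1),(2,0,1,0,0),(1,0,0,0,1),(5,0,0,0,0),(2,2,0,0,0),(3,0,1,0,0),(2,0,0,1,0),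
    (1,0,2,0,0)] 56"
  by simp

lemma smooth_chain_3: "chain 56 56 [
    (2,0,0,0,1),(2,3,0,0,0),(5,0,1,0,0),(3,3,0,0,0),(3,1,0,1,0),(6,0,1,0,0),(3,2,1,0,0),(5,0,0,0,1),
    (2,2,0,0,1),(3,0,1,0,1),(6,2,0,0,0),(4,1,0,0,1),(2,0,0,0,2),(4,2,1,0,0),(8,1,0,0,0),(5,0,2,0,0),
    (6,0,0,0,1),(4,0,1,1,0),(3,2,0,0,1),(3,0,0,2,0),(10,0,0,0,0),(3,3,1,0,0),(2,0,2,1,0),
    (7,2,0,0,0),(4,1,2,0,0),(5,1,0,0,1),(2,0,2,0,1),(3,0,0,0,2),(7,0,0,1,0),(2,1,0,2,0)] 1508"
  by simp

lemma smooth_chain_4: "chain 1508 1508 [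
    (2,1,0,2,0),(3,1,0,2,0),(4,0,2,1,0),(4,1,0,2,0),(5,2,2,0,0),(6,3,1,0,0),(4,0,4,0,0),(4,0,1,1,1),
    (9,0,2,0,0),(4,4,0,1,0),(4,1,2,0,1),(9,1,0,1,0),(7,0,0,1,1),(5,0,1,2,0),(6,0,2,0,1),(4,0,3,1,0),
    (5,6,0,0,0),(13,1,0,0,0),(4,0,3,0,1),(6,1,0,1,1),(7,2,2,0,0),(4,1,4,0,0),(5,1,2,0,1),
    (6,1,0,0,2),(3,0,2,0,2),(7,0,2,1,0),(8,0,0,1,1),(7,3,0,1,0),(5,5,1,0,0),(6,0,4,0,0),(9,4,0,0,0),
    (5,0,0,3,0),(5,0,3,1,0),(12,0,0,1,0),(7,1,0,2,0),(5,3,1,1,0),(5,2,0,0,2),(4,0,5,0,0),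
    (11,0,2,0,0),(4,3,0,2,0),(12,0,0,0,1),(6,0,1,0,2),(11,3,0,0,0),(10,0,1,1,0),(8,2,2,0,0),
    (5,1,1,2,0),(5,0,0,1,2),(5,1,4,0,0),(12,1,1,0,0),(3,0,1,2,1),(9,0,3,0,0),(7,1,0,0,2)] 66404"
  by simp

lemma smooth_chain_5: "chain 66404 66404 [
    (4,1,3,1,0),(5,1,3,1,0),(16,1,0,0,0),(18,0,0,0,0),(16,0,1,0,0),(17,1,0,0,0),(7,0,2,1,1),
    (5,3,1,2,0),(12,0,0,1,1),(8,1,1,0,2),(7,1,0,1,2),(5,1,4,0,1),(10,1,2,1,0),(6,2,0,2,1),
    (6,0,3,2,0),(5,2,2,1,1),(8,0,2,0,2),(6,0,3,1,1),(8,1,0,2,1),(9,2,2,1,0),(12,0,2,0,1),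
    (8,2,1,2,0),(6,3,1,0,2),(10,3,1,1,0),(7,2,3,1,0),(8,2,1,1,1),(7,5,1,1,0),(16,3,0,0,0),
    (9,0,2,1,1),(6,5,0,2,0),(8,2,1,0,2),(7,0,6,0,0),(6,2,2,1,1),(9,1,3,1,0),(9,0,2,0,2),(6,5,0,1,1),
    (7,0,3,1,1),(14,0,0,1,1),(8,1,5,0,0),(15,1,2,0,0),(6,0,2,2,1),(4,0,0,5,0),(7,1,4,1,0),
    (7,0,3,0,2),(14,0,0,0,2),(11,0,3,1,0),(9,2,4,0,0),(12,0,1,1,1),(12,6,0,0,0),(4,0,0,4,1),
    (9,5,2,0,0),(8,2,3,1,0),(11,0,0,2,1),(17,0,2,0,0),(11,0,3,0,1),(5,0,4,0,2),(6,1,3,1,1),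
    (7,2,2,2,0),(17,3,0,0,0),(16,0,1,1,0),(10,0,2,1,1),(11,1,1,2,0),(5,1,2,2,1),(11,1,4,0,0),
    (9,2,1,0,2),(6,2,4,1,0),(8,0,6,0,0),(6,1,3,0,2),(7,2,2,1,1),(8,3,1,2,0),(10,1,3,1,0),
    (8,2,0,1,2),(10,0,2,0,2),(6,4,1,0,2),(8,0,0,3,1),(9,3,2,0,1),(6,2,1,2,1),(8,0,3,1,1),
    (6,1,0,1,3),(15,0,0,1,1)] 4752228"
  by simp

lemma smooth_chain_6: "chain 4752228 4752228 [
    (7,3,3,1,0),(8,3,3,1,0),(7,4,3,1,0),(9,3,3,1,0),(7,3,4,1,0),(8,4,3,1,0),(16,1,0,0,2),
    (7,3,1,0,3),(17,0,2,0,1),(20,2,1,0,0),(12,1,2,0,2),(21,3,0,0,0),(19,2,0,0,1),(7,1,6,1,0),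
    (7,3,0,2,2),(9,5,1,2,0),(10,0,7,0,0),(12,1,4,1,0),(7,1,3,1,2),(17,0,1,1,1),(18,1,3,0,0),
    (7,2,4,1,1),(14,8,0,0,0),(13,4,0,0,2),(10,3,2,0,2),(11,3,0,0,3),(10,6,0,0,2),(8,0,2,2,2),
    (9,7,0,2,0),(11,4,1,0,2),(19,0,2,1,0),(7,0,4,1,2),(18,2,1,0,1),(8,6,1,0,2),(9,1,4,0,2),
    (12,0,5,0,1),(9,5,3,1,0),(7,0,4,0,3),(17,0,3,1,0),(9,8,1,1,0),(9,7,0,0,2),(9,0,5,2,0),
    (16,0,2,2,0),(7,1,5,0,2),(12,4,4,0,0),(7,4,0,2,2),(11,0,4,0,2),(11,4,0,3,0),(15,0,4,1,0),
    (17,3,1,0,1),(16,0,2,1,1),(16,6,1,0,0),(8,0,1,4,1),(14,0,3,2,0),(11,6,0,0,2),(10,3,1,1,2),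
    (16,1,0,3,0),(15,0,4,0,1),(10,7,0,2,0),(10,1,4,1,1),(11,2,3,2,0),(14,0,0,3,1),(11,2,6,0,0),
    (11,0,1,0,4),(12,1,0,1,3),(6,1,1,1,4),(7,2,0,2,3),(15,6,0,0,1),(22,1,2,0,0),(11,2,0,3,1),
    (12,5,2,0,1),(19,0,4,0,0),(17,1,1,0,2),(9,4,4,0,1),(20,0,2,0,1),(9,1,0,3,2),(12,8,0,0,1),
    (19,3,2,0,0),(15,7,1,0,0),(11,11,0,0,0),(12,0,4,1,1),(8,4,3,1,1),(19,0,1,1,1),(15,4,0,1,1),
    (13,1,6,0,0),(13,6,1,0,1),(8,1,2,2,2),(17,0,2,2,0),(10,0,8,0,0),(10,5,3,0,1),(21,1,1,0,1),
    (18,0,0,2,1),(11,0,6,0,1),(11,5,1,0,2),(13,1,0,3,1),(16,8,0,0,0),(12,0,4,0,2),(10,8,1,0,1),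
    (9,0,7,1,0),(11,9,0,1,0),(13,7,2,0,0),(10,6,1,2,0),(12,4,3,1,0),(14,2,5,0,0),(11,1,4,2,0),
    (17,0,2,1,1),(21,2,2,0,0),(11,0,3,1,2),(9,8,0,1,1),(8,0,6,2,0),(18,0,0,1,2),(18,1,4,0,0),
    (15,0,3,2,0),(8,0,9,0,0),(12,6,0,0,2),(22,0,0,2,0),(15,0,6,0,0),(16,0,1,2,1),(9,0,7,0,1),
    (22,0,3,0,0),(10,1,6,1,0),(16,0,4,0,1),(29,0,0,0,0),(10,0,5,0,2),(23,0,1,0,1),(11,1,4,1,1),
    (17,0,2,0,2),(12,2,3,2,0),(18,1,1,1,1),(15,0,0,3,1),(12,1,2,1,2),(16,3,2,0,1),(8,5,1,1,2),
    (12,7,1,0,1),(15,0,3,1,1),(19,2,3,0,0),(6,0,2,0,5),(17,3,0,0,2),(12,5,1,2,0),(9,6,3,0,1),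
    (16,0,1,1,2),(20,2,1,0,1),(7,0,0,0,6),(12,5,4,0,0),(10,1,6,0,1),(11,1,1,2,2),(8,2,3,0,3),
    (19,5,1,0,0),(11,7,0,1,1),(15,9,0,0,0),(11,1,4,0,2),(10,4,1,2,1),(14,6,1,1,0),(8,1,7,1,0),
    (18,1,1,0,2),(13,3,2,2,0),(14,5,0,0,2),(9,7,1,2,0),(21,0,2,0,1),(13,2,1,1,2),(8,4,2,3,0),
    (9,6,0,1,2),(19,0,0,3,0),(13,1,0,0,4),(12,0,6,1,0),(13,0,1,3,1),(7,1,1,0,5),(9,4,0,3,1),
    (19,0,3,1,0),(12,11,0,0,0),(8,3,4,0,2),(13,0,4,1,1),(21,3,0,0,1),(11,8,1,1,0),(7,0,5,1,2),
    (15,3,1,0,2),(20,0,1,1,1),(12,2,0,2,2),(11,7,0,0,2),(14,0,2,1,2),(20,6,0,0,0),(14,1,6,0,0),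
    (10,4,1,1,2),(11,0,5,2,0),(12,2,3,0,2),(11,5,0,2,1),(21,1,3,0,0),(13,3,2,1,1),(18,0,2,2,0),
    (19,2,0,0,2),(9,7,1,1,1),(28,1,0,0,0),(13,2,1,0,3),(10,8,0,2,0),(10,1,0,2,3),(12,6,2,1,0),
    (19,0,0,2,1),(14,4,4,0,0),(12,0,6,0,1),(11,3,3,2,0),(12,5,1,0,2),(13,1,5,1,0),(21,4,1,0,0),
    (13,6,0,1,1),(11,2,2,1,2),(17,8,0,0,0),(11,3,6,0,0),(13,0,4,0,2),(12,3,1,2,1),(11,8,1,0,1),
    (11,1,1,0,4),(10,0,7,1,0),(18,3,3,0,0),(12,9,0,1,0),(12,2,0,1,3),(8,1,4,1,2)] 897072228"
  by simp

lemma smooth_chain_7: "chain 897072228 897072228 [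
    (14,7,2,0,0),(15,7,2,0,0),(14,8,2,0,0),(16,7,2,0,0),(14,7,3,0,0),(15,8,2,0,0),(14,5,0,2,1),
    (11,1,4,1,2),(7,0,0,0,7),(9,1,5,1,2),(8,1,4,2,2),(10,2,4,1,2),(8,1,4,1,3),(10,8,0,1,2),
    (15,3,3,2,0),(12,1,4,1,2),(13,7,1,0,2),(11,7,2,1,1),(15,1,6,1,0),(12,5,3,1,1),(22,4,1,1,0),
    (11,5,2,2,1),(22,1,3,0,1),(10,6,0,0,4),(14,6,0,1,2),(24,0,3,1,0),(16,2,5,0,1),(19,6,1,0,1),
    (14,0,1,1,4),(17,0,6,0,1),(22,8,0,0,0),(17,9,0,1,0),(12,10,0,2,0),(8,1,3,1,4),(17,6,2,0,1),
    (18,1,5,0,1),(15,6,3,1,0),(20,2,2,1,1),(16,0,5,0,2),(15,9,1,1,0),(15,8,0,0,2),(15,1,5,2,0),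
    (22,1,2,2,0),(13,2,5,0,2),(18,5,4,0,0),(13,5,0,2,2),(13,0,8,0,1),(22,4,3,0,0),(15,7,1,2,0),
    (19,3,5,0,0),(18,0,6,1,0),(15,4,0,3,1),(10,2,8,0,1),(14,7,0,3,0),(22,4,0,1,1),(12,1,2,5,0),
    (11,0,6,2,1),(17,0,8,0,0),(16,8,0,2,0),(12,1,8,1,0),(31,0,2,0,0),(25,0,3,0,1),(19,0,4,0,2),
    (13,0,5,0,3),(14,1,4,1,2),(15,2,3,2,1),(16,3,2,3,0),(17,6,4,0,0),(15,7,1,0,2),(18,1,7,0,0),
    (16,2,4,0,2),(14,3,1,0,4),(13,7,2,1,1),(13,1,6,0,2),(18,3,1,1,2),(14,7,0,1,2),(14,1,4,0,3),
    (10,5,3,0,3),(17,0,5,0,2),(13,4,4,0,2),(16,9,1,1,0),(20,4,1,0,2),(22,0,0,3,1),(9,4,0,6,0),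
    (9,0,7,1,2),(16,6,0,2,1),(13,0,2,0,5),(14,8,1,1,1),(18,3,1,0,3),(23,1,5,0,0),(23,6,0,0,1),
    (8,0,1,0,7),(27,0,1,2,0),(11,6,2,0,3),(20,5,2,0,1),(12,0,1,1,5),(15,1,7,1,0),(12,6,0,0,4),
    (21,5,0,0,2),(14,3,3,2,1),(16,1,5,1,1),(14,9,2,1,0),(16,7,4,0,0),(15,3,1,2,2),(24,2,1,2,0),
    (15,9,0,1,1),(14,1,6,2,0),(20,0,4,1,1),(18,8,1,1,0),(15,7,0,3,0),(14,5,0,1,3),(14,6,4,0,1),
    (11,5,3,2,1),(10,3,3,0,4),(17,5,5,0,0),(13,1,0,1,5),(13,2,4,0,3),(10,1,3,2,3),(10,2,7,1,1),
    (16,1,5,0,2),(13,0,4,2,2),(26,0,0,2,1),(15,10,1,1,0),(12,9,0,3,0),(13,0,7,0,2),(26,0,3,0,1),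
    (14,1,6,1,1),(18,3,6,0,0),(12,0,0,5,2),(12,3,7,0,1),(14,12,0,0,1),(12,1,2,0,5),(23,4,0,0,2),
    (11,5,3,1,2),(15,7,3,0,1),(18,0,5,1,1),(22,2,5,0,0),(9,0,4,0,5),(20,3,2,0,2),(15,5,3,2,0),
    (12,6,5,0,1),(13,6,0,2,2),(17,8,0,1,1),(21,10,0,0,0),(8,0,2,7,0),(21,2,1,3,0),(15,3,1,0,4),
    (10,5,2,2,2),(14,7,2,1,1),(18,9,2,0,0),(14,1,6,0,2),(15,1,1,2,3),(10,3,2,4,1),(11,5,0,2,3),
    (17,0,7,0,1),(18,0,2,2,2),(13,4,6,0,1),(12,7,3,2,0),(24,0,4,0,1),(16,0,0,5,1),(20,4,3,0,1),
    (12,6,2,1,2),(31,0,1,0,1),(16,1,2,0,4),(13,7,1,2,1),(25,0,2,0,2),(10,1,3,0,5),(19,7,3,0,0),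
    (22,0,5,1,0),(14,2,4,2,1),(15,4,2,0,3),(16,0,6,1,1),(24,3,2,0,1),(16,5,1,1,2),(10,0,7,1,2),
    (18,3,3,0,2),(10,5,2,1,3),(11,1,6,2,1),(12,3,4,0,3),(11,6,1,2,2),(30,0,0,1,1),(15,1,1,1,4),
    (17,6,3,0,1),(16,9,0,2,0),(9,1,2,1,5),(11,6,4,0,2),(12,2,8,1,0),(20,5,4,0,0),(12,7,3,1,1),
    (12,0,3,1,4),(14,5,5,0,1),(13,8,2,2,0),(13,1,2,2,3),(12,6,2,0,3),(13,2,6,1,1),(21,5,2,0,1),
    (15,0,8,0,1),(13,0,1,1,5),(22,6,1,1,0),(16,1,7,1,0),(13,13,0,0,1),(13,6,0,0,4),(14,2,4,1,2),
    (13,5,1,3,1),(16,0,6,0,2),(31,4,0,0,0),(14,8,3,0,1),(14,1,3,0,4),(11,7,2,2,1),(21,3,5,0,0),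
    (10,5,2,0,4),(11,1,6,1,2),(17,7,4,0,0),(11,2,10,0,0),(14,6,3,2,0),(30,0,0,0,2),(13,4,3,0,3),
    (14,0,7,1,1),(10,3,2,2,3),(27,0,3,1,0),(9,1,2,0,6),(15,1,6,2,0),(14,6,6,0,0),(21,0,4,1,1),
    (10,2,1,1,5),(34,0,0,1,0),(10,3,5,0,3),(15,0,5,1,2),(21,6,3,0,0),(15,1,9,0,0),(10,1,0,0,7),
    (12,0,8,2,0),(17,3,2,0,3),(14,9,1,2,0),(14,2,1,2,3),(13,7,1,0,3),(14,3,5,1,1),(10,6,0,2,3),
    (11,2,4,3,1),(9,4,0,0,6),(10,0,4,1,4),(16,6,2,0,2),(23,0,0,1,3),(13,5,1,2,2),(12,10,1,0,2),
    (10,4,0,4,2),(11,2,7,1,1),(14,6,0,3,1),(13,11,0,1,1),(11,7,2,1,2),(9,1,1,5,2),(17,6,0,0,3),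
    (15,2,2,0,4),(12,8,1,2,1),(10,2,0,6,1),(20,0,6,0,1),(9,2,3,0,5),(33,0,2,0,0),(13,2,0,3,3),
    (12,7,0,1,3),(10,3,2,1,4),(16,9,0,0,2),(14,5,2,0,3),(10,0,0,8,0),(25,8,0,0,0),(23,4,2,0,1),
    (13,9,3,1,0),(10,2,1,0,6),(25,0,1,3,0),(15,7,5,0,0),(13,3,7,0,1),(16,7,0,2,1),(14,3,2,2,2),
    (20,9,0,1,0),(11,4,4,0,3),(9,0,6,0,4),(22,7,2,0,0),(20,3,4,0,1),(25,0,4,1,0),(12,3,0,5,1),
    (13,1,7,2,0),(16,5,0,4,0),(16,0,3,0,4),(13,6,2,2,1),(11,2,4,2,2),(32,0,1,1,0),(12,4,2,0,4),
    (10,0,4,0,5),(23,7,0,0,1),(21,3,2,0,2),(13,1,10,0,0),(16,5,3,2,0),(14,1,5,2,1),(17,7,1,0,2),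
    (15,3,3,0,3),(20,0,3,1,2),(14,6,0,2,2),(12,2,2,2,3),(20,1,7,0,0),(23,5,0,2,0),(14,0,4,1,3),
    (17,0,6,2,0),(20,6,2,0,1),(18,2,4,0,2),(12,8,1,1,2),(10,4,3,1,3),(15,1,3,2,2),(11,0,7,2,1),
    (14,6,3,0,2),(12,2,5,0,3),(24,0,3,2,0),(11,5,2,2,2),(9,1,4,2,3),(17,0,9,0,0),(10,3,2,0,5),
    (15,0,2,1,4),(19,9,2,0,0),(17,5,4,0,1),(15,1,6,0,2),(16,8,1,2,0),(14,4,3,2,1),(12,0,5,2,2),
    (15,6,1,0,3),(13,2,3,0,4),(12,1,9,1,0),(12,5,0,2,3),(20,4,5,0,0),(18,0,7,0,1),(11,3,0,0,6),
    (10,2,6,1,2),(31,0,3,0,0),(18,5,2,0,2),(16,1,4,0,3),(12,0,8,0,2),(13,7,3,2,0),(10,0,1,1,6),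
    (25,0,4,0,1),(12,5,3,0,3),(10,1,5,0,4)] 275082672228"
  by simp

text \<open>The covering now reaches 2^40, where the octave below begins. The preceding bound just
  exceeds 2^38, which is what eight summands demand: 26 * 8 - 94 = 3 * 38.\<close>

lemma smooth_chain_8: "chain 275082672228 275082672228 [
    (38,0,0,0,0),(39,0,0,0,0),(22,0,3,2,1)] 1099787696228"
  by simp

text \<open>From each value to the next the increase is at most by the factor 408 / 407, and the
  last value passes 2^41.\<close>

lemma smooth_octave: "fine_chain (2 ^ 40) [
    (25,8,1,0,0),(11,4,2,2,3),(23,4,3,0,1),(17,10,0,1,1),(12,6,0,0,5),(15,6,2,1,2),(10,2,2,0,6),
    (21,12,0,0,0),(34,0,1,0,1),(19,8,2,0,1),(15,7,6,0,0),(17,4,4,0,2),(13,3,8,0,1),(15,0,6,0,3),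
    (16,7,1,2,1),(11,3,1,1,5),(15,12,1,0,1),(28,0,2,0,2),(13,6,0,4,1),(11,4,5,0,3),(13,1,3,0,5),
    (16,1,5,1,2),(17,8,0,3,0),(22,7,3,0,0),(16,13,0,1,0),(16,2,9,0,0),(16,6,0,1,3),(11,2,0,0,7),
    (14,2,2,1,4),(18,11,2,0,0),(20,8,0,0,2),(16,7,4,0,1),(9,2,0,7,1),(16,0,4,0,4),(19,0,6,1,1),
    (13,6,3,2,1),(15,3,1,2,3),(11,2,5,2,2),(12,9,0,4,0),(17,8,3,1,0),(12,4,3,0,4),(14,1,1,0,6),
    (10,0,5,0,5),(11,7,0,2,3),(23,7,1,0,1),(19,6,5,0,0),(12,1,1,7,0),(13,1,11,0,0),(13,5,2,1,3),
    (15,2,0,1,5),(19,11,0,0,1),(15,10,4,0,0),(17,7,2,0,2),(13,6,6,0,1),(15,3,4,0,3),(11,2,8,0,2),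
    (20,0,4,1,2),(14,6,1,2,2),(9,2,1,1,6),(13,11,1,0,2),(20,1,8,0,0),(14,7,5,1,0),(16,4,3,1,2),
    (11,0,3,0,6),(22,10,1,0,0),(15,7,0,3,1),(20,6,3,0,1),(14,12,0,1,1),(14,1,9,0,1),(14,5,0,1,4),
    (18,14,0,0,0),(15,1,4,2,2),(11,0,8,2,1),(21,7,2,1,0),(16,3,2,0,4),(12,2,6,0,3),(13,9,1,2,1),
    (24,0,4,2,0),(18,6,1,3,0),(23,5,4,0,0),(16,0,0,7,0),(17,0,10,0,0),(17,4,1,1,3),(12,0,1,0,7),
    (14,10,0,3,0),(19,9,3,0,0),(21,6,1,0,2),(17,5,5,0,1),(10,0,1,7,1),(11,0,11,0,1),(11,4,2,1,4),
    (15,13,2,0,0),(12,0,6,2,2),(22,7,0,1,1),(17,3,0,0,5),(11,1,0,8,0),(12,1,10,1,0),(12,5,1,2,3),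
    (24,5,2,0,1),(20,4,6,0,0),(14,10,3,1,0),(16,7,1,1,2),(11,3,1,0,6),(14,3,3,1,3),(16,0,1,1,5),
    (20,9,1,0,1),(16,8,5,0,0),(18,5,3,0,2),(14,4,7,0,1),(23,0,0,5,0),(17,8,0,2,1),(12,4,0,1,5),
    (16,13,0,0,1),(13,0,4,2,3),(25,0,5,0,1),(19,6,2,1,1),(14,2,2,0,5),(10,1,6,0,4),(13,1,8,1,1),
    (23,8,2,0,0),(25,5,0,0,2),(21,4,4,0,1),(15,10,1,1,1),(19,0,6,0,2),(13,6,3,1,2),(15,3,1,1,4),
    (19,12,1,0,0),(32,0,2,0,1),(17,6,0,4,0),(15,4,5,0,2),(16,11,0,2,0),(16,0,9,1,0),(16,4,0,2,3),
    (11,0,0,1,7),(15,9,0,0,3),(18,9,2,1,0),(13,5,2,0,4),(15,2,0,0,6),(9,0,0,8,1),(30,0,0,3,0),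
    (24,8,0,0,1),(20,7,4,0,0),(13,2,0,7,0),(14,2,10,0,0),(14,6,1,1,3),(9,2,1,0,7),(12,2,3,1,4),
    (16,11,3,0,0),(18,8,1,0,2),(14,7,5,0,1),(16,4,3,0,3),(12,3,7,0,2),(13,10,2,2,0),(15,7,0,2,2),
    (10,3,0,1,6),(14,12,0,0,2),(21,2,7,0,0),(15,8,4,1,0),(17,5,2,1,2),(12,1,2,0,6),(23,11,0,0,0),
    (11,0,8,1,2),(21,7,2,0,1),(17,6,6,0,0),(10,1,2,7,0),(24,0,4,1,1),(18,6,1,2,1),(13,2,1,1,5),
    (17,11,1,0,1),(37,0,0,1,0),(15,7,3,0,2),(17,4,1,0,4),(13,3,5,0,3),(14,10,0,2,1),(18,0,5,1,2),
    (12,6,2,2,2),(24,6,3,0,0),(18,12,0,1,0),(18,1,9,0,0),(18,5,0,1,3),(13,1,0,0,7),(9,0,4,0,6),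
    (20,10,2,0,0),(22,7,0,0,2),(18,6,4,0,1),(11,1,0,7,1),(12,1,10,0,1),(12,5,1,1,4),(16,14,1,0,0),
    (13,1,5,2,2),(14,8,0,4,0),(12,6,5,0,2),(14,3,3,0,4),(16,0,1,0,6),(13,2,9,1,0),(13,6,0,2,3),
    (25,6,1,0,1),(21,5,5,0,0),(14,0,1,7,0),(15,0,11,0,0),(15,4,2,1,3),(10,0,2,0,7),(21,10,0,0,1),
    (17,9,4,0,0),(10,4,0,7,0),(17,2,4,0,3),(13,1,8,0,2),(14,8,3,2,0),(16,5,1,2,2),(11,1,1,1,6),
    (15,10,1,0,2),(22,0,8,0,0),(16,6,5,1,0),(9,1,1,8,0),(23,0,3,2,1),(17,6,0,3,1),(22,5,3,0,1),
    (16,11,0,1,1),(16,0,9,0,1),(16,4,0,1,4),(20,13,0,0,0),(17,0,4,2,2),(11,6,1,3,2),(16,5,4,0,2),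
    (9,0,0,7,2),(17,1,8,1,0),(15,8,1,2,1),(10,4,1,1,5),(14,13,1,0,1),(11,0,5,2,3),(12,7,0,4,1),
    (17,6,3,1,1),(12,2,3,0,5),(15,2,5,1,2),(16,9,0,3,0),(21,8,3,0,0),(15,14,0,1,0),(15,3,9,0,0),
    (15,7,0,1,3),(10,3,0,0,7),(13,3,2,1,4),(17,12,2,0,0),(30,0,3,0,1),(24,6,0,1,1),(13,4,6,0,2),
    (13,0,0,8,0),(14,0,10,1,0),(14,4,1,2,3),(9,0,1,1,7),(13,9,1,0,3),(16,9,3,1,0),(11,5,3,0,4),
    (13,2,1,0,6),(16,2,3,1,3),(12,1,7,1,2),(22,8,1,0,1),(18,7,5,0,0),(11,2,1,7,0),(12,2,11,0,0),
    (12,6,2,1,3),(14,3,0,1,5),(18,12,0,0,1),(31,0,1,0,2),(16,8,2,0,2),(18,5,0,0,4),(14,4,4,0,3),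
    (16,1,2,0,5),(12,0,6,0,4),(13,7,1,2,2),(25,7,2,0,0),(11,3,3,2,3),(23,3,4,0,1),(17,9,1,1,1),
    (12,5,1,0,5),(15,5,3,1,2),(10,1,3,0,6),(20,0,0,6,0),(14,8,0,3,1),(19,7,3,0,1),(15,6,7,0,0),
    (17,3,5,0,2),(18,10,0,2,0),(13,6,0,1,4),(17,15,0,0,0),(14,2,4,2,2),(26,2,5,0,0),(20,8,2,1,0),
    (15,4,2,0,4),(11,3,6,0,3),(13,0,4,0,5),(16,0,6,1,2),(26,7,0,0,1),(22,6,4,0,0),(15,1,0,7,0),
    (16,1,10,0,0),(16,5,1,1,3),(11,1,1,0,7),(13,11,0,3,0),(13,0,9,2,0),(13,4,0,3,3),(18,3,3,0,3),
    (12,9,0,1,3),(15,9,2,2,0),(17,6,0,2,2),(12,2,0,1,6),(16,11,0,0,2),(23,1,7,0,0),(17,7,4,1,0),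
    (10,2,0,8,0),(17,0,4,1,3),(11,6,1,2,3),(23,6,2,0,1),(19,5,6,0,0),(12,0,2,7,0),(13,0,12,0,0),
    (13,4,3,1,3),(15,1,1,1,5),(19,10,1,0,1),(15,9,5,0,0),(17,6,3,0,2),(13,5,7,0,1),(22,1,0,5,0),
    (27,0,3,2,0),(21,6,0,3,0),(9,1,2,1,6),(13,10,2,0,2),(20,0,9,0,0),(14,6,6,1,0),(15,0,0,0,7),
    (12,2,8,1,1),(22,9,2,0,0),(24,6,0,0,2),(20,5,4,0,1),(13,0,0,7,1),(14,0,10,0,1),(14,4,1,1,4),
    (18,13,1,0,0),(15,0,5,2,2),(16,7,0,4,0),(14,5,5,0,2),(15,12,0,2,0),(15,1,9,1,0),(15,5,0,2,3),
    (10,1,0,1,7),(14,10,0,0,3),(21,0,7,0,1),(15,6,4,1,1),(10,2,4,0,5),(29,1,0,3,0),(34,0,3,0,0),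
    (28,6,0,1,0),(17,4,6,0,1),(13,3,10,0,0),(13,7,1,1,3),(16,7,3,2,0),(11,3,3,1,4),(15,12,3,0,0),
    (28,0,4,0,1),(22,6,1,1,1),(17,2,1,0,5),(11,0,1,8,0),(12,0,11,1,0)] (2 ^ 41)"
  by simp


section \<open>The number of summands, first for small and then for all numbers\<close>

lemma golay_sum_1: "v \<le> 6 \<Longrightarrow> golay_sum 1 v"
  using golay_sum_chain[OF smooth_chain_1, of 0 v] golay_sum_0 by simp

lemma golay_sum_2: "v \<le> 56 \<Longrightarrow> golay_sum 2 v"
  using golay_sum_chain[OF smooth_chain_2 golay_sum_1, of v] by (simp add: numeral_2_eq_2)

lemma golay_sum_3: "v \<le> 1508 \<Longrightarrow> golay_sum 3 v"
  using golay_sum_chain[OF smooth_chain_3 golay_sum_2, of v] by simp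

lemma golay_sum_4: "v \<le> 66404 \<Longrightarrow> golay_sum 4 v"
  using golay_sum_chain[OF smooth_chain_4 golay_sum_3, of v] by simp

lemma golay_sum_5: "v \<le> 4752228 \<Longrightarrow> golay_sum 5 v"
  using golay_sum_chain[OF smooth_chain_5 golay_sum_4, of v] by simp

lemma golay_sum_6: "v \<le> 897072228 \<Longrightarrow> golay_sum 6 v"
  using golay_sum_chain[OF smooth_chain_6 golay_sum_5, of v] by simp

lemma golay_sum_7: "v \<le> 275082672228 \<Longrightarrow> golay_sum 7 v"
  using golay_sum_chain[OF smooth_chain_7 golay_sum_6, of v] by simp

lemma golay_sum_8: "v \<le> 1099787696228 \<Longrightarrow> golay_sum 8 v"
  using golay_sum_chain[OF smooth_chain_8 golay_sum_7, of v] by simp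

text \<open>The logarithmic bound without denominators, as 47/13 = 94/26, so that it can be checked
  by integer arithmetic. For c at most 3 the exponent is truncated to 0; truncation only increases
  it, so the conclusion stays valid.\<close>

lemma golay_budget:
  assumes "2 ^ (26 * c - 94) \<le> v ^ 3" "v \<ge> 1"
  shows "real c \<le> 47 / 13 + 3 / 26 * log 2 (real v)"
proof -
  have "(2::real) ^ (26 * c - 94) \<le> real v ^ 3"
    using assms(1) by (metis of_nat_le_iff of_nat_numeral of_nat_power)
  then have "log 2 (2 ^ (26 * c - 94)) \<le> log 2 (real v ^ 3)"
    using assms(2) by (subst log_le_cancel_iff) auto
  then have "real (26 * c - 94) \<le> 3 * log 2 (real v)"
    using assms(2) by (simp add: log_nat_power)
  then show ?thesis by linarith
qed

lemma log_407: "26 / 3 \<le> log 2 (407 :: real)"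
proof -
  have 1: "real 26 * log 2 2 = log 2 (2 ^ 26)" by (rule log_nat_power[symmetric]) simp
  have 2: "log 2 (407 ^ 3) = real 3 * log 2 407" by (rule log_nat_power) simp
  have "log 2 (2 ^ 26) \<le> log 2 (407 ^ 3)" by (subst log_le_cancel_iff) auto
  then show ?thesis unfolding 1[symmetric] 2 by simp
qed

text \<open>Strong induction: one summand is spent on dividing the number by at least 407, which
  lowers the right-hand side by at least one.\<close>

lemma golay_sum_log:
  assumes "v \<ge> 1"
  shows "\<exists>c. golay_sum c v \<and> real c \<le> 47 / 13 + 3 / 26 * log 2 (real v)"
  using assms
proof (induction v rule: less_induct)
  case (less v)
  show ?case
  proof (cases "v < 2 ^ 40")
    case True
    have "\<exists>c. golay_sum c v \<and> 2 ^ (26 * c - 94) \<le> v ^ 3"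
    proof -
      have pow: "m ^ 3 \<le> v ^ 3" if "m \<le> v" for m
        using that by (rule power_mono) simp
      \<comment> \<open>Three summands are always affordable, since 3 < 47/13. Beyond that, the
        lower end of each range must be large enough to afford its number of summands.\<close>
      consider "v \<le> 1508" | "1508 < v" "v \<le> 66404" | "66404 < v" "v \<le> 4752228" | "4752228 < v" "v \<le> 897072228"
        | "897072228 < v" "v \<le> 275082672228" | "275082672228 < v" "v \<le> 1099787696228"
        using True by fastforce
      then show ?thesis
      proof cases
        case 1
        then show ?thesis using golay_sum_3 less.prems by (intro exI[of _ 3]) simp
      next
        case 2
        then show ?thesis using golay_sum_4 pow[of 1508] by (intro exI[of _ 4]) simp
      next
        case 3
        then show ?thesis using golay_sum_5 pow[of 66404] by (intro exI[of _ 5]) simp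
      next
        case 4
        then show ?thesis using golay_sum_6 pow[of 4752228] by (intro exI[of _ 6]) simp
      next
        case 5
        then show ?thesis using golay_sum_7 pow[of 897072228] by (intro exI[of _ 7]) simp
      next
        case 6
        then show ?thesis using golay_sum_8 pow[of 275082672228] by (intro exI[of _ 8]) simp
      qed
    qed
    then show ?thesis using golay_budget less.prems by blast
  next
    case False
    \<comment> \<open>The octave containing v is the certified octave from 2^40 multiplied by a
      power of two.\<close>
    obtain k where k: "2 ^ k \<le> v" "v < 2 ^ (k + 1)"
      using ex_power_ivl1[of 2 v] less.prems by auto
    have "(2::nat) ^ 40 < 2 ^ (k + 1)" using False k by linarith
    then have "40 < k + 1" by (rule power_less_imp_less_exp[rotated]) simp
    then obtain j where j: "k = 40 + j" using le_Suc_ex[of 40 k] by auto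
    have split: "(2::nat) ^ k = 2 ^ j * 2 ^ 40" "(2::nat) ^ (k + 1) = 2 ^ j * 2 ^ 41"
      by (simp_all add: j power_add)
    have "golay (2 ^ j * 2 ^ 40)"
      using golay_scaled_smooth_value[of "(40, 0, 0, 0, 0)" j] by simp
    then obtain g where g: "golay g" "g \<le> v" "407 * (v - g) \<le> v"
      using fine_chain_approx[OF smooth_octave] k unfolding split by blast
    show ?thesis
    \<comment> \<open>An exact hit leaves the remainder 0, to which the induction hypothesis does
      not apply.\<close>
    proof (cases "v = g")
      case True
      then have "golay_sum 1 v" using golay_sum_add[OF g(1) golay_sum_0] by simp
      moreover have "log 2 (real v) \<ge> 0" using less.prems by simp
      ultimately show ?thesis by (intro exI[of _ 1]) simp
    next
      case False
      define w where "w = v - g"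
      have w: "w \<ge> 1" "407 * w \<le> v" "w < v" "v = g + w" using False g unfolding w_def by linarith+
      obtain c where c: "golay_sum c w" "real c \<le> 47 / 13 + 3 / 26 * log 2 (real w)"
        using less.IH[OF w(3,1)] by blast
      have wv: "407 * real w \<le> real v" using w(2) by linarith
      note log_407
      moreover have "log 2 (407 * real w) = log 2 407 + log 2 (real w)" using w by (simp add: log_mult)
      moreover have "log 2 (407 * real w) \<le> log 2 (real v)"
        using w(1) wv by (subst log_le_cancel_iff) auto
      ultimately have "real (Suc c) \<le> 47 / 13 + 3 / 26 * log 2 (real v)" using c(2) by simp
      then show ?thesis using golay_sum_add[OF g(1) c(1)] w(4) by blast
    qed
  qed
qed

section \<open>Complementary sequences and labellings of a cycle\<close>

text \<open>Positions are shared out among Q sequences, every sequence having one colour, and E l is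
  the joint power spectrum of the sequences of colour l. It is kept as a parameter because it is not
  constant when only one half of a Golay pair has been placed.\<close>

definition layout :: "nat \<Rightarrow> nat \<Rightarrow> (nat \<Rightarrow> nat) \<Rightarrow> (nat \<Rightarrow> complex \<Rightarrow> real) \<Rightarrow> bool" where
  "layout M Q m E \<longleftrightarrow> (\<exists>\<sigma> colour z. (\<forall>p<M. \<sigma> p < Q \<and> z p \<in> quaternary) \<and>
     (\<forall>l. card {p. p < M \<and> colour (\<sigma> p) = l} = m l) \<and>
     (\<forall>l \<omega>. cmod \<omega> = 1 \<longrightarrow>
        (\<Sum>q | q < Q \<and> colour q = l. (cmod (\<Sum>p | p < M \<and> \<sigma> p = q. z p * \<omega> ^ p))\<^sup>2) = E l \<omega>))"

lemma layout_cong: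
  assumes "layout M Q m E" "\<And>l \<omega>. cmod \<omega> = 1 \<Longrightarrow> E l \<omega> = E' l \<omega>"
  shows "layout M Q m E'"
  using assms(1) unfolding layout_def by (elim ex_forward) (simp add: assms(2))

text \<open>The new sequence has number Q and takes the fresh positions from M onwards. This shift
  multiplies its value by \<open>\<omega> ^ M\<close>, which does not change the modulus.\<close>

lemma layout_append:
  assumes "layout M Q m E" "set A \<subseteq> quaternary"
  shows "layout (M + length A) (Q + 1) (m(l := m l + length A))
    (\<lambda>l' \<omega>. E l' \<omega> + (if l' = l then (cmod (list_eval \<omega> A))\<^sup>2 else 0))"
proof -
  obtain \<sigma> colour z where L: "\<And>p. p < M \<Longrightarrow> \<sigma> p < Q" "\<And>p. p < M \<Longrightarrow> z p \<in> quaternary"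
    "\<And>l. card {p. p < M \<and> colour (\<sigma> p) = l} = m l"
    "\<And>l \<omega>. cmod \<omega> = 1 \<Longrightarrow>
        (\<Sum>q | q < Q \<and> colour q = l. (cmod (\<Sum>p | p < M \<and> \<sigma> p = q. z p * \<omega> ^ p))\<^sup>2) = E l \<omega>"
    using assms(1) unfolding layout_def by blast
  define \<sigma>' where "\<sigma>' p = (if p < M then \<sigma> p else Q)" for p
  define colour' where "colour' = colour(Q := l)"
  define z' where "z' p = (if p < M then z p else A ! (p - M))" for p
  have 1: "\<sigma>' p < Q + 1 \<and> z' p \<in> quaternary" if "p < M + length A" for p
  proof (cases "p < M")
    case True
    then show ?thesis using L(1,2)[of p] by (simp add: \<sigma>'_def z'_def)
  next
    case False
    then have "A ! (p - M) \<in> set A" using that by (intro nth_mem) simp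
    then show ?thesis using assms(2) False by (auto simp: \<sigma>'_def z'_def)
  qed
  have 2: "card {p. p < M + length A \<and> colour' (\<sigma>' p) = l'} = (m(l := m l + length A)) l'" for l'
  proof -
    have "{p. p < M + length A \<and> colour' (\<sigma>' p) = l'} =
        {p. p < M \<and> colour (\<sigma> p) = l'} \<union> (if l' = l then {M..<M + length A} else {})"
      by (rule Set.set_eqI) (use L(1) in \<open>force simp: \<sigma>'_def colour'_def\<close>)
    also have "card \<dots> = m l' + card (if l' = l then {M..<M + length A} else {})"
      by (subst card_Un_disjoint) (auto simp: L(3))
    finally show ?thesis by simp
  qed
  have 3: "(\<Sum>q | q < Q + 1 \<and> colour' q = l'. (cmod (\<Sum>p | p < M + length A \<and> \<sigma>' p = q. z' p * \<omega> ^ p))\<^sup>2)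
      = E l' \<omega> + (if l' = l then (cmod (list_eval \<omega> A))\<^sup>2 else 0)" if \<omega>: "cmod \<omega> = 1" for l' \<omega>
  proof -
    define G where "G q = (cmod (\<Sum>p | p < M + length A \<and> \<sigma>' p = q. z' p * \<omega> ^ p))\<^sup>2" for q
    have old: "G q = (cmod (\<Sum>p | p < M \<and> \<sigma> p = q. z p * \<omega> ^ p))\<^sup>2" if "q < Q" for q
    proof -
      have "{p. p < M + length A \<and> \<sigma>' p = q} = {p. p < M \<and> \<sigma> p = q}"
        using that by (auto simp: \<sigma>'_def split: if_splits)
      moreover have "(\<Sum>p | p < M \<and> \<sigma> p = q. z' p * \<omega> ^ p) = (\<Sum>p | p < M \<and> \<sigma> p = q. z p * \<omega> ^ p)"
        by (rule sum.cong) (auto simp: z'_def)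
      ultimately show ?thesis by (simp add: G_def)
    qed
    have new: "G Q = (cmod (list_eval \<omega> A))\<^sup>2"
    proof -
      have "{p. p < M + length A \<and> \<sigma>' p = Q} = {M..<M + length A}"
        by (rule Set.set_eqI) (use L(1) in \<open>force simp: \<sigma>'_def\<close>)
      then have "(\<Sum>p | p < M + length A \<and> \<sigma>' p = Q. z' p * \<omega> ^ p) = (\<Sum>p=M..<M + length A. z' p * \<omega> ^ p)"
        by simp
      also have "\<dots> = (\<Sum>p=0..<length A. z' (p + M) * \<omega> ^ (p + M))"
        using sum.shift_bounds_nat_ivl[of "\<lambda>p. z' p * \<omega> ^ p" 0 M "length A"] by (simp add: add.commute)
      also have "\<dots> = (\<Sum>p<length A. \<omega> ^ M * (A ! p * \<omega> ^ p))"
        by (auto simp: z'_def power_add lessThan_atLeast0 intro!: sum.cong)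
      also have "\<dots> = \<omega> ^ M * list_eval \<omega> A"
        by (simp add: horner_sum_eq_sum sum_distrib_left lessThan_atLeast0)
      finally show ?thesis using \<omega> by (simp add: G_def norm_mult norm_power)
    qed
    have "{q. q < Q + 1 \<and> colour' q = l'} = {q. q < Q \<and> colour q = l'} \<union> (if l' = l then {Q} else {})"
      by (auto simp: colour'_def split: if_splits)
    then have "sum G {q. q < Q + 1 \<and> colour' q = l'} =
        sum G {q. q < Q \<and> colour q = l'} + sum G (if l' = l then {Q} else {})"
      by (simp only:) (subst sum.union_disjoint, auto)
    also have "sum G {q. q < Q \<and> colour q = l'} = E l' \<omega>"
      unfolding L(4)[OF \<omega>, symmetric] by (rule sum.cong) (auto simp: old)
    finally show ?thesis by (simp add: G_def[symmetric] new)
  qed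
  show ?thesis unfolding layout_def
    by (rule exI[of _ \<sigma>'], rule exI[of _ colour'], rule exI[of _ z'], intro conjI allI impI) (use 1 in blast, use 1 in blast, rule 2, rule 3)
qed

text \<open>Complementary sequences within each colour.\<close>

definition packing :: "nat \<Rightarrow> nat \<Rightarrow> (nat \<Rightarrow> nat) \<Rightarrow> bool" where
  "packing M Q m \<longleftrightarrow> layout M Q m (\<lambda>l _. real (m l))"

lemma packing_empty: "packing 0 0 (\<lambda>_. 0)"
  by (simp add: packing_def layout_def)

lemma packing_single:
  assumes "packing M Q m"
  shows "packing (M + 1) (Q + 1) (m(l := m l + 1))"
proof -
  have "set [1] \<subseteq> quaternary" by (simp add: quaternary_def)
  from layout_append[OF assms[unfolded packing_def] this, of l]
  have "layout (M + 1) (Q + 1) (m(l := m l + 1)) (\<lambda>l' \<omega>. real (m l') + (if l' = l then 1 else 0))"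
    by (simp cong: if_cong)
  then show ?thesis unfolding packing_def by (rule layout_cong) auto
qed

lemma packing_golay:
  assumes "packing M Q m" "golay g"
  shows "packing (M + 2 * g) (Q + 2) (m(l := m l + 2 * g))"
proof -
  obtain A B where AB: "length A = g" "length B = g" "set A \<subseteq> quaternary" "set B \<subseteq> quaternary"
     "\<And>z. cmod z = 1 \<Longrightarrow> (cmod (list_eval z A))\<^sup>2 + (cmod (list_eval z B))\<^sup>2 = 2 * real g"
    using assms(2) unfolding golay_def by blast
  have "layout (M + 2 * g) (Q + 2) (m(l := m l + 2 * g))
    (\<lambda>l' \<omega>. real (m l') + (if l' = l then (cmod (list_eval \<omega> A))\<^sup>2 else 0)
       + (if l' = l then (cmod (list_eval \<omega> B))\<^sup>2 else 0))"
    using layout_append[OF layout_append[OF assms(1)[unfolded packing_def] AB(3), of l] AB(4), of l] AB(1,2)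
    by (simp add: mult_2 add.assoc)
  then show ?thesis unfolding packing_def
    by (rule layout_cong) (use AB(5) in auto)
qed

lemma packing_golay_list:
  assumes "packing M Q m" "\<forall>g \<in> set gs. golay g"
  shows "packing (M + 2 * sum_list gs) (Q + 2 * length gs) (m(l := m l + 2 * sum_list gs))"
  using assms
proof (induction gs arbitrary: M Q m)
  case (Cons g gs)
  then have p: "packing (M + 2 * g) (Q + 2) (m(l := m l + 2 * g))" by (intro packing_golay) auto
  have "\<forall>g \<in> set gs. golay g" using Cons.prems(2) by simp
  from Cons.IH[OF p this] show ?case
    by (simp only: fun_upd_upd fun_upd_same list.size sum_list.Cons mult_Suc_right distrib_left
        add.assoc add_Suc_right add_0_right)
qed simp

section \<open>Quarters of the cycle and periodic autocorrelation\<close>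

lemma sum_four_arcs:
  fixes F :: "nat \<Rightarrow> 'a::comm_monoid_add"
  shows "(\<Sum>r<4 * Suc n. F r) = F 0 + F (Suc n) + F (2 * Suc n) + F (3 * Suc n) +
    (\<Sum>p<n. F (Suc p) + F (2 * Suc n - Suc p) + F (2 * Suc n + Suc p) + F (4 * Suc n - Suc p))"
proof -
  define u where "u = Suc n"
  have block: "(\<Sum>r<a + u. F r) = (\<Sum>r<a. F r) + (F a + (\<Sum>p<n. F (a + Suc p)))" for a
  proof -
    have "(\<Sum>r<a + u. F r) = (\<Sum>r<a. F r) + (\<Sum>p<u. F (a + p))"
      by (induction u) (auto simp: add_ac)
    then show ?thesis by (simp add: u_def sum.lessThan_Suc_shift del: sum.lessThan_Suc)
  qed
  \<comment> \<open>The second and the fourth arc are read backwards. Then each p stands for one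
    orbit of size four under r -> -r and r -> r + N/2; the orbits {0, N/2} and {N/4, 3N/4} have size
    two.\<close>
  have reflect: "(\<Sum>p<n. F (a + Suc p)) = (\<Sum>p<n. F (a + u - Suc p))" for a
    by (subst sum.nat_diff_reindex[symmetric]) (auto simp: u_def Suc_diff_Suc intro!: sum.cong arg_cong[of _ _ F])
  have "(\<Sum>r<4 * u. F r) = (F 0 + (\<Sum>p<n. F (Suc p))) + (F u + (\<Sum>p<n. F (u + Suc p)))
      + (F (2 * u) + (\<Sum>p<n. F (2 * u + Suc p))) + (F (3 * u) + (\<Sum>p<n. F (3 * u + Suc p)))"
    using block[of 0] block[of u] block[of "2 * u"] block[of "3 * u"]
    by (simp add: numeral_eq_Suc add_ac)
  moreover have "(\<Sum>p<n. F (u + Suc p)) = (\<Sum>p<n. F (2 * u - Suc p))"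
    using reflect[of u] by (simp add: mult_2)
  moreover have "(\<Sum>p<n. F (3 * u + Suc p)) = (\<Sum>p<n. F (4 * u - Suc p))"
    using reflect[of "3 * u"] by simp
  ultimately show ?thesis
    unfolding u_def[symmetric] sum.distrib by (simp only: add_ac)
qed

text \<open>A discrete Wiener-Khinchin argument: the power spectrum is the Fourier transform of the
  periodic autocorrelation, so a constant spectrum leaves only the shift 0. Summation against
  \<open>cnj \<zeta> ^ d\<close> to the power j extracts the shift d.\<close>

lemma dft_autocorrelation:
  fixes f :: "'v \<Rightarrow> nat \<Rightarrow> complex"
  assumes "\<And>\<omega>. \<omega> ^ N = 1 \<Longrightarrow> (\<Sum>v\<in>A. (cmod (\<Sum>r<N. f v r * \<omega> ^ r))\<^sup>2) = c" "0 < d" "d < N"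
  shows "(\<Sum>v\<in>A. \<Sum>r<N. f v ((r + d) mod N) * cnj (f v r)) = 0"
proof -
  define \<zeta> where "\<zeta> = cis (2 * pi / real N)"
  have N: "N > 0" using assms by simp
  have \<zeta>N: "\<zeta> ^ N = 1" using N by (simp add: \<zeta>_def DeMoivre)
  have \<zeta>n: "\<zeta> * cnj \<zeta> = 1" by (simp add: \<zeta>_def cis_cnj cis_mult)
  have inj: "a = b" if "\<zeta> ^ a = \<zeta> ^ b" "a < N" "b < N" for a b
  proof -
    have "\<zeta> ^ a = cis (2 * pi * real a / real N)" for a by (simp add: \<zeta>_def DeMoivre mult.commute)
    then show ?thesis using bij_betw_roots_unity[OF N] that unfolding bij_betw_def inj_on_def by simp
  qed
  have mod: "\<zeta> ^ a = \<zeta> ^ (a mod N)" for a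
  proof -
    have "\<zeta> ^ (N * (a div N) + a mod N) = \<zeta> ^ (a mod N)" unfolding power_add power_mult \<zeta>N by simp
    then show ?thesis by simp
  qed
  have root_pow: "(x ^ j) ^ N = 1" if "x ^ N = 1" for x :: complex and j
  proof -
    have "(x ^ j) ^ N = (x ^ N) ^ j" by (simp add: mult.commute flip: power_mult)
    then show ?thesis using that by simp
  qed
  have cnjN: "cnj \<zeta> ^ N = 1" using arg_cong[OF \<zeta>N, of cnj] by simp
  have orth: "(\<Sum>j<N. x ^ j) = (if x = 1 then of_nat N else 0)" if "x ^ N = 1" for x :: complex
    using that by (simp add: geometric_sum)
  have shift: "(\<Sum>j<N. (\<zeta> ^ r * cnj \<zeta> ^ s * cnj \<zeta> ^ d) ^ j) = (if r = (s + d) mod N then of_nat N else 0)"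
    if "r < N" for r s
  proof -
    define x where "x = \<zeta> ^ r * cnj \<zeta> ^ s * cnj \<zeta> ^ d"
    have "x ^ N = 1" by (simp add: x_def power_mult_distrib root_pow[OF \<zeta>N] root_pow[OF cnjN])
    moreover have "x = 1 \<longleftrightarrow> r = (s + d) mod N"
    proof
      assume "x = 1"
      moreover have "x * \<zeta> ^ (s + d) = \<zeta> ^ r * (\<zeta> * cnj \<zeta>) ^ s * (\<zeta> * cnj \<zeta>) ^ d"
        by (simp add: x_def power_add power_mult_distrib)
      ultimately have "\<zeta> ^ ((s + d) mod N) = \<zeta> ^ r" using \<zeta>n mod[of "s + d"] by simp
      from inj[OF this] that N show "r = (s + d) mod N" by simp
    next
      assume "r = (s + d) mod N"
      then have "\<zeta> ^ r = \<zeta> ^ (s + d)" using mod[of "s + d"] by simp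
      then have "x = (\<zeta> * cnj \<zeta>) ^ s * (\<zeta> * cnj \<zeta>) ^ d"
        by (simp add: x_def power_add power_mult_distrib)
      then show "x = 1" using \<zeta>n by simp
    qed
    ultimately show ?thesis using orth[of x] by (simp add: x_def)
  qed
  have sq: "of_real ((cmod (\<Sum>r<N. f v r * (\<zeta> ^ j) ^ r))\<^sup>2)
      = (\<Sum>s<N. \<Sum>r<N. f v r * cnj (f v s) * (\<zeta> ^ r * cnj \<zeta> ^ s) ^ j)" for v j
    unfolding complex_norm_square cnj_sum sum_product
    by (subst sum.swap) (simp add: power_mult_distrib mult_ac flip: power_mult)
  have "cnj \<zeta> ^ d \<noteq> 1"
  proof
    assume "cnj \<zeta> ^ d = 1"
    from arg_cong[OF this, of cnj] have "\<zeta> ^ d = \<zeta> ^ 0" by simp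
    from inj[OF this] assms show False by simp
  qed
  moreover have "(cnj \<zeta> ^ d) ^ N = 1"
    by (rule root_pow[OF cnjN])
  \<comment> \<open>A constant is orthogonal to a nontrivial character of the cyclic group.\<close>
  ultimately have "0 = (\<Sum>j<N. (cnj \<zeta> ^ d) ^ j * of_real c)"
    using orth[of "cnj \<zeta> ^ d"] by (simp flip: sum_distrib_right)
  also have "\<dots> = (\<Sum>j<N. (cnj \<zeta> ^ d) ^ j * (\<Sum>v\<in>A. of_real ((cmod (\<Sum>r<N. f v r * (\<zeta> ^ j) ^ r))\<^sup>2)))"
  proof (rule sum.cong)
    fix j
    from assms(1)[OF root_pow[OF \<zeta>N, of j], symmetric]
    show "(cnj \<zeta> ^ d) ^ j * of_real c
        = (cnj \<zeta> ^ d) ^ j * (\<Sum>v\<in>A. of_real ((cmod (\<Sum>r<N. f v r * (\<zeta> ^ j) ^ r))\<^sup>2))"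
      by simp
  qed simp
  also have "\<dots> = (\<Sum>j<N. \<Sum>v\<in>A. \<Sum>s<N. \<Sum>r<N.
      f v r * cnj (f v s) * (\<zeta> ^ r * cnj \<zeta> ^ s * cnj \<zeta> ^ d) ^ j)"
    unfolding sq sum_distrib_left by (simp add: power_mult_distrib mult_ac)
  also have "\<dots> = (\<Sum>v\<in>A. \<Sum>s<N. \<Sum>r<N. \<Sum>j<N.
      f v r * cnj (f v s) * (\<zeta> ^ r * cnj \<zeta> ^ s * cnj \<zeta> ^ d) ^ j)"
    by (subst sum.swap, rule sum.cong[OF refl], subst sum.swap, rule sum.cong[OF refl], subst sum.swap) simp
  also have "\<dots> = (\<Sum>v\<in>A. \<Sum>s<N. \<Sum>r<N.
      f v r * cnj (f v s) * (if r = (s + d) mod N then of_nat N else 0))"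
    by (intro sum.cong refl) (simp add: shift flip: sum_distrib_left)
  also have "\<dots> = (\<Sum>v\<in>A. \<Sum>s<N. f v ((s + d) mod N) * cnj (f v s) * of_nat N)"
    using N by (simp add: if_distrib[of "(*) _"] cong: if_cong)
  also have "\<dots> = (\<Sum>v\<in>A. \<Sum>s<N. f v ((s + d) mod N) * cnj (f v s)) * of_nat N"
    by (simp add: sum_distrib_right)
  finally show ?thesis using N by simp
qed

lemma arc_cases:
  assumes "r < 4 * Suc n"
  obtains "r = 0" | "r = Suc n" | "r = 2 * Suc n" | "r = 3 * Suc n"
    | p where "p < n" "r = Suc p" | p where "p < n" "r = 2 * Suc n - Suc p"
    | p where "p < n" "r = 2 * Suc n + Suc p" | p where "p < n" "r = 4 * Suc n - Suc p"
proof -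
  have "r < Suc n \<or> (Suc n \<le> r \<and> r < 2 * Suc n) \<or> (2 * Suc n \<le> r \<and> r < 3 * Suc n) \<or> 3 * Suc n \<le> r"
    by linarith
  then consider "r < Suc n" | "Suc n \<le> r" "r < 2 * Suc n" | "2 * Suc n \<le> r" "r < 3 * Suc n" | "3 * Suc n \<le> r"
    by blast
  then show thesis
  proof cases
    case 1
    then show ?thesis using that(1) that(5)[of "r - 1"] by (cases r) auto
  next
    case 2
    then show ?thesis using that(2) that(6)[of "2 * n + 1 - r"] by (cases "r = Suc n") auto
  next
    case 3
    then show ?thesis using that(3) that(7)[of "r - 2 * n - 3"] by (cases "r = 2 * Suc n") auto
  next
    case 4
    then show ?thesis using assms that(4) that(8)[of "4 * n + 3 - r"] by (cases "r = 3 * Suc n") auto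
  qed
qed

text \<open>The labels 2 q and 2 q + 1 come from the same sequence q and inherit its colour, which
  is why the condition depends on \<open>v div 2\<close> only.\<close>

lemma sum_double_filter:
  fixes g :: "nat \<Rightarrow> 'a::comm_monoid_add"
  shows "(\<Sum>v | v < 2 * K \<and> P (v div 2). g v) = (\<Sum>q | q < K \<and> P q. g (2 * q) + g (2 * q + 1))"
proof -
  have "(\<Sum>v<2 * K. if P (v div 2) then g v else 0)
      = (\<Sum>q<K. if P q then g (2 * q) + g (2 * q + 1) else 0)"
    by (induction K) (auto simp: add_ac)
  then show ?thesis by (simp add: sum.If_cases Int_def)
qed

lemma parallelogram: "(cmod (a + b))\<^sup>2 + (cmod (a - b))\<^sup>2 = 2 * (cmod a)\<^sup>2 + 2 * (cmod b)\<^sup>2"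
  unfolding cmod_power2 by (simp add: power2_eq_square algebra_simps)

text \<open>Produces the coefficients of the self-adjoint elements: \<open>lab\<close> says which
  element occupies a position and \<open>wt\<close> gives its coefficient there. The spectra are
  evaluated only at N-th roots of unity, where h is a sign. The additional position of colour 1 in c
  stands for the quadruple 0, N/4, N/2, 3N/4.\<close>

lemma packing_labelling:
  assumes "packing n Q m"
  defines "N \<equiv> 4 * Suc n" and "c \<equiv> (\<lambda>l. 4 * (m(1 := m 1 + 1)) l)"
  obtains lab :: "nat \<Rightarrow> nat" and wt :: "nat \<Rightarrow> complex" and colour :: "nat \<Rightarrow> nat" where
    "\<And>r. r < N \<Longrightarrow> lab r < 2 * (Q + 1)" "\<And>r. r < N \<Longrightarrow> wt r \<in> quaternary"
    "\<And>r. r < N \<Longrightarrow> lab ((N - r) mod N) = lab r" "\<And>r. r < N \<Longrightarrow> wt ((N - r) mod N) = cnj (wt r)"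
    "\<And>l. card {r. r < N \<and> colour (lab r) = l} = c l"
    "\<And>l \<omega>. \<omega> ^ N = 1 \<Longrightarrow> (\<Sum>v | v < 2 * (Q + 1) \<and> colour v = l.
       (cmod (\<Sum>r<N. (if lab r = v then wt r else 0) * \<omega> ^ r))\<^sup>2) = real (c l)"
proof -
  obtain \<sigma> co z where L: "\<And>p. p < n \<Longrightarrow> \<sigma> p < Q" "\<And>p. p < n \<Longrightarrow> z p \<in> quaternary"
    "\<And>l. card {p. p < n \<and> co (\<sigma> p) = l} = m l"
    "\<And>l \<omega>. cmod \<omega> = 1 \<Longrightarrow>
        (\<Sum>q | q < Q \<and> co q = l. (cmod (\<Sum>p | p < n \<and> \<sigma> p = q. z p * \<omega> ^ p))\<^sup>2) = real (m l)"
    using assms(1) unfolding packing_def layout_def by blast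
  define u where "u = Suc n"
  \<comment> \<open>\<open>C\<close> at \<open>1, \<dots>, u - 1\<close> is followed by \<open>- i h C*\<close>, \<open>i h C\<close>, \<open>C*\<close> on the next three arcs.\<close>
  define lab where "lab r =
    (if r = 0 \<or> r = 2 * u then 2 * Q else if r = u \<or> r = 3 * u then 2 * Q + 1
     else if r < u then 2 * \<sigma> (r - 1) else if r < 2 * u then 2 * \<sigma> (2 * u - r - 1) + 1
     else if r < 3 * u then 2 * \<sigma> (r - 2 * u - 1) + 1 else 2 * \<sigma> (4 * u - r - 1))" for r
  define wt where "wt r =
    (if r = 0 \<or> r = 2 * u then 1 else if r = u then \<i> else if r = 3 * u then - \<i>
     else if r < u then z (r - 1) else if r < 2 * u then - \<i> * cnj (z (2 * u - r - 1))
     else if r < 3 * u then \<i> * z (r - 2 * u - 1) else cnj (z (4 * u - r - 1)))" for r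
  \<comment> \<open>The number Q, which no sequence has, stands for the four special
    positions.\<close>
  define cc where "cc = co(Q := 1)"
  define colour where "colour v = cc (v div 2)" for v
  have N: "N = 4 * u" by (simp add: N_def u_def)
  have lab: "lab 0 = 2 * Q" "lab u = 2 * Q + 1" "lab (2 * u) = 2 * Q" "lab (3 * u) = 2 * Q + 1"
    "\<And>p. p < n \<Longrightarrow> lab (Suc p) = 2 * \<sigma> p" "\<And>p. p < n \<Longrightarrow> lab (2 * u - Suc p) = 2 * \<sigma> p + 1"
    "\<And>p. p < n \<Longrightarrow> lab (2 * u + Suc p) = 2 * \<sigma> p + 1" "\<And>p. p < n \<Longrightarrow> lab (4 * u - Suc p) = 2 * \<sigma> p"
    by (auto simp: lab_def u_def)
  have wt: "wt 0 = 1" "wt u = \<i>" "wt (2 * u) = 1" "wt (3 * u) = - \<i>"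
    "\<And>p. p < n \<Longrightarrow> wt (Suc p) = z p" "\<And>p. p < n \<Longrightarrow> wt (2 * u - Suc p) = - \<i> * cnj (z p)"
    "\<And>p. p < n \<Longrightarrow> wt (2 * u + Suc p) = \<i> * z p" "\<And>p. p < n \<Longrightarrow> wt (4 * u - Suc p) = cnj (z p)"
    by (auto simp: wt_def u_def)
  have arcs: "P r" if "r < N" "P 0" "P u" "P (2 * u)" "P (3 * u)" "\<And>p. p < n \<Longrightarrow> P (Suc p)"
    "\<And>p. p < n \<Longrightarrow> P (2 * u - Suc p)" "\<And>p. p < n \<Longrightarrow> P (2 * u + Suc p)" "\<And>p. p < n \<Longrightarrow> P (4 * u - Suc p)"
    for P and r :: nat
    by (rule arc_cases[OF that(1)[unfolded N_def]])
      (use that(2-)[unfolded u_def] in \<open>auto simp only:\<close>)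
  have four: "(\<Sum>r<N. F r) = F 0 + F u + F (2 * u) + F (3 * u) +
      (\<Sum>p<n. F (Suc p) + F (2 * u - Suc p) + F (2 * u + Suc p) + F (4 * u - Suc p))"
    for F :: "nat \<Rightarrow> 'b::comm_monoid_add"
    unfolding N_def u_def by (rule sum_four_arcs)
  have 1: "lab r < 2 * (Q + 1)" if "r < N" for r
    using that by (rule arcs) (simp_all only: lab, auto dest: L(1))
  have 2: "wt r \<in> quaternary" if "r < N" for r
    using that by (rule arcs) (simp_all only: wt, auto simp: L(2) quaternary_closed, auto simp: quaternary_def)
  have neg: "(N - 0) mod N = 0" "(N - u) mod N = 3 * u" "(N - 2 * u) mod N = 2 * u" "(N - 3 * u) mod N = u"
    "\<And>p. p < n \<Longrightarrow> (N - Suc p) mod N = 4 * u - Suc p"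
    "\<And>p. p < n \<Longrightarrow> (N - (2 * u - Suc p)) mod N = 2 * u + Suc p"
    "\<And>p. p < n \<Longrightarrow> (N - (2 * u + Suc p)) mod N = 2 * u - Suc p"
    "\<And>p. p < n \<Longrightarrow> (N - (4 * u - Suc p)) mod N = Suc p"
    by (auto simp: N u_def)
  have 3: "lab ((N - r) mod N) = lab r" if "r < N" for r
    using that by (rule arcs) (simp_all only: neg lab)
  have 4: "wt ((N - r) mod N) = cnj (wt r)" if "r < N" for r
    using that by (rule arcs) (simp_all only: neg wt, simp_all)
  have 5: "card {r. r < N \<and> colour (lab r) = l} = c l" for l
  proof -
    have old: "colour (2 * \<sigma> p) = co (\<sigma> p)" "colour (2 * \<sigma> p + 1) = co (\<sigma> p)" if "p < n" for p
      using L(1)[OF that] by (simp_all add: colour_def cc_def)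
    have new: "colour (2 * Q) = 1" "colour (2 * Q + 1) = 1" by (simp_all add: colour_def cc_def)
    have "card {r. r < N \<and> colour (lab r) = l} = (\<Sum>r<N. if colour (lab r) = l then 1 else 0)"
      by (simp add: sum.If_cases Int_def)
    also have "\<dots> = 4 * (if l = 1 then 1 else 0) + (\<Sum>p<n. 4 * (if co (\<sigma> p) = l then 1 else 0))"
      unfolding four lab(1-4) new
    proof (rule arg_cong2[of _ _ _ _ "(+)"])
      show "(\<Sum>p<n. (if colour (lab (Suc p)) = l then 1 else 0) + (if colour (lab (2 * u - Suc p)) = l then 1 else 0)
          + (if colour (lab (2 * u + Suc p)) = l then 1 else 0) + (if colour (lab (4 * u - Suc p)) = l then 1 else 0))
        = (\<Sum>p<n. 4 * (if co (\<sigma> p) = l then 1 else 0 :: nat))"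
      proof (rule sum.cong[OF refl])
        fix p assume "p \<in> {..<n}"
        then have p: "p < n" by simp
        show "(if colour (lab (Suc p)) = l then 1 else 0) + (if colour (lab (2 * u - Suc p)) = l then 1 else 0)
          + (if colour (lab (2 * u + Suc p)) = l then 1 else 0) + (if colour (lab (4 * u - Suc p)) = l then 1 else 0)
          = 4 * (if co (\<sigma> p) = l then 1 else 0 :: nat)"
          unfolding lab(5-8)[OF p] old[OF p] by simp
      qed
    qed simp
    also have "(\<Sum>p<n. 4 * (if co (\<sigma> p) = l then 1 else 0)) = 4 * m l"
      by (simp add: sum.If_cases Int_def L(3) flip: sum_distrib_left)
    finally show ?thesis by (simp add: c_def)
  qed
  have 6: "(\<Sum>v | v < 2 * (Q + 1) \<and> colour v = l.
       (cmod (\<Sum>r<N. (if lab r = v then wt r else 0) * \<omega> ^ r))\<^sup>2) = real (c l)" if \<omega>N: "\<omega> ^ N = 1" for l \<omega>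
  proof -
    define W where "W v = (\<Sum>r<N. (if lab r = v then wt r else 0) * \<omega> ^ r)" for v
    define h where "h = \<omega> ^ (2 * u)"
    have "cmod \<omega> ^ N = 1" using arg_cong[OF \<omega>N, of cmod] by (simp add: norm_power)
    then have \<omega>: "cmod \<omega> = 1" using power_eq_imp_eq_base[of "cmod \<omega>" N 1] by (simp add: N u_def)
    then have unit: "\<omega> ^ j * cnj (\<omega> ^ j) = 1" for j
      using complex_norm_square[of "\<omega> ^ j"] \<omega> by (simp add: norm_power)
    have h2: "h * h = 1" using \<omega>N by (simp add: h_def N flip: power_add)
    \<comment> \<open>At an N-th root of unity h is a sign, so it disappears from the modulus of
      \<open>W (2 * q + 1)\<close>.\<close>
    then have h: "h = 1 \<or> h = -1" by (metis square_eq_1_iff)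
    have \<omega>3: "\<omega> ^ (3 * u) = h * \<omega> ^ u" by (simp add: h_def flip: power_add)
    have inv: "\<omega> ^ (a - j) = \<omega> ^ a * cnj (\<omega> ^ j)" if "j \<le> a" for a j
    proof -
      have "\<omega> ^ a * cnj (\<omega> ^ j) = \<omega> ^ (a - j) * (\<omega> ^ j * cnj (\<omega> ^ j))"
        using that by (simp flip: power_add mult.assoc)
      then show ?thesis by (simp only: unit mult_1_right)
    qed
    have \<omega>4: "\<omega> ^ (4 * u) = 1" using \<omega>N N by simp
    have pw: "\<omega> ^ (2 * u - Suc p) = h * cnj (\<omega> ^ Suc p)" "\<omega> ^ (2 * u + Suc p) = h * \<omega> ^ Suc p"
      "\<omega> ^ (4 * u - Suc p) = cnj (\<omega> ^ Suc p)" if "p < n" for p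
    proof -
      have le: "Suc p \<le> 2 * u" "Suc p \<le> 4 * u" using that by (simp_all add: u_def)
      show "\<omega> ^ (2 * u - Suc p) = h * cnj (\<omega> ^ Suc p)" unfolding h_def by (rule inv[OF le(1)])
      show "\<omega> ^ (2 * u + Suc p) = h * \<omega> ^ Suc p" unfolding h_def by (rule power_add)
      show "\<omega> ^ (4 * u - Suc p) = cnj (\<omega> ^ Suc p)" unfolding inv[OF le(2)] \<omega>4 by (rule mult_1_left)
    qed
    have pair: "(cmod (W (2 * q)))\<^sup>2 + (cmod (W (2 * q + 1)))\<^sup>2
        = 4 * (cmod (\<Sum>p | p < n \<and> \<sigma> p = q. z p * \<omega> ^ p))\<^sup>2" if "q < Q" for q
    proof -
      \<comment> \<open>The exponent is \<open>Suc p\<close> because position 0 of the cycle is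
        special; compared with the packing this is a factor \<open>\<omega>\<close> of modulus
        one.\<close>
      define C where "C = (\<Sum>p<n. if \<sigma> p = q then z p * \<omega> ^ Suc p else 0)"
      have ne: "2 * Q \<noteq> 2 * q" "2 * Q + 1 \<noteq> 2 * q" "2 * Q \<noteq> 2 * q + 1" "2 * Q + 1 \<noteq> 2 * q + 1"
        using that by (simp, presburger, presburger, simp)
      have par: "2 * a = 2 * q \<longleftrightarrow> a = q" "2 * a + 1 = 2 * q + 1 \<longleftrightarrow> a = q"
        "2 * a = 2 * q + 1 \<longleftrightarrow> False" "2 * a + 1 = 2 * q \<longleftrightarrow> False" for a
        by (simp, simp, presburger, presburger)
      have "W (2 * q) = (\<Sum>p<n. (if \<sigma> p = q then z p * \<omega> ^ Suc p else 0)
            + cnj (if \<sigma> p = q then z p * \<omega> ^ Suc p else 0))"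
        unfolding W_def four
      proof (simp only: lab(1-4) ne if_False mult_zero_left add_0_left, rule sum.cong[OF refl], goal_cases)
        case (1 p)
        then have p: "p < n" by simp
        show ?case unfolding lab(5-8)[OF p] wt(5-8)[OF p] pw[OF p] par by (simp del: power_Suc add: algebra_simps)
      qed
      then have W0: "W (2 * q) = C + cnj C" by (simp only: C_def sum.distrib cnj_sum)
      have "W (2 * q + 1) = (\<Sum>p<n. \<i> * h * (if \<sigma> p = q then z p * \<omega> ^ Suc p else 0)
            - \<i> * h * cnj (if \<sigma> p = q then z p * \<omega> ^ Suc p else 0))"
        unfolding W_def four
      proof (simp only: lab(1-4) ne if_False mult_zero_left add_0_left, rule sum.cong[OF refl], goal_cases)
        case (1 p)
        then have p: "p < n" by simp
        show ?case unfolding lab(5-8)[OF p] wt(5-8)[OF p] pw[OF p] par by (simp del: power_Suc add: algebra_simps)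
      qed
      then have "W (2 * q + 1) = \<i> * h * (C - cnj C)"
        by (simp only: C_def sum_subtractf cnj_sum right_diff_distrib sum_distrib_left)
      then have W1: "cmod (W (2 * q + 1)) = cmod (C - cnj C)" using h by (auto simp: norm_mult)
      have "C = \<omega> * (\<Sum>p | p < n \<and> \<sigma> p = q. z p * \<omega> ^ p)"
        unfolding C_def by (simp add: sum.If_cases Int_def sum_distrib_left mult_ac)
      then have "cmod C = cmod (\<Sum>p | p < n \<and> \<sigma> p = q. z p * \<omega> ^ p)" using \<omega> by (simp add: norm_mult)
      then show ?thesis using parallelogram[of C "cnj C"] unfolding W0 W1 by simp
    qed
    have special: "(cmod (W (2 * Q)))\<^sup>2 + (cmod (W (2 * Q + 1)))\<^sup>2 = 4"
    proof -
      have ne: "2 * \<sigma> p \<noteq> 2 * Q" "2 * \<sigma> p + 1 \<noteq> 2 * Q" "2 * \<sigma> p \<noteq> 2 * Q + 1" "2 * \<sigma> p + 1 \<noteq> 2 * Q + 1"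
        if "p < n" for p using L(1)[OF that] by (simp, presburger, presburger, simp)
      have ne2: "2 * Q \<noteq> 2 * Q + 1" "2 * Q + 1 \<noteq> 2 * Q" by presburger+
      have W: "W v = (if lab 0 = v then wt 0 else 0) * \<omega> ^ 0 + (if lab u = v then wt u else 0) * \<omega> ^ u
          + (if lab (2 * u) = v then wt (2 * u) else 0) * \<omega> ^ (2 * u)
          + (if lab (3 * u) = v then wt (3 * u) else 0) * \<omega> ^ (3 * u)"
        if "\<And>p. p < n \<Longrightarrow> 2 * \<sigma> p \<noteq> v" "\<And>p. p < n \<Longrightarrow> 2 * \<sigma> p + 1 \<noteq> v" for v
        unfolding W_def four
        by (subst sum.neutral, rule ballI)
          (simp_all only: lessThan_iff lab(5-8) that if_False mult_zero_left add_0_left add_0_right)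
      \<comment> \<open>Of the two values 1 + h and 1 - h, one is 0 and the other is 2, whatever the
        sign h.\<close>
      have "W (2 * Q) = 1 + h"
        by (subst W, erule ne(1), erule ne(2)) (simp only: lab(1-4) wt(1-4) ne2 h_def, simp)
      moreover have "W (2 * Q + 1) = \<i> * \<omega> ^ u * (1 - h)"
        by (subst W, erule ne(3), erule ne(4)) (simp only: lab(1-4) wt(1-4) ne2 \<omega>3, simp add: algebra_simps)
      moreover have "cmod (\<omega> ^ u) = 1" using \<omega> by (simp add: norm_power)
      ultimately show ?thesis using parallelogram[of 1 h] h by (auto simp: norm_mult)
    qed
    have "(\<Sum>v | v < 2 * (Q + 1) \<and> colour v = l. (cmod (W v))\<^sup>2) =
       (\<Sum>q | q < Q + 1 \<and> cc q = l. (cmod (W (2 * q)))\<^sup>2 + (cmod (W (2 * q + 1)))\<^sup>2)"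
      unfolding colour_def by (rule sum_double_filter)
    also have "{q. q < Q + 1 \<and> cc q = l} = {q. q < Q \<and> co q = l} \<union> (if l = 1 then {Q} else {})"
      by (auto simp: cc_def split: if_splits)
    also have "(\<Sum>q\<in>\<dots>. (cmod (W (2 * q)))\<^sup>2 + (cmod (W (2 * q + 1)))\<^sup>2)
      = (\<Sum>q | q < Q \<and> co q = l. (cmod (W (2 * q)))\<^sup>2 + (cmod (W (2 * q + 1)))\<^sup>2) + (if l = 1 then 4 else 0)"
      by (subst sum.union_disjoint) (auto simp: special[simplified])
    also have "(\<Sum>q | q < Q \<and> co q = l. (cmod (W (2 * q)))\<^sup>2 + (cmod (W (2 * q + 1)))\<^sup>2)
      = (\<Sum>q | q < Q \<and> co q = l. 4 * (cmod (\<Sum>p | p < n \<and> \<sigma> p = q. z p * \<omega> ^ p))\<^sup>2)"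
      by (rule sum.cong) (auto simp: pair[simplified])
    also have "\<dots> = 4 * real (m l)"
      using L(4)[OF \<omega>, of l] by (simp flip: sum_distrib_left)
    finally show ?thesis by (simp add: W_def c_def)
  qed
  show thesis by (rule that[of lab wt colour]) (fact 1 2 3 4 5 6)+
qed

section \<open>Signed group rings\<close>

context signed_group
begin

lemma neg_one_neg_one: "s \<in> carrier S \<Longrightarrow> \<epsilon> \<otimes> (\<epsilon> \<otimes> s) = s"
  using neg_one_closed neg_one_square by (simp flip: m_assoc)

lemma neg_one_neq: "s \<in> carrier S \<Longrightarrow> \<epsilon> \<otimes> s \<noteq> s"
  using neg_one_closed neg_one_neq_one by (metis l_one one_closed right_cancel)

lemma inv_neg_one: "s \<in> carrier S \<Longrightarrow> inv (\<epsilon> \<otimes> s) = \<epsilon> \<otimes> inv s"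
proof -
  assume s: "s \<in> carrier S"
  have "inv \<epsilon> = \<epsilon>" using neg_one_closed neg_one_square by (simp add: inv_equality)
  then show ?thesis using s neg_one_closed by (simp add: inv_mult_group neg_one_central)
qed

lemma subgroup_neg_one: "subgroup {\<one>, \<epsilon>} S"
proof
  show "inv x \<in> {\<one>, \<epsilon>}" if "x \<in> {\<one>, \<epsilon>}" for x
    using that neg_one_closed neg_one_square by (auto simp: inv_equality)
qed (use neg_one_closed neg_one_square in auto)

lemma neg_one_coset: "s \<in> carrier S \<Longrightarrow> {\<one>, \<epsilon>} #> s = {s, \<epsilon> \<otimes> s}"
  by (auto simp: r_coset_def)

text \<open>\<open>reps\<close> is a Hilbert choice, so some set of representatives has to be
  exhibited: one chosen element of every coset.\<close>

lemma coset_reps_reps: "coset_reps S (reps S)"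
proof -
  let ?H = "{\<one>, \<epsilon>}"
  define P where "P = (\<lambda>C. SOME x. x \<in> C) ` (rcosets ?H)"
  have mem: "(SOME x. x \<in> C) \<in> C" "C \<subseteq> carrier S" if C: "C \<in> rcosets ?H" for C
  proof -
    obtain s where "s \<in> carrier S" "C = ?H #> s" using C by (auto simp: RCOSETS_def)
    then have "s \<in> C" "C \<subseteq> carrier S" using neg_one_closed by (auto simp: neg_one_coset)
    then show "(SOME x. x \<in> C) \<in> C" "C \<subseteq> carrier S" by (auto intro: someI)
  qed
  have "coset_reps S P" unfolding coset_reps_def
  proof (intro conjI ballI)
    show "P \<subseteq> carrier S" using mem by (auto simp: P_def)
  next
    fix C assume C: "C \<in> rcosets ?H"
    show "\<exists>!p. p \<in> P \<inter> C"
    proof (rule ex1I)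
      show "(SOME x. x \<in> C) \<in> P \<inter> C" using mem(1)[OF C] C by (auto simp: P_def)
    next
      fix p assume p: "p \<in> P \<inter> C"
      then obtain C' where C': "C' \<in> rcosets ?H" "p = (SOME x. x \<in> C')" by (auto simp: P_def)
      then have "p \<in> C' \<inter> C" using mem(1)[of C'] p by simp
      then have "C = C'" using rcos_disjoint[OF subgroup_neg_one] C C'(1)
        by (auto simp: pairwise_def disjnt_def)
      then show "p = (SOME x. x \<in> C)" using C' by simp
    qed
  qed
  then show ?thesis unfolding reps_def by (rule someI)
qed

lemma reps_iff:
  assumes "s \<in> carrier S"
  shows "\<epsilon> \<otimes> s \<in> reps S \<longleftrightarrow> s \<notin> reps S"
proof -
  have "{\<one>, \<epsilon>} #> s \<in> rcosets {\<one>, \<epsilon>}" using assms by (auto simp: RCOSETS_def)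
  then have "\<exists>!p. p \<in> reps S \<inter> {s, \<epsilon> \<otimes> s}"
    using coset_reps_reps assms unfolding coset_reps_def by (metis neg_one_coset)
  then show ?thesis using neg_one_neq[OF assms] by auto
qed

lemma sg_term_zero: "sg_term S 0 s = (\<lambda>t. 0)"
  by (auto simp: sg_term_def)

lemma sg_term_neg: "s \<in> carrier S \<Longrightarrow> sg_term S r (\<epsilon> \<otimes> s) t = - sg_term S r s t"
  using neg_one_neg_one neg_one_neq[of s] by (auto simp: sg_term_def)

lemma sg_term_uminus: "sg_term S (- r) s t = - sg_term S r s t"
  by (auto simp: sg_term_def)

lemma sg_term_mult_left: "sg_term S (r * r') s t = r * sg_term S r' s t"
  by (auto simp: sg_term_def)

lemma sg_term_sum: "sg_term S (\<Sum>a\<in>A. r a) s t = (\<Sum>a\<in>A. sg_term S (r a) s t)"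
  by (auto simp: sg_term_def sum_negf)

lemma sg_term_self: "sg_term S r s s = r"
  by (simp add: sg_term_def)

lemma sg_term_closed:
  assumes "s \<in> carrier S"
  shows "sg_term S r s \<in> carrier (sg_ring S)"
proof -
  have "{t. sg_term S r s t \<noteq> 0} \<subseteq> {s, \<epsilon> \<otimes> s}" by (auto simp: sg_term_def)
  moreover have "sg_term S r s (\<epsilon> \<otimes> t) = - sg_term S r s t" if "t \<in> carrier S" for t
  proof -
    have "\<epsilon> \<otimes> t = s \<longleftrightarrow> t = \<epsilon> \<otimes> s" using that assms neg_one_neg_one by metis
    moreover have "\<epsilon> \<otimes> t = \<epsilon> \<otimes> s \<longleftrightarrow> t = s" using that assms neg_one_closed by simp
    ultimately show ?thesis using neg_one_neq[OF assms] by (auto simp: sg_term_def)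
  qed
  ultimately show ?thesis using assms neg_one_closed
    by (auto simp: sg_ring_def intro: finite_subset)
qed

text \<open>Products and conjugates are computed at the chosen representative p, which is s or its
  negative. The coefficient changes sign together with p, and so the choice leaves no trace in the
  results. A zero coefficient has empty support.\<close>

lemma sg_term_rep:
  assumes "s \<in> carrier S"
  obtains p r' where "p \<in> carrier S" "sg_term S r s p = r'" "r \<noteq> 0 \<Longrightarrow> sg_supp S (sg_term S r s) = {p}"
    "p = s \<and> r' = r \<or> p = \<epsilon> \<otimes> s \<and> r' = - r"
proof (cases "s \<in> reps S")
  case True
  then have "\<epsilon> \<otimes> s \<notin> reps S" using reps_iff assms by simp
  with True have "r \<noteq> 0 \<Longrightarrow> sg_supp S (sg_term S r s) = {s}"
    by (auto simp: sg_supp_def sg_term_def)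
  then show thesis using assms by (intro that[of s r]) (auto simp: sg_term_def)
next
  case False
  then have "\<epsilon> \<otimes> s \<in> reps S" using reps_iff assms by simp
  with False have "r \<noteq> 0 \<Longrightarrow> sg_supp S (sg_term S r s) = {\<epsilon> \<otimes> s}"
    using neg_one_neq[OF assms] by (auto simp: sg_supp_def sg_term_def)
  then show thesis using assms neg_one_closed neg_one_neq[OF assms]
    by (intro that[of "\<epsilon> \<otimes> s" "- r"]) (auto simp: sg_term_def)
qed

lemma sg_term_mult:
  assumes "s \<in> carrier S" "s' \<in> carrier S"
  shows "sg_term S r s \<otimes>\<^bsub>sg_ring S\<^esub> sg_term S r' s' = sg_term S (r * r') (s \<otimes> s')"
proof (cases "r = 0 \<or> r' = 0")
  case True
  then show ?thesis by (auto simp: sg_ring_def sg_term_zero sg_supp_def)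
next
  case False
  obtain p x where p: "p \<in> carrier S" "sg_term S r s p = x" "sg_supp S (sg_term S r s) = {p}"
    "p = s \<and> x = r \<or> p = \<epsilon> \<otimes> s \<and> x = - r"
    using sg_term_rep[OF assms(1), of r] False by metis
  obtain p' x' where p': "p' \<in> carrier S" "sg_term S r' s' p' = x'" "sg_supp S (sg_term S r' s') = {p'}"
    "p' = s' \<and> x' = r' \<or> p' = \<epsilon> \<otimes> s' \<and> x' = - r'"
    using sg_term_rep[OF assms(2), of r'] False by metis
  have "(sg_term S r s \<otimes>\<^bsub>sg_ring S\<^esub> sg_term S r' s') = sg_term S (x * x') (p \<otimes> p')"
    by (simp add: sg_ring_def p p')
  also have "\<dots> = sg_term S (r * r') (s \<otimes> s')"
  proof -
    have "s \<otimes> (\<epsilon> \<otimes> s') = \<epsilon> \<otimes> (s \<otimes> s')"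
      using assms neg_one_closed neg_one_central[of s] by (simp flip: m_assoc)
    then show ?thesis using p(4) p'(4) assms neg_one_closed
      by (auto simp: fun_eq_iff m_assoc sg_term_neg sg_term_uminus)
  qed
  finally show ?thesis .
qed

lemma sg_conj_term:
  assumes "s \<in> carrier S"
  shows "sg_conj S (sg_term S r s) = sg_term S r (inv s)"
proof (cases "r = 0")
  case True
  then show ?thesis by (auto simp: sg_conj_def sg_term_zero sg_supp_def)
next
  case False
  obtain p x where p: "p \<in> carrier S" "sg_term S r s p = x" "sg_supp S (sg_term S r s) = {p}"
    "p = s \<and> x = r \<or> p = \<epsilon> \<otimes> s \<and> x = - r"
    using sg_term_rep[OF assms(1), of r] False by metis
  have "sg_conj S (sg_term S r s) = sg_term S x (inv p)" by (simp add: sg_conj_def p)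
  then show ?thesis using p(4) assms
    by (auto simp: fun_eq_iff inv_neg_one sg_term_neg sg_term_uminus)
qed

text \<open>The structure on which the sums \<open>finsum\<close> in matrix products rest.\<close>

lemma abelian_monoid_sg_ring: "abelian_monoid (sg_ring S :: ('a \<Rightarrow> 'r::comm_ring_1) ring)"
proof (rule abelian_monoidI)
  fix x y :: "'a \<Rightarrow> 'r"
  assume "x \<in> carrier (sg_ring S)" "y \<in> carrier (sg_ring S)"
  moreover have "{s. x s + y s \<noteq> 0} \<subseteq> {s. x s \<noteq> 0} \<union> {s. y s \<noteq> 0}" by auto
  ultimately show "x \<oplus>\<^bsub>sg_ring S\<^esub> y \<in> carrier (sg_ring S)"
    by (auto simp: sg_ring_def intro: finite_subset)
qed (auto simp: sg_ring_def fun_eq_iff add_ac)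

lemma finsum_sg_ring:
  fixes f :: "'i \<Rightarrow> 'a \<Rightarrow> 'r::comm_ring_1"
  assumes "finite A" "\<And>a. a \<in> A \<Longrightarrow> f a \<in> carrier (sg_ring S)"
  shows "(\<Oplus>\<^bsub>sg_ring S\<^esub>a\<in>A. f a) = (\<lambda>t. \<Sum>a\<in>A. f a t)"
proof -
  interpret abelian_monoid "sg_ring S :: ('a \<Rightarrow> 'r) ring" by (rule abelian_monoid_sg_ring)
  show ?thesis using assms
  proof (induction A rule: finite_induct)
    case empty
    show ?case unfolding finsum_empty by (simp add: sg_ring_def)
  next
    case (insert a A)
    then have "finsum (sg_ring S) f (insert a A) = f a \<oplus>\<^bsub>sg_ring S\<^esub> finsum (sg_ring S) f A"
      by (intro finsum_insert) auto
    then show ?case using insert by (simp add: sg_ring_def)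
  qed
qed

lemma sg_ring_simps:
  "\<zero>\<^bsub>sg_ring S\<^esub> = (\<lambda>t. 0)" "\<one>\<^bsub>sg_ring S\<^esub> = sg_term S 1 \<one>"
  "\<zero>\<^bsub>sg_ring S\<^esub> \<otimes>\<^bsub>sg_ring S\<^esub> f = \<zero>\<^bsub>sg_ring S\<^esub>" "f \<otimes>\<^bsub>sg_ring S\<^esub> \<zero>\<^bsub>sg_ring S\<^esub> = \<zero>\<^bsub>sg_ring S\<^esub>"
  by (auto simp: sg_ring_def sg_supp_def)

lemma sg_ring_zero_one_closed:
  "\<zero>\<^bsub>sg_ring S\<^esub> \<in> carrier (sg_ring S)" "\<one>\<^bsub>sg_ring S\<^esub> \<in> carrier (sg_ring S)"
  using sg_term_closed[OF one_closed] unfolding sg_ring_simps by (auto simp: sg_ring_def)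

section \<open>Circulant matrices over the signed group ring\<close>

lemma cyclic_shift_pow:
  assumes "n > 0"
  shows "ring_mat_pow (sg_ring S :: ('a \<Rightarrow> 'r::comm_ring_1) ring) n (cyclic_shift (sg_ring S) n) e =
    mat n n (\<lambda>(i, j). if j = (i + e) mod n then \<one>\<^bsub>sg_ring S\<^esub> else \<zero>\<^bsub>sg_ring S\<^esub>)"
proof (induction e)
  case 0
  show ?case by (auto simp: ring_mat_one_def)
next
  case (Suc e)
  let ?R = "sg_ring S :: ('a \<Rightarrow> 'r) ring"
  have oo: "\<one>\<^bsub>?R\<^esub> \<otimes>\<^bsub>?R\<^esub> \<one>\<^bsub>?R\<^esub> = \<one>\<^bsub>?R\<^esub>"
    unfolding sg_ring_simps by (simp add: sg_term_mult)
  let ?P = "mat n n (\<lambda>(i, j). if j = (i + e) mod n then \<one>\<^bsub>?R\<^esub> else \<zero>\<^bsub>?R\<^esub>)"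
  let ?C = "cyclic_shift ?R n"
  have "(\<Oplus>\<^bsub>?R\<^esub>l\<in>{..<n}. ?P $$ (i, l) \<otimes>\<^bsub>?R\<^esub> ?C $$ (l, j))
      = (if j = (i + Suc e) mod n then \<one>\<^bsub>?R\<^esub> else \<zero>\<^bsub>?R\<^esub>)" (is "?L = _") if "i < n" "j < n" for i j
  proof -
    define b where "b = (if j = (i + Suc e) mod n then \<one>\<^bsub>?R\<^esub> else \<zero>\<^bsub>?R\<^esub>)"
    have b: "b \<in> carrier ?R" by (simp add: b_def sg_ring_zero_one_closed)
    have "?L = (\<Oplus>\<^bsub>?R\<^esub>l\<in>{..<n}. if l = (i + e) mod n then b else \<zero>\<^bsub>?R\<^esub>)"
      using that b by (intro abelian_monoid.finsum_cong'[OF abelian_monoid_sg_ring])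
        (auto simp: cyclic_shift_def oo sg_ring_simps(3,4) sg_ring_zero_one_closed b_def mod_Suc_eq)
    also have "\<dots> = (\<lambda>t. \<Sum>l<n. (if l = (i + e) mod n then b else \<zero>\<^bsub>?R\<^esub>) t)"
      by (rule finsum_sg_ring) (auto simp: b sg_ring_zero_one_closed)
    also have "\<dots> = (\<lambda>t. \<Sum>l<n. if l = (i + e) mod n then b t else 0)"
      by (intro ext sum.cong) (auto simp: sg_ring_simps(1))
    also have "\<dots> = b" using assms by simp
    finally show ?thesis by (simp add: b_def)
  qed
  moreover have "dim_col ?C = n" by (simp add: cyclic_shift_def)
  ultimately show ?case unfolding ring_mat_pow.simps Suc ring_mat_mult_def
    by (intro eq_matI) simp_all
qed

text \<open>The power l of the shift has its units where j - i is l modulo n, so each entry picks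
  out one coefficient. \<open>circ\<close> numbers its arguments from 1, hence l - 1; adding n
  before subtracting i avoids truncation.\<close>

lemma circ_term:
  fixes r :: "nat \<Rightarrow> 'r::comm_ring_1"
  assumes "n > 0" "\<And>l. l < n \<Longrightarrow> s l \<in> carrier S"
  shows "circ (sg_ring S) n (\<lambda>l. sg_term S (r (l - 1)) (s (l - 1))) =
    mat n n (\<lambda>(i, j). sg_term S (r ((j + n - i) mod n)) (s ((j + n - i) mod n)))"
proof -
  let ?R = "sg_ring S :: ('a \<Rightarrow> 'r) ring"
  have "(\<Oplus>\<^bsub>?R\<^esub>l\<in>{..<n}. sg_term S (r l) (s l) \<otimes>\<^bsub>?R\<^esub> (if j = (i + l) mod n then \<one>\<^bsub>?R\<^esub> else \<zero>\<^bsub>?R\<^esub>))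
      = sg_term S (r ((j + n - i) mod n)) (s ((j + n - i) mod n))" (is "?L = _") if "i < n" "j < n" for i j
  proof -
    define a where "a l = sg_term S (r l) (s l)" for l
    define l0 where "l0 = (j + n - i) mod n"
    have l0: "l0 < n" using assms by (simp add: l0_def)
    have iff: "j = (i + l) mod n \<longleftrightarrow> l = l0" if "l < n" for l
      using that \<open>i < n\<close> \<open>j < n\<close> by (auto simp: l0_def mod_if)
    have "sg_term S (r l) (s l) \<otimes>\<^bsub>?R\<^esub> (if j = (i + l) mod n then \<one>\<^bsub>?R\<^esub> else \<zero>\<^bsub>?R\<^esub>)
        = (if l = l0 then a l0 else \<zero>\<^bsub>?R\<^esub>)" if "l < n" for l
      using iff[OF that] assms(2)[OF that]
      by (auto simp: sg_ring_simps(4)) (simp add: sg_ring_simps(2) sg_term_mult a_def)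
    then have "?L = (\<Oplus>\<^bsub>?R\<^esub>l\<in>{..<n}. if l = l0 then a l0 else \<zero>\<^bsub>?R\<^esub>)"
      by (intro abelian_monoid.finsum_cong'[OF abelian_monoid_sg_ring])
        (auto simp: a_def l0 assms(2) sg_term_closed sg_ring_zero_one_closed)
    also have "\<dots> = (\<lambda>t. \<Sum>l<n. (if l = l0 then a l0 else \<zero>\<^bsub>?R\<^esub>) t)"
      by (rule finsum_sg_ring) (auto simp: a_def l0 assms(2) sg_term_closed sg_ring_zero_one_closed)
    also have "\<dots> = (\<lambda>t. \<Sum>l<n. if l = l0 then a l0 t else 0)"
      by (intro ext sum.cong) (auto simp: sg_ring_simps(1))
    also have "\<dots> = a l0" using l0 by simp
    finally show ?thesis by (simp add: a_def l0_def)
  qed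
  then show ?thesis
    by (auto simp: circ_def ring_mat_smult_def cyclic_shift_pow[OF assms(1)])
qed

end

section \<open>Designs from Clifford labellings\<close>

lemma sum_mod_shift:
  fixes f :: "nat \<Rightarrow> 'a::comm_monoid_add"
  assumes "N > 0"
  shows "(\<Sum>l<N. f ((l + a) mod N)) = (\<Sum>l<N. f l)"
proof (induction a arbitrary: f)
  case 0
  show ?case by (intro sum.cong) auto
next
  case (Suc a)
  have step: "(\<Sum>l<N. f (Suc l mod N)) = (\<Sum>l<N. f l)"
  proof -
    obtain M where M: "N = Suc M" using assms gr0_conv_Suc by blast
    have "(\<Sum>l<N. f (Suc l mod N)) = (\<Sum>l<M. f (Suc l)) + f 0" by (simp add: M)
    then show ?thesis by (simp add: M sum.lessThan_Suc_shift add.commute del: sum.lessThan_Suc)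
  qed
  show ?case using Suc[of "\<lambda>x. f (Suc x mod N)"] by (simp add: mod_Suc_eq step)
qed

lemma sum_mod_neg:
  fixes f :: "nat \<Rightarrow> 'a::comm_monoid_add"
  assumes "N > 0"
  shows "(\<Sum>l<N. f ((N - l) mod N)) = (\<Sum>l<N. f l)"
  by (rule sum.reindex_bij_witness[of _ "\<lambda>l. (N - l) mod N" "\<lambda>l. (N - l) mod N"])
    (use assms in \<open>auto simp: mod_if\<close>)

section \<open>Indeterminates and constants among the real polynomials\<close>

lemma var_lookup: "Poly_Mapping.lookup (var i) (Poly_Mapping.single i 1) = 1"
  by (simp add: var_def lookup_single)

text \<open>The second inequality is what makes \<open>sg_abs\<close> well defined: an entry can be
  written with s or with its negative, and the latter would turn x_i into -x_j.\<close>

lemma var_neq: "var i \<noteq> 0" "var i \<noteq> - var j"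
proof -
  show "var i \<noteq> 0" using var_lookup[of i] by auto
  have "Poly_Mapping.lookup (var j) m \<ge> 0" for m by (simp add: var_def lookup_single when_def)
  then have "Poly_Mapping.lookup (- var j) (Poly_Mapping.single i 1) \<le> 0" by simp
  then show "var i \<noteq> - var j" using var_lookup[of i] by auto
qed

text \<open>Real coefficients have no 2-torsion. This disposes of a sum that a change of index turns
  into its own negative.\<close>

lemma rpoly_self_neg_zero: "(x :: rpoly) = - x \<Longrightarrow> x = 0"
  by (rule poly_mapping_eqI) (metis equal_neg_zero lookup_uminus lookup_zero)

definition const_poly :: "real \<Rightarrow> rpoly" where
  "const_poly r = Poly_Mapping.single 0 r"

lemma const_poly_sum: "const_poly (\<Sum>a\<in>A. f a) = (\<Sum>a\<in>A. const_poly (f a))"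
proof (cases "finite A")
  case True
  then show ?thesis by (induction A) (simp_all add: const_poly_def single_add)
qed (simp add: const_poly_def)

lemma const_poly_simps: "const_poly 0 = 0" "const_poly 1 = 1" "const_poly (- r) = - const_poly r"
  by (simp_all add: const_poly_def single_uminus)

text \<open>I acts as the imaginary unit. It has to commute with the involutions, but not with all
  of S, because S will be a copy of the full signed permutation group.\<close>

locale clifford_signed_group = signed_group S for S :: "('g, 'm) signed_monoid_scheme" (structure) +
  fixes I :: 'g and E :: "nat \<Rightarrow> 'g" and V :: nat
  assumes I_closed: "I \<in> carrier S" and I_square: "I \<otimes> I = \<epsilon>"
    and E_closed: "v < V \<Longrightarrow> E v \<in> carrier S" and E_square: "v < V \<Longrightarrow> E v \<otimes> E v = \<one>"
    and E_anticommute: "v < V \<Longrightarrow> w < V \<Longrightarrow> v \<noteq> w \<Longrightarrow> E v \<otimes> E w = \<epsilon> \<otimes> (E w \<otimes> E v)"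
    and I_E_commute: "v < V \<Longrightarrow> I \<otimes> E v = E v \<otimes> I"
begin

text \<open>Embeds the fourth roots of unity into S. The last branch is meant for -i; as a default
  for other arguments it keeps all values in the carrier.\<close>

definition scalar :: "complex \<Rightarrow> 'g" where
  "scalar z = (if z = 1 then \<one> else if z = - 1 then \<epsilon> else if z = \<i> then I else \<epsilon> \<otimes> I)"

lemma scalar_closed: "scalar z \<in> carrier S"
  using I_closed neg_one_closed by (simp add: scalar_def)

lemma scalar_values: "scalar 1 = \<one>" "scalar (- 1) = \<epsilon>" "scalar \<i> = I" "scalar (- \<i>) = \<epsilon> \<otimes> I"
  by (auto simp: scalar_def complex_eq_iff)

lemma scalar_mult:
  assumes "x \<in> quaternary" "y \<in> quaternary"
  shows "scalar (x * y) = scalar x \<otimes> scalar y"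
proof -
  have *: "I \<otimes> (\<epsilon> \<otimes> I) = \<one>" "\<epsilon> \<otimes> I \<otimes> (\<epsilon> \<otimes> I) = \<epsilon>" "\<epsilon> \<otimes> I \<otimes> I = \<one>" "I \<otimes> \<epsilon> = \<epsilon> \<otimes> I"
    "\<epsilon> \<otimes> I \<otimes> \<epsilon> = I" "\<epsilon> \<otimes> (\<epsilon> \<otimes> I) = I"
  proof -
    have c: "I \<otimes> \<epsilon> = \<epsilon> \<otimes> I" using neg_one_central[OF I_closed] by simp
    then show "I \<otimes> \<epsilon> = \<epsilon> \<otimes> I" .
    show 1: "\<epsilon> \<otimes> (\<epsilon> \<otimes> I) = I" using neg_one_neg_one I_closed by simp
    show 2: "\<epsilon> \<otimes> I \<otimes> I = \<one>" using I_closed neg_one_closed I_square neg_one_square by (simp add: m_assoc)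
    show 3: "\<epsilon> \<otimes> I \<otimes> \<epsilon> = I" using 1 c I_closed neg_one_closed by (simp add: m_assoc)
    show "I \<otimes> (\<epsilon> \<otimes> I) = \<one>" using 2 c I_closed neg_one_closed by (simp flip: m_assoc)
    show "\<epsilon> \<otimes> I \<otimes> (\<epsilon> \<otimes> I) = \<epsilon>" using 3 I_square I_closed neg_one_closed by (simp flip: m_assoc)
  qed
  show ?thesis using assms * I_closed neg_one_closed neg_one_square I_square
    by (auto simp: quaternary_def scalar_values)
qed

lemma scalar_E_commute: "v < V \<Longrightarrow> scalar z \<otimes> E v = E v \<otimes> scalar z"
  using neg_one_central[of "E v"] I_E_commute[of v] I_closed neg_one_closed E_closed[of v]
  by (auto simp: scalar_def m_assoc) (metis m_assoc)

lemma inv_scalar: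
  assumes "z \<in> quaternary"
  shows "inv (scalar z) = scalar (cnj z)"
proof -
  have "cnj z * z = 1" using assms by (auto simp: quaternary_def)
  then have "scalar (cnj z) \<otimes> scalar z = \<one>"
    using scalar_mult[of "cnj z" z] assms quaternary_closed scalar_values(1) by simp
  then show ?thesis by (rule inv_equality) (auto simp: scalar_closed)
qed

lemma unit_quotient:
  assumes "v < V" "v' < V" "z \<in> quaternary" "z' \<in> quaternary"
  shows "(scalar z \<otimes> E v) \<otimes> inv (scalar z' \<otimes> E v') = scalar (z * cnj z') \<otimes> (E v \<otimes> E v')"
proof -
  have "inv (E v') = E v'" using assms E_square E_closed by (intro inv_equality) auto
  then have "inv (scalar z' \<otimes> E v') = scalar (cnj z') \<otimes> E v'"
    using assms E_closed scalar_closed inv_scalar scalar_E_commute by (simp add: inv_mult_group)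
  then have "(scalar z \<otimes> E v) \<otimes> inv (scalar z' \<otimes> E v') = scalar z \<otimes> (E v \<otimes> scalar (cnj z')) \<otimes> E v'"
    using assms E_closed scalar_closed by (simp add: m_assoc)
  also have "\<dots> = (scalar z \<otimes> scalar (cnj z')) \<otimes> (E v \<otimes> E v')"
    using assms E_closed scalar_closed by (simp add: m_assoc flip: scalar_E_commute)
  also have "scalar z \<otimes> scalar (cnj z') = scalar (z * cnj z')"
    using assms by (simp add: scalar_mult quaternary_closed)
  finally show ?thesis .
qed

text \<open>The real-linear extension of \<open>scalar\<close> to the complex numbers, with values
  in the group ring and read off at t. Sums of products of weights can thus be formed in the complex
  numbers.\<close>

definition lin :: "complex \<Rightarrow> 'g \<Rightarrow> rpoly" where
  "lin z t = const_poly (Re z) * sg_term S 1 \<one> t + const_poly (Im z) * sg_term S 1 I t"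

lemma lin_sum: "lin (\<Sum>a\<in>A. f a) t = (\<Sum>a\<in>A. lin (f a) t)"
  by (simp add: lin_def const_poly_sum sum_distrib_right sum.distrib)

lemma lin_zero: "lin 0 t = 0"
  by (simp add: lin_def const_poly_simps)

lemma sg_term_scalar:
  assumes "z \<in> quaternary"
  shows "sg_term S r (scalar z) t = r * lin z t"
proof -
  have "sg_term S r s t = r * sg_term S 1 s t" for r :: rpoly and s by (metis mult.right_neutral sg_term_mult_left)
  moreover have "sg_term S 1 (scalar z) t = lin z t"
    using assms sg_term_neg[OF one_closed, of 1 t] sg_term_neg[OF I_closed, of 1 t] neg_one_closed
    by (auto simp: quaternary_def scalar_values lin_def const_poly_simps)
  ultimately show ?thesis by metis
qed

end

section \<open>Absolute values of entries\<close>

context signed_group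
begin

lemma sg_term_var_neq_zero: "sg_term S (var l) s \<noteq> \<zero>\<^bsub>sg_ring S\<^esub>"
  using var_neq(1)[of l] unfolding sg_ring_simps by (metis sg_term_self)

lemma sg_abs_term:
  assumes "s \<in> carrier S"
  shows "sg_abs S (sg_term S (var l) s) = var l"
proof -
  have "var l = var l'" if "sg_term S (var l) s = sg_term S (var l') s'" for l' s'
    using fun_cong[OF that, of s] var_neq[of l] unfolding sg_term_self
    by (auto simp: sg_term_def split: if_splits)
  then have "(THE x. \<exists>l'. \<exists>s' \<in> carrier S. sg_term S (var l) s = sg_term S (var l') s' \<and> x = var l') = var l"
    using assms by (intro the_equality) auto
  then show ?thesis by (simp add: sg_abs_def sg_term_var_neq_zero)
qed

end

lemma sum_group_colour:
  fixes h :: "nat \<Rightarrow> 'a::comm_monoid_add"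
  assumes "finite A"
  shows "(\<Sum>v\<in>A. h v) = (\<Sum>l\<in>colour ` A. \<Sum>v | v \<in> A \<and> colour v = l. h v)"
  using sum.image_gen[OF assms, of h colour] .

text \<open>The positions with label v carry the coefficients of W_v; \<open>lab_neg\<close> and
  \<open>wt_neg\<close> make it self-adjoint, and having one label at each position makes the
  supports disjoint.\<close>

locale clifford_labelling = clifford_signed_group S I E V
  for S :: "('g, 'm) signed_monoid_scheme" (structure) and I E V +
  fixes N k :: nat and uu lab colour :: "nat \<Rightarrow> nat" and wt :: "nat \<Rightarrow> complex" and c :: "nat \<Rightarrow> real"
  assumes N_pos: "N > 0"
    and lab_less: "r < N \<Longrightarrow> lab r < V" and wt_quaternary: "r < N \<Longrightarrow> wt r \<in> quaternary"
    and lab_neg: "r < N \<Longrightarrow> lab ((N - r) mod N) = lab r"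
    and wt_neg: "r < N \<Longrightarrow> wt ((N - r) mod N) = cnj (wt r)"
    and colour_card: "card {r. r < N \<and> colour (lab r) = l} = (if l \<in> {1..k} then uu l else 0)"
    and spectrum: "\<omega> ^ N = 1 \<Longrightarrow> (\<Sum>v | v < V \<and> colour v = l.
       (cmod (\<Sum>r<N. (if lab r = v then wt r else 0) * \<omega> ^ r))\<^sup>2) = c l"
    and uu_pos: "i \<in> {1..k} \<Longrightarrow> uu i > 0"
begin

definition unit :: "nat \<Rightarrow> 'g" where
  "unit r = scalar (wt r) \<otimes> E (lab r)"

definition indet :: "nat \<Rightarrow> rpoly" where
  "indet r = var (colour (lab r))"

lemma unit_closed: "r < N \<Longrightarrow> unit r \<in> carrier S"
  by (simp add: unit_def scalar_closed E_closed lab_less)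

lemma indet_neg: "r < N \<Longrightarrow> indet ((N - r) mod N) = indet r"
  by (simp add: indet_def lab_neg)

lemma unit_quotient':
  assumes "r < N" "r' < N"
  shows "unit r \<otimes> inv (unit r') = scalar (wt r * cnj (wt r')) \<otimes> (E (lab r) \<otimes> E (lab r'))"
  unfolding unit_def using assms by (intro unit_quotient lab_less wt_quaternary)

lemma colour_range: "r < N \<Longrightarrow> colour (lab r) \<in> {1..k}"
proof (rule ccontr)
  assume r: "r < N" "colour (lab r) \<notin> {1..k}"
  then have "card {r'. r' < N \<and> colour (lab r') = colour (lab r)} = 0"
    by (simp only: colour_card r(2) if_False simp_thms)
  with r(1) show False by simp blast
qed

definition corr :: "nat \<Rightarrow> nat \<Rightarrow> 'g \<Rightarrow> rpoly" where
  "corr r r' = sg_term S (indet r * indet r') (unit r \<otimes> inv (unit r'))"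

text \<open>Swapping and negating the two positions leaves the product of the weights unchanged, but
  reverses the order of two different involutions, and they anticommute.\<close>

lemma corr_neg:
  assumes "r < N" "r' < N" "lab r \<noteq> lab r'"
  shows "corr ((N - r') mod N) ((N - r) mod N) t = - corr r r' t"
proof -
  define q where "q = scalar (wt r * cnj (wt r')) \<otimes> (E (lab r) \<otimes> E (lab r'))"
  have lt: "(N - r') mod N < N" "(N - r) mod N < N" using N_pos by simp_all
  have q: "q \<in> carrier S" using assms by (simp add: q_def scalar_closed E_closed lab_less)
  have "unit ((N - r') mod N) \<otimes> inv (unit ((N - r) mod N))
      = scalar (wt r * cnj (wt r')) \<otimes> (\<epsilon> \<otimes> (E (lab r) \<otimes> E (lab r')))"
    using assms E_anticommute[of "lab r'" "lab r"]
    by (simp add: unit_quotient'[OF lt] lab_neg wt_neg lab_less mult.commute)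
  also have "\<dots> = \<epsilon> \<otimes> q"
    using neg_one_central[of "scalar (wt r * cnj (wt r'))"] scalar_closed[of "wt r * cnj (wt r')"]
      neg_one_closed assms E_closed lab_less
    by (simp add: q_def flip: m_assoc)
  finally show ?thesis
    using assms unit_quotient'[OF assms(1,2)] q
    by (simp add: corr_def indet_neg sg_term_neg q_def mult.commute)
qed

text \<open>Equal involutions cancel and leave a scalar. It is spread over all labels v, with a
  single nonzero term, so that summation over positions yields one autocorrelation for each
  label.\<close>

lemma corr_same_label:
  assumes "r < N" "r' < N" "lab r = lab r'"
  shows "corr r r' t = (\<Sum>v<V. (var (colour v))\<^sup>2 *
    lin ((if lab r = v then wt r else 0) * cnj (if lab r' = v then wt r' else 0)) t)"
proof -
  have "unit r \<otimes> inv (unit r') = scalar (wt r * cnj (wt r'))"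
    using unit_quotient'[OF assms(1,2)] E_square[OF lab_less[OF assms(1)]] scalar_closed assms(3) by simp
  then have "corr r r' t = (var (colour (lab r)))\<^sup>2 * lin (wt r * cnj (wt r')) t"
    using assms wt_quaternary
    by (simp add: corr_def sg_term_scalar quaternary_closed indet_def power2_eq_square)
  also have "\<dots> = (\<Sum>v<V. if v = lab r then (var (colour v))\<^sup>2 * lin (wt r * cnj (wt r')) t else 0)"
    using lab_less[OF assms(1)] by simp
  also have "\<dots> = (\<Sum>v<V. (var (colour v))\<^sup>2 *
    lin ((if lab r = v then wt r else 0) * cnj (if lab r' = v then wt r' else 0)) t)"
    using assms(3) by (intro sum.cong) (auto simp: lin_zero)
  finally show ?thesis .
qed

text \<open>
  The terms with different labels cancel under \<open>(r', r) \<mapsto> (- r, - r')\<close>; those with equal labels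
  add up to the autocorrelation of the weights.
\<close>

lemma corr_sum_zero:
  assumes "0 < d" "d < N"
  shows "(\<Sum>r<N. corr ((r + d) mod N) r t) = 0"
proof -
  define f where "f v r = (if lab r = v then wt r else 0)" for v r
  define F where "F r = (if lab ((r + d) mod N) = lab r then 0 else corr ((r + d) mod N) r t)" for r
  define G where "G r = (if lab ((r + d) mod N) = lab r then corr ((r + d) mod N) r t else 0)" for r
  have lt: "(r + d) mod N < N" for r using N_pos by simp
  have F_neg: "F ((N - (r + d) mod N) mod N) = - F r" if "r < N" for r
  proof -
    \<comment> \<open>This is -(r + d) + d = -r modulo N.\<close>
    have *: "((N - (r + d) mod N) mod N + d) mod N = (N - r) mod N"
      using that assms by (cases "r + d < N"; cases "r = 0"; cases "r + d = N") (auto simp: mod_if)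
    show ?thesis
      unfolding F_def * using that corr_neg[OF lt that] lab_neg[OF that] lab_neg[OF lt] by auto
  qed
  have "(\<Sum>r<N. F r) = (\<Sum>r<N. F ((N - r) mod N))" by (rule sum_mod_neg[OF N_pos, symmetric])
  also have "\<dots> = (\<Sum>r<N. F ((N - (r + d) mod N) mod N))"
    by (rule sum_mod_shift[OF N_pos, symmetric])
  also have "\<dots> = - (\<Sum>r<N. F r)" by (simp add: F_neg sum_negf)
  finally have F: "(\<Sum>r<N. F r) = 0" by (rule rpoly_self_neg_zero)
  have "(\<Sum>r<N. G r) = (\<Sum>r<N. \<Sum>v<V. (var (colour v))\<^sup>2 * lin (f v ((r + d) mod N) * cnj (f v r)) t)"
  proof (rule sum.cong[OF refl])
    fix r assume "r \<in> {..<N}"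
    then show "G r = (\<Sum>v<V. (var (colour v))\<^sup>2 * lin (f v ((r + d) mod N) * cnj (f v r)) t)"
      using corr_same_label[OF lt, of r r t]
      by (auto simp: G_def f_def lin_zero intro!: sum.neutral)
  qed
  also have "\<dots> = (\<Sum>v<V. (var (colour v))\<^sup>2 * lin (\<Sum>r<N. f v ((r + d) mod N) * cnj (f v r)) t)"
    by (subst sum.swap) (simp add: lin_sum sum_distrib_left)
  \<comment> \<open>The autocorrelations vanish only when added over all labels of one colour. These
    labels share the factor \<open>(var l)\<^sup>2\<close>, so it can be taken out first.\<close>
  also have "\<dots> = (\<Sum>l\<in>colour ` {..<V}. \<Sum>v | v \<in> {..<V} \<and> colour v = l.
      (var (colour v))\<^sup>2 * lin (\<Sum>r<N. f v ((r + d) mod N) * cnj (f v r)) t)"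
    by (rule sum_group_colour) simp
  also have "\<dots> = (\<Sum>l\<in>colour ` {..<V}. (var l)\<^sup>2 *
      lin (\<Sum>v | v < V \<and> colour v = l. \<Sum>r<N. f v ((r + d) mod N) * cnj (f v r)) t)"
    unfolding lin_sum[where A = "{v. v < V \<and> colour v = _}"] sum_distrib_left
    by (intro sum.cong) auto
  also have "\<dots> = (\<Sum>l\<in>colour ` {..<V}. (var l)\<^sup>2 * lin 0 t)"
    using dft_autocorrelation[OF _ assms, of f] spectrum unfolding f_def by (intro sum.cong) auto
  also have "\<dots> = 0" by (simp add: lin_zero)
  finally have "(\<Sum>r<N. G r) = 0" .
  moreover have "(\<Sum>r<N. corr ((r + d) mod N) r t) = (\<Sum>r<N. F r) + (\<Sum>r<N. G r)"
    unfolding sum.distrib[symmetric] by (intro sum.cong) (auto simp: F_def G_def)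
  ultimately show ?thesis using F by simp
qed

lemma corr_sum_diag: "(\<Sum>r<N. corr r r t) = sg_term S (\<Sum>l=1..k. of_nat (uu l) * (var l)\<^sup>2) \<one> t"
proof -
  have "(\<Sum>r<N. corr r r t) = (\<Sum>r<N. sg_term S ((indet r)\<^sup>2) \<one> t)"
    by (intro sum.cong) (auto simp: corr_def unit_closed power2_eq_square)
  also have "\<dots> = sg_term S (\<Sum>r<N. (indet r)\<^sup>2) \<one> t" by (rule sg_term_sum[symmetric])
  also have "(\<Sum>r<N. (indet r)\<^sup>2) = (\<Sum>l=1..k. \<Sum>r | r \<in> {..<N} \<and> colour (lab r) = l. (indet r)\<^sup>2)"
    using colour_range by (intro sum.group[symmetric]) auto
  also have "\<dots> = (\<Sum>l=1..k. of_nat (uu l) * (var l)\<^sup>2)"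
    using colour_card by (intro sum.cong) (simp_all add: indet_def)
  finally show ?thesis .
qed

section \<open>The circulant design\<close>

definition design :: "('g \<Rightarrow> rpoly) mat" where
  "design = circ (sg_ring S) N (\<lambda>l. sg_term S (indet (l - 1)) (unit (l - 1)))"

lemma design_eq:
  "design = mat N N (\<lambda>(i, j). sg_term S (indet ((j + N - i) mod N)) (unit ((j + N - i) mod N)))"
  unfolding design_def using N_pos unit_closed by (rule circ_term)

lemma adjoint_design:
  "sg_adjoint S design = mat N N (\<lambda>(i, j).
     sg_term S (indet ((i + N - j) mod N)) (inv (unit ((i + N - j) mod N))))"
  by (rule eq_matI) (use N_pos in \<open>auto simp: sg_adjoint_def design_eq sg_conj_term unit_closed\<close>)

lemma circulant_design: "circulant (sg_ring S) N design"
  unfolding circulant_def design_def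
  by (intro exI conjI[rotated], rule refl) (auto intro!: sg_term_closed unit_closed)

lemma full_design: "full S design"
  by (auto simp: full_def design_eq indet_def sg_term_var_neq_zero)

text \<open>The positions j - i and i - j are negatives of each other and so have the same label,
  hence the same indeterminate.\<close>

lemma quasisymmetric_design: "quasisymmetric S design"
proof -
  have "indet ((j + N - i) mod N) = indet ((i + N - j) mod N)" if "i < N" "j < N" for i j
  proof -
    have "(j + N - i) mod N = (N - (i + N - j) mod N) mod N"
      using that by (auto simp: mod_if)
    then show ?thesis using indet_neg[of "(i + N - j) mod N"] N_pos by simp
  qed
  then show ?thesis unfolding quasisymmetric_def adjoint_design unfolding design_eq
    by (intro eq_matI) (use N_pos in \<open>auto simp: indet_def sg_abs_term unit_closed\<close>)
qed

lemma sod_design: "sod S N k uu design"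
proof -
  let ?R = "sg_ring S :: ('g \<Rightarrow> rpoly) ring"
  let ?c = "sg_term S (\<Sum>i=1..k. of_nat (uu i) * (var i)\<^sup>2) \<one>"
  have lt: "a mod N < N" for a using N_pos by simp
  have entry: "(\<Oplus>\<^bsub>?R\<^esub>l\<in>{..<N}. design $$ (i, l) \<otimes>\<^bsub>?R\<^esub> sg_adjoint S design $$ (l, j))
      = ?c \<otimes>\<^bsub>?R\<^esub> (if i = j then \<one>\<^bsub>?R\<^esub> else \<zero>\<^bsub>?R\<^esub>)" if ij: "i < N" "j < N" for i j
  proof -
    have "(\<Oplus>\<^bsub>?R\<^esub>l\<in>{..<N}. design $$ (i, l) \<otimes>\<^bsub>?R\<^esub> sg_adjoint S design $$ (l, j))
        = (\<Oplus>\<^bsub>?R\<^esub>l\<in>{..<N}. corr ((l + N - i) mod N) ((l + N - j) mod N))"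
      using ij by (intro abelian_monoid.finsum_cong'[OF abelian_monoid_sg_ring])
        (auto simp: design_eq adjoint_design[unfolded design_eq] corr_def sg_term_mult sg_term_closed unit_closed lt)
    also have "\<dots> = (\<lambda>t. \<Sum>l<N. corr ((l + N - i) mod N) ((l + N - j) mod N) t)"
      by (rule finsum_sg_ring) (auto simp: corr_def sg_term_closed unit_closed lt)
    also have "\<dots> = (\<lambda>t. \<Sum>r<N. corr ((r + (j + N - i) mod N) mod N) r t)"
    proof
      fix t
      \<comment> \<open>Substituting r = l - j turns l - i into r + (j - i), so the entry is an
        autocorrelation at the shift j - i.\<close>
      define H where "H r = corr ((r + (j + N - i) mod N) mod N) r t" for r
      have "corr ((l + N - i) mod N) ((l + N - j) mod N) t = H ((l + (N - j)) mod N)" for l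
      proof -
        have "l + (N - j) + (j + N - i) = (l + N - i) + N" using ij by simp
        then have "((l + (N - j)) mod N + (j + N - i) mod N) mod N = (l + N - i) mod N"
          by (simp add: mod_add_eq)
        then show ?thesis using ij by (simp add: H_def)
      qed
      then show "(\<Sum>l<N. corr ((l + N - i) mod N) ((l + N - j) mod N) t)
          = (\<Sum>r<N. corr ((r + (j + N - i) mod N) mod N) r t)"
        using sum_mod_shift[OF N_pos, of H "N - j"] by (simp add: H_def)
    qed
    also have "\<dots> = ?c \<otimes>\<^bsub>?R\<^esub> (if i = j then \<one>\<^bsub>?R\<^esub> else \<zero>\<^bsub>?R\<^esub>)"
    proof (cases "i = j")
      case True
      then have "(\<lambda>t. \<Sum>r<N. corr ((r + (j + N - i) mod N) mod N) r t) = ?c"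
        using corr_sum_diag by simp
      then show ?thesis using True by (simp add: sg_ring_simps(2) sg_term_mult)
    next
      case False
      then have "0 < (j + N - i) mod N" using ij by (auto simp: mod_if)
      then show ?thesis using False corr_sum_zero[OF _ lt]
        by (simp only: if_False sg_ring_simps(4)) (simp add: sg_ring_simps(1))
    qed
    finally show ?thesis .
  qed
  have dims: "dim_row design = N" "dim_col design = N" "dim_row (sg_adjoint S design) = N"
    "dim_col (sg_adjoint S design) = N" by (simp_all add: design_eq sg_adjoint_def)
  have "ring_mat_mult ?R design (sg_adjoint S design) = ring_mat_smult ?R ?c (ring_mat_one ?R N)"
    by (rule eq_matI) (simp_all add: ring_mat_mult_def ring_mat_smult_def ring_mat_one_def dims entry)
  moreover have "\<exists>s\<in>carrier S. \<exists>l\<in>{1..k}. design $$ (i, j) = sg_term S (var l) s" if "i < N" "j < N" for i j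
    using that
    by (intro bexI[of _ "unit ((j + N - i) mod N)"] bexI[of _ "colour (lab ((j + N - i) mod N))"]
        unit_closed[of "(j + N - i) mod N"] colour_range[of "(j + N - i) mod N"] lt)
      (simp add: design_eq indet_def)
  ultimately show ?thesis unfolding sod_def using uu_pos dims by (auto intro: carrier_matI)
qed

end

section \<open>Signed permutation matrices\<close>

text \<open>Applied to the rows and columns of an integral orthogonal matrix, this makes them signed
  unit vectors.\<close>

lemma int_sum_squares_one:
  fixes a :: "'i \<Rightarrow> int"
  assumes "finite J" "(\<Sum>j\<in>J. a j * a j) = 1"
  shows "\<exists>!j. j \<in> J \<and> a j \<noteq> 0" "j \<in> J \<Longrightarrow> a j \<in> {-1, 0, 1}"
proof -
  have "\<exists>j\<in>J. a j \<noteq> 0" by (rule ccontr) (use assms(2) in simp)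
  then obtain j0 where j0: "j0 \<in> J" "a j0 \<noteq> 0" by blast
  have split: "(\<Sum>j\<in>J. a j * a j) = a j0 * a j0 + (\<Sum>j\<in>J - {j0}. a j * a j)"
    by (rule sum.remove) (use assms j0 in auto)
  have pos: "(\<Sum>j\<in>J - {j0}. a j * a j) \<ge> 0" by (intro sum_nonneg) simp
  have ge: "a j0 * a j0 \<ge> 1" using j0(2) zero_less_power2[of "a j0"] by (simp add: power2_eq_square)
  with pos split assms(2) have "(\<Sum>j\<in>J - {j0}. a j * a j) = 0" and one: "a j0 * a j0 = 1" by linarith+
  then have "\<forall>j\<in>J - {j0}. a j * a j = 0" using assms(1) by (subst (asm) sum_nonneg_eq_0_iff) auto
  then have zero: "a j = 0" if "j \<in> J" "j \<noteq> j0" for j using that by auto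
  from one have "a j0 = 1 \<or> a j0 = -1" by (simp add: square_eq_1_iff)
  then show "j \<in> J \<Longrightarrow> a j \<in> {-1, 0, 1}" using zero by (cases "j = j0") auto
  show "\<exists>!j. j \<in> J \<and> a j \<noteq> 0" using j0 zero by blast
qed

definition orthogonal_int_mat :: "nat \<Rightarrow> int mat \<Rightarrow> bool" where
  "orthogonal_int_mat m A \<longleftrightarrow> A \<in> carrier_mat m m \<and> A * A\<^sup>T = 1\<^sub>m m \<and> A\<^sup>T * A = 1\<^sub>m m"

lemma mult_transpose_index:
  assumes "A \<in> carrier_mat m m" "i < m" "k < m"
  shows "(A * A\<^sup>T) $$ (i, k) = (\<Sum>j\<in>{..<m}. A $$ (i, j) * A $$ (k, j))"
  using assms by (simp add: scalar_prod_def lessThan_atLeast0)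

lemma monomial_mult_transpose:
  fixes A :: "int mat"
  assumes "A \<in> carrier_mat m m" "\<forall>i<m. \<forall>j<m. A $$ (i, j) \<in> {-1, 0, 1}"
    "\<forall>i<m. \<exists>!j. j < m \<and> A $$ (i, j) \<noteq> 0" "\<forall>j<m. \<exists>!i. i < m \<and> A $$ (i, j) \<noteq> 0"
  shows "A * A\<^sup>T = 1\<^sub>m m"
proof (rule eq_matI)
  fix i k assume ik: "i < dim_row (1\<^sub>m m)" "k < dim_col (1\<^sub>m m)"
  obtain j0 where j0: "j0 < m" "A $$ (i, j0) \<noteq> 0" "\<And>j. j < m \<Longrightarrow> j \<noteq> j0 \<Longrightarrow> A $$ (i, j) = 0"
    using assms(3) ik by (metis index_one_mat(2))
  have "(\<Sum>j\<in>{..<m}. A $$ (i, j) * A $$ (k, j)) = A $$ (i, j0) * A $$ (k, j0)"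
    by (subst sum.remove[of _ j0]) (use j0 in auto)
  moreover have "A $$ (k, j0) = 0" if "i \<noteq> k" using assms(4) j0 ik that by auto
  moreover have "A $$ (i, j0) * A $$ (i, j0) = 1" using assms(2) ik j0 by fastforce
  ultimately show "(A * A\<^sup>T) $$ (i, k) = 1\<^sub>m m $$ (i, k)"
    using mult_transpose_index[OF assms(1)] ik by auto
qed (use assms in auto)

text \<open>With orthogonality in place of conditions on entries, the group laws and the membership
  of block matrices become matrix algebra.\<close>

lemma signed_perm_group_carrier: "carrier (signed_perm_group m) = {A. orthogonal_int_mat m A}"
proof (rule Set.set_eqI, rule iffI)
  fix A assume "A \<in> carrier (signed_perm_group m)"
  then have A: "A \<in> carrier_mat m m" "\<forall>i<m. \<forall>j<m. A $$ (i, j) \<in> {-1, 0, 1}"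
    "\<forall>i<m. \<exists>!j. j < m \<and> A $$ (i, j) \<noteq> 0" "\<forall>j<m. \<exists>!i. i < m \<and> A $$ (i, j) \<noteq> 0"
    by (auto simp: signed_perm_group_def)
  have T: "A\<^sup>T $$ (i, j) = A $$ (j, i)" if "i < m" "j < m" for i j using A(1) that by auto
  have "A\<^sup>T * A\<^sup>T\<^sup>T = 1\<^sub>m m"
  proof (rule monomial_mult_transpose)
    show "\<forall>i<m. \<exists>!j. j < m \<and> A\<^sup>T $$ (i, j) \<noteq> 0" using A(4) T by (metis (no_types, lifting))
    show "\<forall>j<m. \<exists>!i. i < m \<and> A\<^sup>T $$ (i, j) \<noteq> 0" using A(3) T by (metis (no_types, lifting))
  qed (use A(1,2) T in auto)
  then show "A \<in> {A. orthogonal_int_mat m A}"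
    using A monomial_mult_transpose[OF A] by (simp add: orthogonal_int_mat_def)
next
  fix A assume "A \<in> {A. orthogonal_int_mat m A}"
  then have A: "A \<in> carrier_mat m m" "A * A\<^sup>T = 1\<^sub>m m" "A\<^sup>T * A = 1\<^sub>m m" by (auto simp: orthogonal_int_mat_def)
  have row: "(\<Sum>j\<in>{..<m}. A $$ (i, j) * A $$ (i, j)) = 1" if "i < m" for i
    using mult_transpose_index[OF A(1) that that] A(2) that by simp
  have column: "(\<Sum>i\<in>{..<m}. A $$ (i, j) * A $$ (i, j)) = 1" if "j < m" for j
  proof -
    have "(\<Sum>i\<in>{..<m}. A\<^sup>T $$ (j, i) * A\<^sup>T $$ (j, i)) = 1"
      using mult_transpose_index[of "A\<^sup>T" m j j] A(1,3) that by simp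
    then show ?thesis using A(1) that by simp
  qed
  have "A $$ (i, j) \<in> {-1, 0, 1}" if "i < m" "j < m" for i j
    using int_sum_squares_one(2)[OF _ row[OF that(1)], of j] that by simp
  moreover have "\<exists>!j. j < m \<and> A $$ (i, j) \<noteq> 0" if "i < m" for i
    using int_sum_squares_one(1)[OF _ row[OF that]] by simp
  moreover have "\<exists>!i. i < m \<and> A $$ (i, j) \<noteq> 0" if "j < m" for j
    using int_sum_squares_one(1)[OF _ column[OF that]] by simp
  ultimately show "A \<in> carrier (signed_perm_group m)" using A(1) by (simp add: signed_perm_group_def)
qed

lemma signed_perm_group_sel:
  "A \<otimes>\<^bsub>signed_perm_group m\<^esub> B = A * B" "\<one>\<^bsub>signed_perm_group m\<^esub> = 1\<^sub>m m"
  "\<epsilon>\<^bsub>signed_perm_group m\<^esub> = - 1\<^sub>m m"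
  by (simp_all add: signed_perm_group_def)

lemma orthogonal_int_mat_mult:
  assumes "orthogonal_int_mat m A" "orthogonal_int_mat m B"
  shows "orthogonal_int_mat m (A * B)"
proof -
  have A: "A \<in> carrier_mat m m" "A\<^sup>T \<in> carrier_mat m m" "A * A\<^sup>T = 1\<^sub>m m" "A\<^sup>T * A = 1\<^sub>m m"
    and B: "B \<in> carrier_mat m m" "B\<^sup>T \<in> carrier_mat m m" "B * B\<^sup>T = 1\<^sub>m m" "B\<^sup>T * B = 1\<^sub>m m"
    using assms by (auto simp: orthogonal_int_mat_def)
  have "(A * B) * (B\<^sup>T * A\<^sup>T) = A * (B * B\<^sup>T) * A\<^sup>T"
    using A(1,2) B(1,2) by (simp add: assoc_mult_mat[of _ m m _ m _ m])
  moreover have "(B\<^sup>T * A\<^sup>T) * (A * B) = B\<^sup>T * (A\<^sup>T * A) * B"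
    using A(1,2) B(1,2) by (simp add: assoc_mult_mat[of _ m m _ m _ m])
  ultimately show ?thesis using A B by (simp add: orthogonal_int_mat_def transpose_mult[of _ m m _ m])
qed

lemma signed_group_signed_perm_group:
  assumes "m > 0"
  shows "signed_group (signed_perm_group m)"
proof -
  have C: "A \<in> carrier_mat m m" "A\<^sup>T \<in> carrier_mat m m" if "orthogonal_int_mat m A" for A
    using that by (auto simp: orthogonal_int_mat_def)
  have one: "orthogonal_int_mat m (1\<^sub>m m)" by (simp add: orthogonal_int_mat_def transpose_one)
  have "group (signed_perm_group m)"
  proof (rule groupI; unfold signed_perm_group_carrier signed_perm_group_sel mem_Collect_eq)
    fix A B assume "orthogonal_int_mat m A" "orthogonal_int_mat m B"
    then show "orthogonal_int_mat m (A * B)" by (rule orthogonal_int_mat_mult)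
  next
    show "orthogonal_int_mat m (1\<^sub>m m)" by (rule one)
  next
    fix A B C assume "orthogonal_int_mat m A" "orthogonal_int_mat m B" "orthogonal_int_mat m C"
    then show "A * B * C = A * (B * C)" using C(1) by (intro assoc_mult_mat) auto
  next
    fix A assume A: "orthogonal_int_mat m A"
    show "1\<^sub>m m * A = A" using C(1)[OF A] by (rule left_mult_one_mat)
    show "\<exists>B\<in>{A. orthogonal_int_mat m A}. B * A = 1\<^sub>m m"
      using A by (intro bexI[of _ "A\<^sup>T"]) (auto simp: orthogonal_int_mat_def)
  qed
  moreover have neg: "- 1\<^sub>m m * A = - A" "A * - 1\<^sub>m m = - A" if "A \<in> carrier_mat m m" for A :: "int mat"
    using that by (auto simp: uminus_mult_left_mat uminus_mult_right_mat)
  moreover have "orthogonal_int_mat m (- 1\<^sub>m m)"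
  proof -
    have "(- 1\<^sub>m m :: int mat)\<^sup>T = - 1\<^sub>m m" by (rule eq_matI) auto
    then show ?thesis using neg[of "- 1\<^sub>m m"] by (simp add: orthogonal_int_mat_def)
  qed
  moreover have "(- 1\<^sub>m m :: int mat) \<noteq> 1\<^sub>m m"
  proof
    assume "(- 1\<^sub>m m :: int mat) = 1\<^sub>m m"
    then have "(- 1\<^sub>m m :: int mat) $$ (0, 0) = 1\<^sub>m m $$ (0, 0)" by simp
    then show False using assms by simp
  qed
  ultimately show ?thesis using C
    by (auto simp: signed_group_def signed_group_axioms_def signed_perm_group_carrier signed_perm_group_sel neg C(1))
qed

text \<open>Finiteness allows the group to be copied onto natural numbers.\<close>

lemma finite_signed_perm_group: "finite (carrier (signed_perm_group m))"
proof (rule finite_subset)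
  show "carrier (signed_perm_group m) \<subseteq> mat m m ` (({..<m} \<times> {..<m}) \<rightarrow>\<^sub>E {-1, 0, 1})"
  proof
    fix A assume A: "A \<in> carrier (signed_perm_group m)"
    define f where "f = restrict (\<lambda>x. A $$ x) ({..<m} \<times> {..<m})"
    have "A = mat m m f" using A by (auto simp: signed_perm_group_def f_def intro!: eq_matI)
    moreover have "f \<in> ({..<m} \<times> {..<m}) \<rightarrow>\<^sub>E {-1, 0, 1}"
      using A by (auto simp: signed_perm_group_def f_def)
    ultimately show "A \<in> mat m m ` (({..<m} \<times> {..<m}) \<rightarrow>\<^sub>E {-1, 0, 1})" by blast
  qed
qed (intro finite_imageI finite_PiE, auto)

text \<open>J is the imaginary unit. The conditions on transposes make all these integer matrices
  orthogonal, so they are signed permutation matrices.\<close>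

definition clifford_mats :: "nat \<Rightarrow> nat \<Rightarrow> int mat \<Rightarrow> (nat \<Rightarrow> int mat) \<Rightarrow> bool" where
  "clifford_mats m V J E \<longleftrightarrow> J \<in> carrier_mat m m \<and> J\<^sup>T = - J \<and> J * J = - 1\<^sub>m m \<and>
     (\<forall>v<V. E v \<in> carrier_mat m m \<and> (E v)\<^sup>T = E v \<and> E v * E v = 1\<^sub>m m \<and> J * E v = E v * J) \<and>
     (\<forall>v<V. \<forall>w<V. v \<noteq> w \<longrightarrow> E v * E w = - (E w * E v))"

text \<open>The start of the doubling: a first factor 2 of the dimension pays for J.\<close>

lemma clifford_mats_2: "clifford_mats 2 0 (mat 2 2 (\<lambda>(i, j). if i = j then 0 else if i = 0 then - 1 else 1)) E"
  unfolding clifford_mats_def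
  by (auto intro!: eq_matI simp: scalar_prod_def numeral_2_eq_2 less_Suc_eq)

abbreviation square_block :: "nat \<Rightarrow> int mat \<Rightarrow> int mat \<Rightarrow> int mat \<Rightarrow> int mat \<Rightarrow> bool" where
  "square_block m A B C D \<equiv> A \<in> carrier_mat m m \<and> B \<in> carrier_mat m m \<and> C \<in> carrier_mat m m \<and> D \<in> carrier_mat m m"

lemma uminus_four_block_mat:
  "square_block m A B C D \<Longrightarrow> - four_block_mat A B C D = four_block_mat (- A) (- B) (- C) (- D)"
  by (rule eq_matI) auto

text \<open>The Pauli matrices, with J for the imaginary unit: P and, up to sign, Q are the first
  two, and D v multiplies E v by the third. Since J is skew, Q is symmetric, so one doubling gains
  two involutions.\<close>

lemma clifford_mats_double:
  assumes "clifford_mats m V J E"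
  shows "\<exists>J' E'. clifford_mats (2 * m) (V + 2) J' E'"
proof -
  let ?Z = "0\<^sub>m m m :: int mat" and ?I = "1\<^sub>m m :: int mat"
  have J: "J \<in> carrier_mat m m" "J\<^sup>T = - J" "J * J = - ?I"
    and E: "\<And>v. v < V \<Longrightarrow> E v \<in> carrier_mat m m" "\<And>v. v < V \<Longrightarrow> (E v)\<^sup>T = E v"
      "\<And>v. v < V \<Longrightarrow> E v * E v = ?I" "\<And>v. v < V \<Longrightarrow> J * E v = E v * J"
      "\<And>v w. v < V \<Longrightarrow> w < V \<Longrightarrow> v \<noteq> w \<Longrightarrow> E v * E w = - (E w * E v)"
    using assms unfolding clifford_mats_def by blast+
  define J' where "J' = four_block_mat J ?Z ?Z J"
  define P where "P = four_block_mat ?Z ?I ?I ?Z"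
  define Q where "Q = four_block_mat ?Z J (- J) ?Z"
  define D where "D v = four_block_mat (E v) ?Z ?Z (- E v)" for v
  define E' where "E' v = (if v < V then D v else if v = V then P else Q)" for v
  have mult: "four_block_mat A B C D * four_block_mat A' B' C' D' =
      four_block_mat (A * A' + B * C') (A * B' + B * D') (C * A' + D * C') (C * B' + D * D')"
    if "square_block m A B C D" "square_block m A' B' C' D'" for A B C D A' B' C' D' :: "int mat"
    using that by (intro mult_four_block_mat) auto
  have trans: "(four_block_mat A B C D)\<^sup>T = four_block_mat A\<^sup>T C\<^sup>T B\<^sup>T D\<^sup>T"
    if "square_block m A B C D" for A B C D :: "int mat"
    using that by (intro transpose_four_block_mat) auto
  have one: "1\<^sub>m (2 * m) = four_block_mat ?I ?Z ?Z ?I" by (simp add: mult_2)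
  have neg: "- four_block_mat A B C D = four_block_mat (- A) (- B) (- C) (- D)"
    if "square_block m A B C D" for A B C D :: "int mat" using uminus_four_block_mat that .
  have nz: "- ?Z = ?Z" by (rule eq_matI) auto
  have carrier: "four_block_mat A B C D \<in> carrier_mat (2 * m) (2 * m)"
    if "square_block m A B C D" for A B C D :: "int mat"
    using that four_block_carrier_mat[of A m m D m m] by (simp add: mult_2)
  note defs = J'_def P_def Q_def D_def
  have zero: "A * ?Z = ?Z" "?Z * A = ?Z" "A + ?Z = A" "?Z + A = A" if "A \<in> carrier_mat m m" for A
    using that by auto
  have prod: "A * B \<in> carrier_mat m m" "- A * B = - (A * B)" "A * - B = - (A * B)"
    if "A \<in> carrier_mat m m" "B \<in> carrier_mat m m" for A B :: "int mat"
    using that by auto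
  have unit: "A * ?I = A" "?I * A = A" if "A \<in> carrier_mat m m" for A using that by auto
  note rules = mult trans one neg carrier nz zero prod unit J E(1-4)
  have 1: "J' \<in> carrier_mat (2 * m) (2 * m)" "J'\<^sup>T = - J'" "J' * J' = - 1\<^sub>m (2 * m)"
    unfolding defs by (simp_all add: rules del: four_block_one_mat)
  have 2: "E' v \<in> carrier_mat (2 * m) (2 * m)" "(E' v)\<^sup>T = E' v" "E' v * E' v = 1\<^sub>m (2 * m)"
    "J' * E' v = E' v * J'" if "v < V + 2" for v
    unfolding E'_def defs by (simp_all add: rules transpose_uminus del: four_block_one_mat)
  have DD: "D v * D w = - (D w * D v)" if "v < V" "w < V" "v \<noteq> w" for v w
    using that E(5)[OF that] unfolding defs by (simp add: rules del: four_block_one_mat)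
  have DP: "D v * P = - (P * D v)" "D v * Q = - (Q * D v)" if "v < V" for v
    using that unfolding defs by (simp_all add: rules del: four_block_one_mat)
  have PQ: "P * Q = - (Q * P)" unfolding defs by (simp add: rules del: four_block_one_mat)
  have 3: "E' v * E' w = - (E' w * E' v)" if "v < V + 2" "w < V + 2" "v \<noteq> w" for v w
  proof -
    consider "v < V" "w < V" | "v < V" "w = V" | "v < V" "w = V + 1" | "v = V" "w < V" | "v = V" "w = V + 1"
      | "v = V + 1" "w < V" | "v = V + 1" "w = V" using \<open>v < V + 2\<close> \<open>w < V + 2\<close> \<open>v \<noteq> w\<close> by linarith
    then show ?thesis
    proof cases
      case 1
      then show ?thesis using DD[of v w] that by (simp add: E'_def)
    next
      case 2
      then show ?thesis using DP(1)[of v] by (simp add: E'_def)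
    next
      case 3
      then show ?thesis using DP(2)[of v] by (simp add: E'_def)
    next
      case 4
      then show ?thesis using DP(1)[of w] by (simp add: E'_def)
    next
      case 5
      then show ?thesis using PQ by (simp add: E'_def)
    next
      case 6
      then show ?thesis using DP(2)[of w] by (simp add: E'_def)
    next
      case 7
      then show ?thesis using PQ by (simp add: E'_def)
    qed
  qed
  have "clifford_mats (2 * m) (V + 2) J' E'"
    unfolding clifford_mats_def using 1 2 3 by blast
  then show ?thesis by blast
qed

lemma clifford_mats_exist: "\<exists>J E. clifford_mats (2 ^ (a + 1)) (2 * a) J E"
proof (induction a)
  case 0
  show ?case using clifford_mats_2 by auto
next
  case (Suc a)
  then obtain J E where "clifford_mats (2 ^ (a + 1)) (2 * a) J E" by blast
  from clifford_mats_double[OF this] show ?case by simp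
qed

text \<open>The theorem speaks of a group on natural numbers. The structure is copied along an
  injection, and the inverse map will serve as the remrep.\<close>

lemma signed_group_transport_nat:
  fixes G :: "('g, 'm) signed_monoid_scheme"
  assumes "signed_group G" "finite (carrier G)"
  obtains S :: "nat signed_monoid" and h where "signed_group S"
    "\<And>x. x \<in> carrier G \<Longrightarrow> h x \<in> carrier S"
    "\<And>x y. x \<in> carrier G \<Longrightarrow> y \<in> carrier G \<Longrightarrow> h (x \<otimes>\<^bsub>G\<^esub> y) = h x \<otimes>\<^bsub>S\<^esub> h y"
    "h \<one>\<^bsub>G\<^esub> = \<one>\<^bsub>S\<^esub>" "h \<epsilon>\<^bsub>G\<^esub> = \<epsilon>\<^bsub>S\<^esub>"
    "the_inv_into (carrier G) h \<in> hom S G" "the_inv_into (carrier G) h \<epsilon>\<^bsub>S\<^esub> = \<epsilon>\<^bsub>G\<^esub>"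
proof -
  interpret G: signed_group G by fact
  obtain h :: "'g \<Rightarrow> nat" where h: "inj_on h (carrier G)"
    using finite_imp_inj_to_nat_seg[OF assms(2)] by blast
  define g where "g = the_inv_into (carrier G) h"
  have gh: "g (h x) = x" if "x \<in> carrier G" for x
    using that h by (simp add: g_def the_inv_into_f_f)
  define S :: "nat signed_monoid" where
    "S = \<lparr>carrier = h ` carrier G, monoid.mult = (\<lambda>x y. h (g x \<otimes>\<^bsub>G\<^esub> g y)), one = h \<one>\<^bsub>G\<^esub>,
      neg_one = h \<epsilon>\<^bsub>G\<^esub>\<rparr>"
  have S: "carrier S = h ` carrier G" "x \<otimes>\<^bsub>S\<^esub> y = h (g x \<otimes>\<^bsub>G\<^esub> g y)" "\<one>\<^bsub>S\<^esub> = h \<one>\<^bsub>G\<^esub>" "\<epsilon>\<^bsub>S\<^esub> = h \<epsilon>\<^bsub>G\<^esub>"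
    for x y by (simp_all add: S_def)
  have "group S"
  proof (rule groupI)
    fix x assume "x \<in> carrier S"
    then obtain a where a: "a \<in> carrier G" "x = h a" by (auto simp: S)
    then show "\<exists>y\<in>carrier S. y \<otimes>\<^bsub>S\<^esub> x = \<one>\<^bsub>S\<^esub>"
      by (intro bexI[of _ "h (inv\<^bsub>G\<^esub> a)"]) (auto simp: S gh)
  qed (auto simp: S gh G.m_assoc)
  then have "signed_group S"
  proof (rule signed_group.intro[OF _ signed_group_axioms.intro])
    show "\<epsilon>\<^bsub>S\<^esub> \<noteq> \<one>\<^bsub>S\<^esub>" using G.neg_one_neq_one G.neg_one_closed h by (simp add: S inj_on_eq_iff)
    show "\<epsilon>\<^bsub>S\<^esub> \<otimes>\<^bsub>S\<^esub> \<epsilon>\<^bsub>S\<^esub> = \<one>\<^bsub>S\<^esub>" using G.neg_one_square G.neg_one_closed by (simp add: S gh)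
    show "\<epsilon>\<^bsub>S\<^esub> \<in> carrier S" using G.neg_one_closed by (simp add: S)
    show "\<epsilon>\<^bsub>S\<^esub> \<otimes>\<^bsub>S\<^esub> s = s \<otimes>\<^bsub>S\<^esub> \<epsilon>\<^bsub>S\<^esub>" if s: "s \<in> carrier S" for s
    proof -
      obtain a where a: "a \<in> carrier G" "s = h a" using s by (auto simp: S)
      show ?thesis unfolding a(2) S gh[OF a(1)] gh[OF G.neg_one_closed] G.neg_one_central[OF a(1)] ..
    qed
  qed
  moreover have "g \<in> hom S G" by (rule homI) (auto simp: S gh)
  moreover have "g \<epsilon>\<^bsub>S\<^esub> = \<epsilon>\<^bsub>G\<^esub>" using G.neg_one_closed by (simp add: S gh)
  ultimately show thesis by (intro that[of S h]) (auto simp: S gh g_def[symmetric])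
qed

section \<open>The theorem\<close>

lemma clifford_signed_group_exists:
  obtains S :: "nat signed_monoid" and \<pi> I E
  where "clifford_signed_group S I E (2 * a)" "remrep S (2 ^ (a + 1)) \<pi>"
proof -
  define m where "m = (2::nat) ^ (a + 1)"
  obtain J E where JE: "clifford_mats m (2 * a) J E" using clifford_mats_exist[of a] by (auto simp: m_def)
  have J: "J \<in> carrier_mat m m" "J\<^sup>T = - J" "J * J = - 1\<^sub>m m"
    and E: "\<And>v. v < 2 * a \<Longrightarrow> E v \<in> carrier_mat m m" "\<And>v. v < 2 * a \<Longrightarrow> (E v)\<^sup>T = E v"
      "\<And>v. v < 2 * a \<Longrightarrow> E v * E v = 1\<^sub>m m" "\<And>v. v < 2 * a \<Longrightarrow> J * E v = E v * J"
      "\<And>v w. v < 2 * a \<Longrightarrow> w < 2 * a \<Longrightarrow> v \<noteq> w \<Longrightarrow> E v * E w = - (E w * E v)"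
    using JE unfolding clifford_mats_def by blast+
  let ?G = "signed_perm_group m"
  have Jc: "J \<in> carrier ?G"
    using J by (simp add: signed_perm_group_carrier orthogonal_int_mat_def)
  have Ec: "E v \<in> carrier ?G" if "v < 2 * a" for v
    using E(1-3)[OF that] by (simp add: signed_perm_group_carrier orthogonal_int_mat_def)
  have "signed_group ?G" by (rule signed_group_signed_perm_group) (simp add: m_def)
  then interpret G: signed_group ?G .
  obtain S :: "nat signed_monoid" and h where S: "signed_group S"
    and h: "\<And>x. x \<in> carrier ?G \<Longrightarrow> h x \<in> carrier S"
    "\<And>x y. x \<in> carrier ?G \<Longrightarrow> y \<in> carrier ?G \<Longrightarrow> h (x \<otimes>\<^bsub>?G\<^esub> y) = h x \<otimes>\<^bsub>S\<^esub> h y"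
    "h \<one>\<^bsub>?G\<^esub> = \<one>\<^bsub>S\<^esub>" "h \<epsilon>\<^bsub>?G\<^esub> = \<epsilon>\<^bsub>S\<^esub>"
    and rep: "the_inv_into (carrier ?G) h \<in> hom S ?G" "the_inv_into (carrier ?G) h \<epsilon>\<^bsub>S\<^esub> = \<epsilon>\<^bsub>?G\<^esub>"
    using signed_group_transport_nat[OF G.signed_group_axioms finite_signed_perm_group] by metis
  have "clifford_signed_group S (h J) (\<lambda>v. h (E v)) (2 * a)"
  proof (rule clifford_signed_group.intro[OF S clifford_signed_group_axioms.intro])
    show "h J \<in> carrier S" using Jc h(1) by simp
    have "J \<otimes>\<^bsub>?G\<^esub> J = \<epsilon>\<^bsub>?G\<^esub>" using J(3) by (simp add: signed_perm_group_sel)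
    then show "h J \<otimes>\<^bsub>S\<^esub> h J = \<epsilon>\<^bsub>S\<^esub>" using h(2)[OF Jc Jc] h(4) by simp
  next
    fix v assume v: "v < 2 * a"
    show "h (E v) \<in> carrier S" using Ec[OF v] h(1) by simp
    have "E v \<otimes>\<^bsub>?G\<^esub> E v = \<one>\<^bsub>?G\<^esub>" using E(3)[OF v] by (simp add: signed_perm_group_sel)
    then show "h (E v) \<otimes>\<^bsub>S\<^esub> h (E v) = \<one>\<^bsub>S\<^esub>" using h(2)[OF Ec[OF v] Ec[OF v]] h(3) by simp
    have "J \<otimes>\<^bsub>?G\<^esub> E v = E v \<otimes>\<^bsub>?G\<^esub> J" using E(4)[OF v] by (simp add: signed_perm_group_sel)
    then show "h J \<otimes>\<^bsub>S\<^esub> h (E v) = h (E v) \<otimes>\<^bsub>S\<^esub> h J"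
      using h(2)[OF Jc Ec[OF v]] h(2)[OF Ec[OF v] Jc] by simp
    fix w assume w: "w < 2 * a" "v \<noteq> w"
    have "- 1\<^sub>m m * (E w * E v) = - (E w * E v)" using E(1)[OF v] E(1)[OF w(1)] by simp
    then have "E v \<otimes>\<^bsub>?G\<^esub> E w = \<epsilon>\<^bsub>?G\<^esub> \<otimes>\<^bsub>?G\<^esub> (E w \<otimes>\<^bsub>?G\<^esub> E v)"
      unfolding signed_perm_group_sel E(5)[OF v w] by simp
    then show "h (E v) \<otimes>\<^bsub>S\<^esub> h (E w) = \<epsilon>\<^bsub>S\<^esub> \<otimes>\<^bsub>S\<^esub> (h (E w) \<otimes>\<^bsub>S\<^esub> h (E v))"
      using h(2)[OF Ec[OF v] Ec[OF w(1)]] h(2)[OF Ec[OF w(1)] Ec[OF v]] h(4)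
        h(2)[OF G.neg_one_closed G.m_closed[OF Ec[OF w(1)] Ec[OF v]]] by simp
  qed
  moreover have "remrep S (2 ^ (a + 1)) (the_inv_into (carrier ?G) h)"
    using rep unfolding remrep_def m_def by blast
  ultimately show thesis by (rule that)
qed

section \<open>Distributing the positions over the colours\<close>

lemma packing_part:
  assumes "packing M Q m"
  shows "\<exists>Q'. packing (M + a) Q' (m(l := m l + a)) \<and> real Q' \<le> real Q + 8 + 3 / 13 * lg a"
proof -
  consider "a = 0" | "a = 1" | "a div 2 \<ge> 1" by linarith
  then show ?thesis
  proof cases
    case 1
    then show ?thesis using assms by (intro exI[of _ Q]) (simp add: lg_def)
  next
    case 2
    then show ?thesis using packing_single[OF assms, of l] by (intro exI[of _ "Q + 1"]) (simp add: lg_def)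
  next
    case 3
    define v where "v = a div 2"
    obtain c where c: "golay_sum c v" "real c \<le> 47 / 13 + 3 / 26 * log 2 (real v)"
      using golay_sum_log 3 by (auto simp: v_def)
    obtain gs where gs: "length gs \<le> c" "\<forall>g \<in> set gs. golay g" "sum_list gs = v"
      using c(1) unfolding golay_sum_def by blast
    \<comment> \<open>Halving a gains one in the logarithm, worth 3/13 of a sequence; together with
      94/13 for the pairs this leaves room below 8 for the single position of an odd a.\<close>
    have "log 2 (real v) + 1 = log 2 (2 * real v)" using 3 by (simp add: v_def log_mult)
    also have "\<dots> \<le> log 2 (real a)" using 3 by (subst log_le_cancel_iff) (auto simp: v_def)
    finally have lg: "log 2 (real v) + 1 \<le> lg a" using 3 by (cases "a = 0") (simp_all add: lg_def)
    have p: "packing (M + 2 * v) (Q + 2 * length gs) (m(l := m l + 2 * v))"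
      using packing_golay_list[OF assms gs(2)] gs(3) by simp
    show ?thesis
    proof (cases "even a")
      case True
      then have "a = 2 * v" by (simp add: v_def)
      then show ?thesis using p gs(1) c(2) lg by (intro exI[of _ "Q + 2 * length gs"]) auto
    next
      case False
      then have a: "a = 2 * v + 1" by (simp add: v_def)
      have "packing (M + a) (Q + 2 * length gs + 1) (m(l := m l + a))"
        using packing_single[OF p, of l] by (simp add: a add.assoc)
      then show ?thesis using gs(1) c(2) lg by (intro exI[of _ "Q + 2 * length gs + 1"]) auto
    qed
  qed
qed

lemma packing_colours:
  fixes w :: "nat \<Rightarrow> nat"
  assumes "finite A"
  shows "\<exists>Q. packing (sum w A) Q (\<lambda>l. if l \<in> A then w l else 0) \<and>
    real Q \<le> (\<Sum>i\<in>A. 8 + 3 / 13 * lg (w i))"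
  using assms
proof (induction A)
  case empty
  then show ?case using packing_empty by auto
next
  case (insert a A)
  then obtain Q where Q: "packing (sum w A) Q (\<lambda>l. if l \<in> A then w l else 0)"
    "real Q \<le> (\<Sum>i\<in>A. 8 + 3 / 13 * lg (w i))" by blast
  have "(\<lambda>l. if l \<in> A then w l else 0)(a := (if a \<in> A then w a else 0) + w a)
      = (\<lambda>l. if l \<in> insert a A then w l else 0)"
    using insert.hyps by (auto simp: fun_eq_iff)
  then obtain Q' where "packing (sum w A + w a) Q' (\<lambda>l. if l \<in> insert a A then w l else 0)"
    "real Q' \<le> real Q + 8 + 3 / 13 * lg (w a)"
    using packing_part[OF Q(1), of "w a" a] by auto
  then show ?case using Q(2) insert.hyps by (intro exI[of _ Q']) (simp add: add.commute)
qed

theorem theorem8: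
  fixes k :: nat and u :: "nat \<Rightarrow> nat" and utot :: nat
  assumes "k \<ge> 1"
    and "\<forall>i \<in> {1..k}. u i > 0"
    and "\<forall>i \<in> {2..k}. int (lc (u 1)) - int (lc (u 1 - 1)) \<ge> int (lc (u i)) - int (lc (u i - 1))"
    and "(\<Sum>i=1..k. u i) = utot"
  shows "\<exists>(S :: nat signed_monoid) (n :: nat) (\<pi> :: nat \<Rightarrow> int mat) (X :: (nat \<Rightarrow> rpoly) mat).
    signed_group S \<and> remrep S (2 ^ n) \<pi> \<and>
    sod S (4 * utot) k (\<lambda>i. 4 * u i) X \<and>
    full S X \<and> circulant (sg_ring S) (4 * utot) X \<and> quasisymmetric S X \<and>
    real n \<le> 3 / 13 * lg (u 1 - 1) + 3 / 13 * (\<Sum>i=2..k. lg (u i)) + 8 * real k + 2"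
proof -
  \<comment> \<open>One quadruple of colour 1 is already provided by the special positions.\<close>
  define w where "w = u(1 := u 1 - 1)"
  define m where "m l = (if l \<in> {1..k} then w l else 0)" for l
  define n where "n = sum w {1..k}"
  obtain Q where Q: "packing n Q m" "real Q \<le> (\<Sum>i=1..k. 8 + 3 / 13 * lg (w i))"
    using packing_colours[of "{1..k}" w] unfolding n_def m_def by auto
  have range: "{1..k} = insert 1 {2..k}" using assms(1) by auto
  have split: "sum f {1..k} = f 1 + sum f {2..k}" for f :: "nat \<Rightarrow> 'b::comm_monoid_add"
    unfolding range by simp
  have rest: "sum f {2..k} = sum g {2..k}" if "\<And>i. i \<noteq> 1 \<Longrightarrow> f i = g i" for f g :: "nat \<Rightarrow> 'b::comm_monoid_add"
    using that by (intro sum.cong) auto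
  have u1: "u 1 > 0" using assms(1,2) by simp
  have n: "Suc n = utot"
    using u1 rest[of w u] assms(4) unfolding n_def split by (simp add: w_def)
  have "(\<Sum>i=1..k. 8 + 3 / 13 * lg (w i)) = 8 * real k + 3 / 13 * lg (w 1) + 3 / 13 * (\<Sum>i=2..k. lg (w i))"
    unfolding sum.distrib sum_distrib_left[symmetric] split[of "\<lambda>i. lg (w i)"] by (simp add: distrib_left)
  then have bound: "real Q \<le> 8 * real k + 3 / 13 * lg (u 1 - 1) + 3 / 13 * (\<Sum>i=2..k. lg (u i))"
    using Q(2) rest[of "\<lambda>i. lg (w i)" "\<lambda>i. lg (u i)"] by (simp add: w_def)
  have colours: "4 * (m(1 := m 1 + 1)) l = (if l \<in> {1..k} then 4 * u l else 0)" for l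
    using assms(1) u1 by (auto simp: m_def w_def)
  obtain lab wt colour where L:
    "\<And>r. r < 4 * utot \<Longrightarrow> lab r < 2 * (Q + 1)" "\<And>r. r < 4 * utot \<Longrightarrow> wt r \<in> quaternary"
    "\<And>r. r < 4 * utot \<Longrightarrow> lab ((4 * utot - r) mod (4 * utot)) = lab r"
    "\<And>r. r < 4 * utot \<Longrightarrow> wt ((4 * utot - r) mod (4 * utot)) = cnj (wt r)"
    "\<And>l. card {r. r < 4 * utot \<and> colour (lab r) = l} = 4 * (m(1 := m 1 + 1)) l"
    "\<And>l \<omega>. \<omega> ^ (4 * utot) = 1 \<Longrightarrow> (\<Sum>v | v < 2 * (Q + 1) \<and> colour v = l.
       (cmod (\<Sum>r<4 * utot. (if lab r = v then wt r else 0) * \<omega> ^ r))\<^sup>2) = real (4 * (m(1 := m 1 + 1)) l)"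
    by (rule packing_labelling[OF Q(1), unfolded n], rule that) blast+
  \<comment> \<open>One doubling for each of the Q + 1 pairs of labels, and one further factor 2 for
    the imaginary unit: this is the summand 2 in the bound.\<close>
  obtain S :: "nat signed_monoid" and \<pi> I E where
    S: "clifford_signed_group S I E (2 * (Q + 1))" "remrep S (2 ^ (Q + 1 + 1)) \<pi>"
    by (rule clifford_signed_group_exists)
  interpret clifford_signed_group S I E "2 * (Q + 1)" by (rule S(1))
  interpret clifford_labelling S I E "2 * (Q + 1)" "4 * utot" k "\<lambda>i. 4 * u i" lab colour wt
    "\<lambda>l. real (4 * (m(1 := m 1 + 1)) l)"
  proof unfold_locales
    show "4 * utot > 0" using n by simp
    show "card {r. r < 4 * utot \<and> colour (lab r) = l} = (if l \<in> {1..k} then 4 * u l else 0)" for l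
      unfolding L(5) by (rule colours)
    show "4 * u i > 0" if "i \<in> {1..k}" for i using assms(2) that by simp
  qed (fact L(1-4) L(6))+
  show ?thesis
  proof (intro exI conjI)
    show "signed_group S" by (rule signed_group_axioms)
    show "remrep S (2 ^ (Q + 1 + 1)) \<pi>" by (rule S(2))
    show "sod S (4 * utot) k (\<lambda>i. 4 * u i) design" by (rule sod_design)
    show "full S design" by (rule full_design)
    show "circulant (sg_ring S) (4 * utot) design" by (rule circulant_design)
    show "quasisymmetric S design" by (rule quasisymmetric_design)
    show "real (Q + 1 + 1) \<le> 3 / 13 * lg (u 1 - 1) + 3 / 13 * (\<Sum>i=2..k. lg (u i)) + 8 * real k + 2"
      using bound by simp
  qed
qed

end
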